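(* A finitely generated $\mathcal{A}^{\mathbb{R}}(1)$-module $\mathrm{M}$ is free if and only if (1) $\mathrm{M}$ is free as an $\mathbb{M}_2^{\mathbb{R}}$-module, and (2) $\mathbb{F}_2\otimes_{\mathbb{M}_2^{\mathbb{R}}}\mathrm{M}$ is a free $\mathbb{F}_2\otimes_{\mathbb{M}_2^{\mathbb{R}}}\mathcal{A}^{\mathbb{R}}(1)$-module.
   Context: $\mathcal{A}^{\mathbb{R}}=[\mathrm{H}\mathbb{F}_2^{\mathbb{R}},\mathrm{H}\mathbb{F}_2^{\mathbb{R}}]_{*,*}$ is the (bigraded) mod 2 $\mathbb{R}$-motivic Steenrod algebra of Voevodsky. It contains the mod 2 motivic cohomology of a point $\mathbb{M}_2^{\mathbb{R}}=\mathbb{F}_2[\tau,\rho]$, with $\tau,\rho$ in cohomological bidegrees $(0,1)$ and $(1,1)$, and is free as a left $\mathbb{M}_2^{\mathbb{R}}$-module; $\tau$ is not central (one has $\mathrm{Sq}^1(\tau)=\rho$) while $\rho$ is central. $\mathcal{A}^{\mathbb{R}}(1)$ is the subalgebra generated by $\tau,\rho,\mathrm{Sq}^1,\mathrm{Sq}^2$. $\mathbb{F}_2$ is an $\mathbb{M}_2^{\mathbb{R}}$-module via $\mathbb{M}_2^{\mathbb{R}}/(\tau,\rho)=\mathbb{F}_2$, and $\mathbb{F}_2\otimes_{\mathbb{M}_2^{\mathbb{R}}}(-)$ is quotienting by $(\rho,\tau)$. Modules are bigraded left modules. *)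

theory Defs
  imports
    "HOL-Library.Poly_Mapping"
    "HOL-Library.Product_Plus"
    "HOL-Library.Z2"
    "HOL-Algebra.Algebra"
    "HOL-Algebra.Generated_Rings"
    "HOL-Algebra.Algebraic_Closure_Type"
begin

section \<open>The free associative algebra over the field with two elements\<close>

text \<open>
  The \<open>\<real>\<close>-motivic Steenrod algebra enters through Voevodsky's presentation: it is the
  associative algebra over the field with two elements generated by \<open>\<tau>\<close>, \<open>\<rho>\<close> and the
  \<open>Sq\<^sup>i\<close>, subject to \<open>Sq\<^sup>0 = 1\<close>, the commutation relations with \<open>\<tau>\<close> and \<open>\<rho>\<close> given by the
  motivic Cartan formula, and the motivic Adem relations (with Riou's correction of the
  \<open>\<rho>\<close>-terms).

  The free algebra is the monoid algebra of the monoid of words. Words are wrapped in a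
  datatype so that concatenation can serve as the monoid addition which the convolution
  product of \<open>poly_mapping\<close> uses.
\<close>

datatype steenrod_gen = Tau | Rho | Sq nat

datatype steenrod_word = Word (letters: "steenrod_gen list")

instantiation steenrod_word :: monoid_add
begin

definition zero_steenrod_word :: steenrod_word where
  "0 = Word []"

definition plus_steenrod_word :: "steenrod_word \<Rightarrow> steenrod_word \<Rightarrow> steenrod_word" where
  "v + w = Word (letters v @ letters w)"

instance
  by standard (simp_all add: zero_steenrod_word_def plus_steenrod_word_def)

end

type_synonym free_steenrod = "steenrod_word \<Rightarrow>\<^sub>0 bit"

definition gen :: "steenrod_gen \<Rightarrow> free_steenrod" where
  "gen g = Poly_Mapping.single (Word [g]) 1"

abbreviation ftau :: free_steenrod where "ftau \<equiv> gen Tau"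
abbreviation frho :: free_steenrod where "frho \<equiv> gen Rho"
abbreviation fSq :: "nat \<Rightarrow> free_steenrod" where "fSq i \<equiv> gen (Sq i)"

text \<open>Cohomological bidegrees (degree, weight).\<close>

fun gen_bideg :: "steenrod_gen \<Rightarrow> int \<times> int" where
  "gen_bideg Tau = (0, 1)"
| "gen_bideg Rho = (1, 1)"
| "gen_bideg (Sq i) = (int i, int (i div 2))"

definition word_bideg :: "steenrod_word \<Rightarrow> int \<times> int" where
  "word_bideg w = sum_list (map gen_bideg (letters w))"

definition free_homogeneous :: "int \<times> int \<Rightarrow> free_steenrod set" where
  "free_homogeneous d = {x. \<forall>w \<in> Poly_Mapping.keys x. word_bideg w = d}"


section \<open>The motivic Steenrod algebra over the real numbers\<close>

text \<open>
  The right-hand side of the motivic Adem relation for \<open>Sq\<^sup>a Sq\<^sup>b\<close>, \<open>0 < a < 2b\<close>: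
  a factor \<open>\<tau>\<close> occurs at odd \<open>j\<close> if both \<open>a\<close> and \<open>b\<close> are even, and there is a further sum
  with coefficient \<open>\<rho>\<close> if \<open>a\<close> and \<open>b\<close> have different parity. The lower index of the binomial
  coefficient in that sum is \<open>a - 2j\<close> for even \<open>a\<close> and \<open>a - 1 - 2j\<close> for odd \<open>a\<close>. No
  subtraction of natural numbers truncates when \<open>0 < a < 2b\<close>.
\<close>

definition adem_rhs :: "nat \<Rightarrow> nat \<Rightarrow> free_steenrod" where
  "adem_rhs a b =
     (\<Sum>j \<in> {0..a div 2}.
        of_nat ((b - 1 - j) choose (a - 2 * j)) *
        (if even a \<and> even b \<and> odd j then ftau else 1) * fSq (a + b - j) * fSq j)
   + (if even (a + b) then 0 else
      (\<Sum>j \<in> {j \<in> {0..a div 2}. odd j}.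
        of_nat ((b - 1 - j) choose (2 * (a div 2) - 2 * j)) *
        frho * fSq (a + b - 1 - j) * fSq j))"

text \<open>The relations with \<open>\<tau>\<close> are the Cartan formula for \<open>Sq\<^sup>n(\<tau> x)\<close> with
  \<open>Sq\<^sup>1(\<tau>) = \<rho>\<close> and \<open>Sq\<^sup>n(\<tau>) = 0\<close> for \<open>n > 1\<close>.\<close>

inductive_set steenrod_relations :: "free_steenrod set" where
  Sq_zero: "fSq 0 - 1 \<in> steenrod_relations"
| rho_central: "gen g * frho - frho * gen g \<in> steenrod_relations"
| Sq_one_tau: "fSq 1 * ftau - (ftau * fSq 1 + frho) \<in> steenrod_relations"
| Sq_even_tau: "i \<ge> 1 \<Longrightarrow>
    fSq (2 * i) * ftau - (ftau * fSq (2 * i) + frho * ftau * fSq (2 * i - 1))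
      \<in> steenrod_relations"
| Sq_odd_tau: "i \<ge> 1 \<Longrightarrow>
    fSq (2 * i + 1) * ftau
      - (ftau * fSq (2 * i + 1) + frho * fSq (2 * i) + frho * frho * fSq (2 * i - 1))
      \<in> steenrod_relations"
| adem: "0 < a \<Longrightarrow> a < 2 * b \<Longrightarrow> fSq a * fSq b - adem_rhs a b \<in> steenrod_relations"

definition steenrod_ideal :: "free_steenrod set" where
  "steenrod_ideal = genideal ring_of_type_algebra steenrod_relations"

type_synonym steenrod = "free_steenrod set"

definition AR :: "steenrod ring" where
  "AR = ring_of_type_algebra Quot steenrod_ideal"

definition steenrod_class :: "free_steenrod \<Rightarrow> steenrod" where
  "steenrod_class x = steenrod_ideal +>\<^bsub>ring_of_type_algebra\<^esub> x"

definition tau :: steenrod where "tau = steenrod_class ftau"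
definition rho :: steenrod where "rho = steenrod_class frho"
definition SqR :: "nat \<Rightarrow> steenrod" where "SqR i = steenrod_class (fSq i)"

definition AR_grading :: "int \<times> int \<Rightarrow> steenrod set" where
  "AR_grading d = steenrod_class ` free_homogeneous d"

text \<open>As a subring of the Steenrod algebra, the cohomology \<open>F\<^sub>2[\<tau>,\<rho>]\<close> of a point is the
  one generated by \<open>\<tau>\<close> and \<open>\<rho>\<close>. All rings here have characteristic two, so generated
  subrings are generated subalgebras.\<close>

definition M2R :: "steenrod ring" where
  "M2R = AR\<lparr>carrier := generate_ring AR {tau, rho}\<rparr>"

definition A1R :: "steenrod ring" where
  "A1R = AR\<lparr>carrier := generate_ring AR {tau, rho, SqR 1, SqR 2}\<rparr>"

definition A1R_grading :: "int \<times> int \<Rightarrow> steenrod set" where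
  "A1R_grading d = AR_grading d \<inter> carrier A1R"


section \<open>Bigraded left modules\<close>

text \<open>The locale \<open>module\<close> of the library requires a commutative ring.\<close>

locale left_module = R?: ring R + M?: abelian_group M
  for R :: "('r, 's) ring_scheme" (structure) and M :: "('r, 'm, 't) module_scheme" (structure) +
  assumes smult_closed: "\<lbrakk>a \<in> carrier R; x \<in> carrier M\<rbrakk> \<Longrightarrow> a \<odot>\<^bsub>M\<^esub> x \<in> carrier M"
    and smult_l_distr: "\<lbrakk>a \<in> carrier R; b \<in> carrier R; x \<in> carrier M\<rbrakk> \<Longrightarrow>
      (a \<oplus> b) \<odot>\<^bsub>M\<^esub> x = (a \<odot>\<^bsub>M\<^esub> x) \<oplus>\<^bsub>M\<^esub> (b \<odot>\<^bsub>M\<^esub> x)"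
    and smult_r_distr: "\<lbrakk>a \<in> carrier R; x \<in> carrier M; y \<in> carrier M\<rbrakk> \<Longrightarrow>
      a \<odot>\<^bsub>M\<^esub> (x \<oplus>\<^bsub>M\<^esub> y) = (a \<odot>\<^bsub>M\<^esub> x) \<oplus>\<^bsub>M\<^esub> (a \<odot>\<^bsub>M\<^esub> y)"
    and smult_assoc: "\<lbrakk>a \<in> carrier R; b \<in> carrier R; x \<in> carrier M\<rbrakk> \<Longrightarrow>
      (a \<otimes> b) \<odot>\<^bsub>M\<^esub> x = a \<odot>\<^bsub>M\<^esub> (b \<odot>\<^bsub>M\<^esub> x)"
    and smult_one: "x \<in> carrier M \<Longrightarrow> \<one> \<odot>\<^bsub>M\<^esub> x = x"

locale bigraded_left_module = left_module R M
  for R :: "('r, 's) ring_scheme" (structure) and M :: "('r, 'm, 't) module_scheme" (structure) +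
  fixes RG :: "int \<times> int \<Rightarrow> 'r set" and G :: "int \<times> int \<Rightarrow> 'm set"
  assumes graded_subgroup: "additive_subgroup (G d) M"
    and smult_graded: "\<lbrakk>a \<in> RG d; x \<in> G e\<rbrakk> \<Longrightarrow> a \<odot>\<^bsub>M\<^esub> x \<in> G (d + e)"
    and graded_decomposition: "x \<in> carrier M \<Longrightarrow>
      \<exists>!f. (\<forall>d. f d \<in> G d) \<and> finite {d. f d \<noteq> \<zero>\<^bsub>M\<^esub>} \<and>
           x = (\<Oplus>\<^bsub>M\<^esub>d \<in> {d. f d \<noteq> \<zero>\<^bsub>M\<^esub>}. f d)"

definition finitely_generated_module ::
  "('r, 's) ring_scheme \<Rightarrow> ('r, 'm, 't) module_scheme \<Rightarrow> bool" where
  "finitely_generated_module R M \<longleftrightarrow>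
     (\<exists>S. finite S \<and> S \<subseteq> carrier M \<and>
        (\<forall>x \<in> carrier M. \<exists>c \<in> S \<rightarrow> carrier R. x = (\<Oplus>\<^bsub>M\<^esub>s \<in> S. c s \<odot>\<^bsub>M\<^esub> s)))"

definition module_basis ::
  "('r, 's) ring_scheme \<Rightarrow> ('r, 'm, 't) module_scheme \<Rightarrow> 'm set \<Rightarrow> bool" where
  "module_basis R M B \<longleftrightarrow>
     B \<subseteq> carrier M \<and>
     (\<forall>x \<in> carrier M. \<exists>F c. finite F \<and> F \<subseteq> B \<and> c \<in> F \<rightarrow> carrier R \<and>
        x = (\<Oplus>\<^bsub>M\<^esub>b \<in> F. c b \<odot>\<^bsub>M\<^esub> b)) \<and>
     (\<forall>F c. finite F \<and> F \<subseteq> B \<and> c \<in> F \<rightarrow> carrier R \<and>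
        (\<Oplus>\<^bsub>M\<^esub>b \<in> F. c b \<odot>\<^bsub>M\<^esub> b) = \<zero>\<^bsub>M\<^esub> \<longrightarrow> (\<forall>b \<in> F. c b = \<zero>\<^bsub>R\<^esub>))"

text \<open>A bigraded module is free if it is a direct sum of shifts of the ring, that is, if
  it has a basis of homogeneous elements.\<close>

definition bigraded_free ::
  "('r, 's) ring_scheme \<Rightarrow> ('r, 'm, 't) module_scheme \<Rightarrow> (int \<times> int \<Rightarrow> 'm set) \<Rightarrow> bool" where
  "bigraded_free R M G \<longleftrightarrow> (\<exists>B. B \<subseteq> (\<Union>d. G d) \<and> module_basis R M B)"


section \<open>Reduction modulo \<open>\<rho>\<close> and \<open>\<tau>\<close>\<close>

text \<open>\<open>F\<^sub>2 \<otimes> N = N / (\<tau>,\<rho>)N\<close>, the tensor product being over \<open>F\<^sub>2[\<tau>,\<rho>]\<close>, for the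
  left action of \<open>\<tau>\<close> and \<open>\<rho>\<close> on \<open>N\<close>. For \<open>N\<close> the algebra \<open>A1R\<close> the subgroup
  \<open>(\<tau>,\<rho>)N\<close> is a two-sided ideal, although \<open>\<tau>\<close> is not central.\<close>

definition tau_rho_ideal :: "steenrod set" where
  "tau_rho_ideal =
     {(tau \<otimes>\<^bsub>A1R\<^esub> a) \<oplus>\<^bsub>A1R\<^esub> (rho \<otimes>\<^bsub>A1R\<^esub> b) | a b. a \<in> carrier A1R \<and> b \<in> carrier A1R}"

definition F2A1R :: "steenrod set ring" where
  "F2A1R = A1R Quot tau_rho_ideal"

definition tau_rho_submodule :: "(steenrod, 'm, 't) module_scheme \<Rightarrow> 'm set" where
  "tau_rho_submodule M =
     {(tau \<odot>\<^bsub>M\<^esub> x) \<oplus>\<^bsub>M\<^esub> (rho \<odot>\<^bsub>M\<^esub> y) | x y. x \<in> carrier M \<and> y \<in> carrier M}"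

text \<open>The quotient as a module over \<open>F2A1R\<close>, with the action induced on cosets (cf.
  \<open>rcoset_mult\<close>). The fields \<open>mult\<close> and \<open>one\<close>, which the library's record type of
  modules inherits from rings, are irrelevant.\<close>

definition F2_tensor :: "(steenrod, 'm, 't) module_scheme \<Rightarrow> (steenrod set, 'm set) module" where
  "F2_tensor M =
     \<lparr>carrier = a_rcosets\<^bsub>M\<^esub> (tau_rho_submodule M),
      monoid.mult = undefined,
      one = undefined,
      ring.zero = tau_rho_submodule M,
      add = set_add M,
      module.smult = (\<lambda>A C. \<Union>a \<in> A. \<Union>x \<in> C. tau_rho_submodule M +>\<^bsub>M\<^esub> (a \<odot>\<^bsub>M\<^esub> x))\<rparr>"

definition F2_tensor_grading ::
  "(steenrod, 'm, 't) module_scheme \<Rightarrow> (int \<times> int \<Rightarrow> 'm set) \<Rightarrow> int \<times> int \<Rightarrow> 'm set set" where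
  "F2_tensor_grading M G d = (\<lambda>x. tau_rho_submodule M +>\<^bsub>M\<^esub> x) ` G d"

end

theory Submission
  imports Defs
begin

text \<open>
  The algebra \<open>A1R\<close> is spanned over \<open>F\<^sub>2[\<tau>,\<rho>]\<close> by eight monomials in \<open>Sq\<^sup>1\<close> and \<open>Sq\<^sup>2\<close>,
  by the relations \<open>Sq\<^sup>1Sq\<^sup>1 = 0\<close>, \<open>Sq\<^sup>2Sq\<^sup>2 = \<tau>Sq\<^sup>1Sq\<^sup>2Sq\<^sup>1\<close> and
  \<open>Sq\<^sup>1Sq\<^sup>2Sq\<^sup>1Sq\<^sup>2 = Sq\<^sup>2Sq\<^sup>1Sq\<^sup>2Sq\<^sup>1\<close>. They are independent since they act independently on
  the elements \<open>1, \<tau>, \<tau>\<^sup>2, \<tau>\<^sup>3\<close> of the cohomology of the cofiber of \<open>\<eta>\<close>, which is free over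
  \<open>F\<^sub>2[\<tau>,\<rho>]\<close> on \<open>1\<close> and \<open>e = Sq\<^sup>2 1\<close>. That the Steenrod algebra acts there amounts to the
  Adem relations: they hold on \<open>1\<close> and \<open>e\<close> for degree reasons, and their defects on \<open>\<tau>x\<close> are
  combinations of their defects on \<open>x\<close>.

  Hence \<open>A1R\<close> is free of rank eight over \<open>F\<^sub>2[\<tau>,\<rho>]\<close> and a free module satisfies both
  conditions. Conversely, lift a homogeneous basis of the reduction. The lifts span by
  Nakayama's lemma, because the weights of a finitely generated module are bounded below
  while \<open>\<tau>\<close> and \<open>\<rho>\<close> have weight one. The coefficients of a linear relation between the
  lifts lie in \<open>(\<tau>,\<rho>)\<close>. As \<open>\<rho>, \<tau>\<close> is a regular sequence on the module, such a relation is
  \<open>\<tau>\<close> times a relation plus \<open>\<rho>\<close> times a relation, so the coefficients lie in every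
  power of \<open>(\<tau>,\<rho>)\<close> and vanish.
\<close>

section \<open>Adem relations and multiplication by \<open>\<tau>\<close>\<close>

text \<open>\<open>AR\<close> is given by generators and relations, and its definition alone does
  not exclude that these identify too much. Independence of the eight monomials needs a module on
  which every Adem relation holds, although only those of total degree at most six are used to
  reduce words in \<open>sq1\<close> and \<open>sq2\<close>. The cohomology of a point is too small
  for this: the fourth power of tau commutes with \<open>sq1\<close> and \<open>sq2\<close>, so over
  \<open>F_2[rho, tau^4]\<close> an algebra of the expected size has rank 32, while the linear
  endomorphisms of \<open>F_2[rho, tau]\<close> have rank 16. One more cell, reached from 1 by
  \<open>sq2\<close>, is enough. On the two generators almost every operation is zero, so the real
  work is the passage from x to tau x. It must stay within the range of the Adem relations: for i =
  2l - 1 the general rule for \<open>P i * P l\<close> would refer to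
  \<open>P (2l - 1) * Q (l - 1)\<close>, which no Adem relation covers. Hence the separate formulas
  at the upper end. Freeness over \<open>F_2[tau, rho]\<close> enters the converse only through the
  regular sequence. The descent through the powers of (tau, rho) ends because \<open>A1R\<close>
  acts faithfully on pairs of polynomials, where these powers have zero intersection.\<close>

definition zbinom :: "int \<Rightarrow> int \<Rightarrow> nat" where
  "zbinom n k = (if 0 \<le> n \<and> 0 \<le> k then nat n choose nat k else 0)"

lemma zbinom_neg [simp]: "n < 0 \<Longrightarrow> zbinom n k = 0" "k < 0 \<Longrightarrow> zbinom n k = 0"
  by (auto simp: zbinom_def)

lemma zbinom_gt [simp]: "n < k \<Longrightarrow> zbinom n k = 0"
  by (auto simp: zbinom_def nat_less_eq_zless)

lemma zbinom_same [simp]: "zbinom n n = (if 0 \<le> n then 1 else 0)"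
  by (auto simp: zbinom_def)

lemma zbinom_zero [simp]: "zbinom n 0 = (if 0 \<le> n then 1 else 0)"
  by (auto simp: zbinom_def)

text \<open>Extending by 0 to all negative arguments, and not by generalized binomial coefficients,
  leaves 0 over 0 as the only exception: its value 1 is not a sum of two earlier ones. This
  exception is what singles out the upper end of the Adem range.\<close>

lemma zbinom_pascal:
  assumes "n \<noteq> 0 \<or> k \<noteq> 0"
  shows "zbinom n k = zbinom (n - 1) k + zbinom (n - 1) (k - 1)"
proof (cases "0 < n \<and> 0 < k")
  case True
  then obtain n' k' where "nat n = Suc n'" "nat k = Suc k'"
    by (metis gr0_implies_Suc zero_less_nat_eq)
  moreover from this have "nat (n - 1) = n'" "nat (k - 1) = k'" by auto
  ultimately show ?thesis using True by (simp add: zbinom_def)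
next
  case False
  then show ?thesis using assms
    by (cases "n < 0"; cases "k < 0"; cases "k = 0"; cases "n = 0") (auto simp: zbinom_def)
qed

lemma diff_one_one: "x - 1 - 1 = x - (2::int)"
  by simp

text \<open>\<open>P i\<close> and \<open>Q i\<close> stand for \<open>Sq\<^sup>2\<^sup>i\<close> and \<open>Sq\<^sup>2\<^sup>i\<^sup>+\<^sup>1\<close>.\<close>

locale motivic_squares =
  fixes t r :: "'e::ring_1" and P Q :: "int \<Rightarrow> 'e"
  assumes char_two: "x + x = (0::'e)"
    and r_t: "t * r = r * t"
    and P_r: "P i * r = r * P i"
    and Q_r: "Q i * r = r * Q i"
    and P_t: "P i * t = t * P i + r * (t * Q (i - 1))"
    and Q_t: "Q i * t = t * Q i + (r * P i + r * (r * Q (i - 1)))"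
    and P_neg: "i < 0 \<Longrightarrow> P i = 0"
    and Q_neg: "i < 0 \<Longrightarrow> Q i = 0"
    and P_zero: "P 0 = 1"
    and Q_zero_P: "Q 0 * P i = Q i"
    and Q_zero_Q: "Q 0 * Q i = 0"
begin

lemma char_two_left: "x + (x + y) = (y::'e)"
  using char_two[of x] by (simp add: add.assoc[symmetric])

lemma add_eq_zero_iff: "x + y = 0 \<longleftrightarrow> x = (y::'e)"
  by (metis char_two char_two_left add.right_neutral)

lemma of_nat_left_commute: "x * (of_nat n * y) = of_nat n * (x * (y::'e))"
  by (metis mult.assoc mult_of_nat_commute)

lemma left_commutations:
  "t * (r * x) = r * (t * x)" "P i * (r * x) = r * (P i * x)" "Q i * (r * x) = r * (Q i * x)"
  "P i * (t * x) = t * (P i * x) + r * (t * (Q (i - 1) * x))"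
  "Q i * (t * x) = t * (Q i * x) + (r * (P i * x) + r * (r * (Q (i - 1) * x)))"
  "Q 0 * (P i * x) = Q i * x" "Q 0 * (Q i * x) = 0"
       apply (metis mult.assoc r_t)
      apply (metis mult.assoc P_r)
     apply (metis mult.assoc Q_r)
    apply (simp add: mult.assoc[symmetric] P_t distrib_right)
   apply (simp add: mult.assoc[symmetric] Q_t distrib_right)
  apply (simp_all add: mult.assoc[symmetric] Q_zero_P Q_zero_Q)
  done

text \<open>Turns an expression into a sum of monomials with the numerical coefficient first, then
  \<open>r\<close>, then \<open>t\<close>, then the operators. What remains is the cancellation of
  equal pairs, left to \<open>cancel_simps\<close>.\<close>

lemmas normal_form = mult.assoc[where 'a='e] distrib_left[where 'a='e] distrib_right[where 'a='e] r_t P_r Q_r P_t Q_t Q_zero_P Q_zero_Q left_commutations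
  of_nat_left_commute of_nat_add add.assoc[where 'a='e]

lemmas cancel_simps = add.left_commute[where 'a='e] add.commute[where 'a='e] char_two char_two_left

text \<open>The right-hand sides of the Adem relations for \<open>P i P l\<close> and \<open>P i Q l\<close>; modulo two, the
  binomial coefficients are those of the halved indices. The relations for \<open>Q i\<close> on the left
  follow by multiplication with \<open>Q 0\<close>. The terms with negative \<open>m\<close> vanish, they only keep the
  indices \<open>l - 2\<close> and \<open>l - 1\<close> in range.\<close>

definition adem_even_sum :: "nat \<Rightarrow> int \<Rightarrow> int \<Rightarrow> 'e" where
  "adem_even_sum K i l = (\<Sum>m\<in>{-2..int K}. of_nat (zbinom (l - 1 - m) (i - 2 * m)) * (P (i + l - m) * P m)
     + of_nat (zbinom (l - 1 - m) (i - 2 * m - 1)) * (t * (Q (i + l - m - 1) * Q m)))"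

definition adem_odd_sum :: "nat \<Rightarrow> int \<Rightarrow> int \<Rightarrow> 'e" where
  "adem_odd_sum K i l = (\<Sum>m\<in>{-2..int K}. of_nat (zbinom (l - m) (i - 2 * m)) * (Q (i + l - m) * P m)
     + of_nat (zbinom (l - m - 1) (i - 2 * m - 1)) * ((P (i + l - m) + r * Q (i + l - m - 1)) * Q m))"

text \<open>Moving \<open>t\<close> past \<open>P m\<close> or \<open>Q m\<close> creates
  \<open>Q (m - 1)\<close>; the shift realigns such terms with the index m. In the applications the
  end terms vanish because \<open>Q\<close> is 0 at negative indices and the binomial coefficients
  are 0 beyond \<open>K\<close>.\<close>

lemma sum_shift:
  fixes h :: "int \<Rightarrow> 'e"
  assumes "h (-2) = 0" "h (int K + 1) = 0"
  shows "(\<Sum>m\<in>{-2..int K}. h m) = (\<Sum>m\<in>{-2..int K}. h (m + 1))"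
proof -
  have "(\<Sum>m\<in>{-2..int K}. h (m + 1)) = (\<Sum>m\<in>{-1..int K + 1}. h m)"
    by (rule sum.reindex_bij_witness[of _ "\<lambda>m. m - 1" "\<lambda>m. m + 1"]) auto
  also have "\<dots> = (\<Sum>m\<in>{-2..int K + 1}. h m)"
    using assms by (intro sum.mono_neutral_left) (auto, smt (verit))
  also have "\<dots> = (\<Sum>m\<in>{-2..int K}. h m)"
    using assms by (intro sum.mono_neutral_right) (auto, smt (verit))
  finally show ?thesis by simp
qed

text \<open>The right-hand side is what moving \<open>t\<close> to the left through
  \<open>P i * P l\<close> produces, with each of the four resulting products replaced by its Adem
  sum and \<open>Q (i - 1)\<close> written as \<open>Q 0 * P (i - 1)\<close>.\<close>

lemma adem_even_sum_t:
  assumes "i \<le> 2 * l - 2" "i \<le> int K"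
  shows "adem_even_sum K i l * t = t * adem_even_sum K i l + r * (t * (Q 0 * adem_even_sum K (i - 1) l)) + r * (t * adem_odd_sum K i (l - 1))
    + r * (r * (t * (Q 0 * adem_odd_sum K (i - 1) (l - 1))))"
proof -
  define N where "N = i + l"
  \<comment> \<open>\<open>U\<close> collects the terms that keep the index m after \<open>t\<close>
    has passed, \<open>h\<close> those in which \<open>Q (m - 1)\<close> has appeared.\<close>
  define U where "U m = of_nat (zbinom (l - 1 - m) (i - 2 * m)) *
      (t * (P (N - m) * P m) + r * (t * (Q (N - m - 1) * P m)))
    + of_nat (zbinom (l - 1 - m) (i - 2 * m - 1)) *
      (t * (t * (Q (N - m - 1) * Q m)) + r * (t * (P (N - m - 1) * Q m))
        + r * (r * (t * (Q (N - m - 2) * Q m))) + r * (t * (Q (N - m - 1) * P m)))" for m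
  define h where "h m = of_nat (zbinom (l - 1 - m) (i - 2 * m)) *
      (r * (t * (P (N - m) * Q (m - 1))) + r * (r * (t * (Q (N - m - 1) * Q (m - 1)))))
    + of_nat (zbinom (l - 1 - m) (i - 2 * m - 1)) * (r * (r * (t * (Q (N - m - 1) * Q (m - 1)))))" for m
  have "adem_even_sum K i l * t = (\<Sum>m\<in>{-2..int K}. U m + h m)"
    unfolding adem_even_sum_def sum_distrib_right
    by (rule sum.cong, simp, simp only: U_def h_def N_def normal_form diff_one_one, simp only: cancel_simps)
  also have "\<dots> = (\<Sum>m\<in>{-2..int K}. U m + h (m + 1))"
    using sum_shift[of h K] assms by (simp add: sum.distrib h_def Q_neg)
  also have "\<dots> = t * adem_even_sum K i l + r * (t * (Q 0 * adem_even_sum K (i - 1) l)) + r * (t * adem_odd_sum K i (l - 1))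
    + r * (r * (t * (Q 0 * adem_odd_sum K (i - 1) (l - 1))))"
    unfolding adem_even_sum_def adem_odd_sum_def sum_distrib_left sum.distrib[symmetric]
  proof (rule sum.cong[OF refl], goal_cases)
    case (1 m)
    \<comment> \<open>The bound \<open>i \<le> 2 * l - 2\<close> keeps both uses of Pascal's rule
      away from 0 over 0, which would mean i = 2l - 1 or i = 2l.\<close>
    have 1: "zbinom (l - 1 - m) (i - 2 * m - 1) = zbinom (l - 2 - m) (i - 2 * m - 1) + zbinom (l - 2 - m) (i - 2 * m - 2)"
      using zbinom_pascal[of "l - 1 - m" "i - 2 * m - 1"] assms by (auto simp: algebra_simps)
    have 2: "zbinom (l - 1 - m) (i - 2 * m - 2) = zbinom (l - 2 - m) (i - 2 * m - 2) + zbinom (l - 2 - m) (i - 2 * m - 3)"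
      using zbinom_pascal[of "l - 1 - m" "i - 2 * m - 2"] assms by (auto simp: algebra_simps)
    have e: "l - 1 - (m + 1) = l - 2 - m" "i - 2 * (m + 1) = i - 2 * m - 2" "i - 2 * m - 2 - 1 = i - 2 * m - 3"
      "N - (m + 1) = N - m - 1" "m + 1 - 1 = m" "i - 1 - 2 * m = i - 2 * m - 1" "i - 2 * m - 1 - 1 = i - 2 * m - 2"
      "i - 1 + l - m = N - m - 1" "N - m - 1 - 1 = N - m - 2" "i + l - m = N - m" "l - 1 - m - 1 = l - 2 - m"
      "i + (l - 1) - m = N - m - 1" "i - 1 + (l - 1) - m = N - m - 2"
      by (auto simp: N_def)
    show ?case
      by (simp only: U_def h_def e 1 2 normal_form) (simp add: cancel_simps P_zero Q_neg)
  qed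
  finally show ?thesis .
qed

text \<open>The same comparison with \<open>P i * Q l * t\<close>, where \<open>Q l * t\<close> has
  three terms.\<close>

lemma adem_odd_sum_t:
  assumes "i \<le> 2 * l - 2" "i \<le> int K"
  shows "adem_odd_sum K i l * t = t * adem_odd_sum K i l + r * (t * (Q 0 * adem_odd_sum K (i - 1) l)) + r * adem_even_sum K i l
    + r * (r * adem_odd_sum K i (l - 1))"
proof -
  define N where "N = i + l"
  define U where "U m = of_nat (zbinom (l - m) (i - 2 * m)) *
      ((t * Q (N - m) + r * P (N - m) + r * (r * Q (N - m - 1))) * P m)
    + of_nat (zbinom (l - m - 1) (i - 2 * m - 1)) *
      ((t * P (N - m) + r * (r * P (N - m - 1)) + r * (r * (r * Q (N - m - 2)))) * Q m
        + r * ((P (N - m) + r * Q (N - m - 1)) * P m))" for m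
  define h where "h m = of_nat (zbinom (l - m) (i - 2 * m)) *
      (r * ((t * Q (N - m) + r * P (N - m) + r * (r * Q (N - m - 1))) * Q (m - 1)))
    + of_nat (zbinom (l - m - 1) (i - 2 * m - 1)) *
      (r * (r * ((P (N - m) + r * Q (N - m - 1)) * Q (m - 1))))" for m
  have "adem_odd_sum K i l * t = (\<Sum>m\<in>{-2..int K}. U m + h m)"
    unfolding adem_odd_sum_def sum_distrib_right
    by (rule sum.cong, simp, simp only: U_def h_def N_def normal_form diff_one_one, simp only: cancel_simps)
  also have "\<dots> = (\<Sum>m\<in>{-2..int K}. U m + h (m + 1))"
    using sum_shift[of h K] assms by (simp add: sum.distrib h_def Q_neg)
  also have "\<dots> = t * adem_odd_sum K i l + r * (t * (Q 0 * adem_odd_sum K (i - 1) l)) + r * adem_even_sum K i l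
    + r * (r * adem_odd_sum K i (l - 1))"
    unfolding adem_even_sum_def adem_odd_sum_def sum_distrib_left sum.distrib[symmetric]
  proof (rule sum.cong[OF refl], goal_cases)
    case (1 m)
    have 1: "zbinom (l - 1 - m) (i - 2 * m - 1) = zbinom (l - 2 - m) (i - 2 * m - 1) + zbinom (l - 2 - m) (i - 2 * m - 2)"
      using zbinom_pascal[of "l - 1 - m" "i - 2 * m - 1"] assms by (auto simp: algebra_simps)
    have 2: "zbinom (l - 1 - m) (i - 2 * m - 2) = zbinom (l - 2 - m) (i - 2 * m - 2) + zbinom (l - 2 - m) (i - 2 * m - 3)"
      using zbinom_pascal[of "l - 1 - m" "i - 2 * m - 2"] assms by (auto simp: algebra_simps)
    have 3: "zbinom (l - m) (i - 2 * m) = zbinom (l - 1 - m) (i - 2 * m) + zbinom (l - 1 - m) (i - 2 * m - 1)"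
      using zbinom_pascal[of "l - m" "i - 2 * m"] assms by (auto simp: algebra_simps)
    have e: "l - (m + 1) = l - 1 - m" "l - m - 1 = l - 1 - m" "i - 2 * (m + 1) = i - 2 * m - 2" "i - 2 * m - 2 - 1 = i - 2 * m - 3"
      "N - (m + 1) = N - m - 1" "m + 1 - 1 = m" "i - 1 - 2 * m = i - 2 * m - 1" "i - 2 * m - 1 - 1 = i - 2 * m - 2"
      "i - 1 + l - m = N - m - 1" "N - m - 1 - 1 = N - m - 2" "i + l - m = N - m" "l - 1 - m - 1 = l - 2 - m"
      "i + (l - 1) - m = N - m - 1"
      by (auto simp: N_def)
    show ?case
      by (simp only: U_def h_def e 1 2 3 normal_form) (simp add: cancel_simps P_zero Q_neg)
  qed
  finally show ?thesis .
qed

text \<open>Pascal's rule fails for the coefficient \<open>0\<close> over \<open>0\<close>. It would be needed for \<open>i\<close> at the upper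
  end of the range of the Adem relations, where the sums have at most three terms.\<close>

lemma sum_three:
  fixes f :: "int \<Rightarrow> 'e"
  assumes "0 \<le> l" "l \<le> int K" "\<And>m. m < l - 2 \<or> l < m \<Longrightarrow> f m = 0"
  shows "(\<Sum>m\<in>{-2..int K}. f m) = f (l - 2) + f (l - 1) + f l"
proof -
  have "(\<Sum>m\<in>{-2..int K}. f m) = (\<Sum>m\<in>{l - 2, l - 1, l}. f m)"
    using assms(1,2) by (intro sum.mono_neutral_right) (auto intro!: assms(3))
  then show ?thesis by (simp add: add.assoc)
qed

text \<open>A nonzero coefficient at m forces i - l \<le> m \<le> l, so for i \<ge> 2l - 2 only m =
  l - 2, l - 1, l can contribute.\<close>

lemma adem_sum_boundary:
  assumes "0 \<le> l" "l \<le> int K"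
  shows "adem_even_sum K (2 * l - 1) l = t * (Q (2 * l - 1) * Q (l - 1))"
    and "adem_even_sum K (2 * l - 2) l = P (2 * l - 1) * P (l - 1) + t * (Q (2 * l - 1) * Q (l - 2))"
    and "adem_odd_sum K (2 * l) l = Q (2 * l) * P l"
    and "adem_odd_sum K (2 * l - 1) l = Q (2 * l) * P (l - 1) + (P (2 * l) + r * Q (2 * l - 1)) * Q (l - 1)"
    and "adem_odd_sum K (2 * l - 2) l = Q (2 * l) * P (l - 2) + Q (2 * l - 1) * P (l - 1)
       + (P (2 * l) + r * Q (2 * l - 1)) * Q (l - 2)"
  unfolding adem_even_sum_def adem_odd_sum_def by (subst sum_three[OF assms]; auto simp: cancel_simps)+

text \<open>The difference of the two sides of an Adem relation, written as a sum in characteristic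
  two.\<close>

definition even_defect :: "nat \<Rightarrow> int \<Rightarrow> int \<Rightarrow> 'e" where
  "even_defect K i l = P i * P l + adem_even_sum K i l"

definition odd_defect :: "nat \<Rightarrow> int \<Rightarrow> int \<Rightarrow> 'e" where
  "odd_defect K i l = P i * Q l + adem_odd_sum K i l"

text \<open>The product and its Adem sum obey one and the same commutation rule with
  \<open>t\<close>, so the defect inherits it.\<close>

lemma even_defect_t:
  assumes "i \<le> 2 * l - 2" "i \<le> int K"
  shows "even_defect K i l * t = t * even_defect K i l + r * (t * (Q 0 * even_defect K (i - 1) l)) + r * (t * odd_defect K i (l - 1))
    + r * (r * (t * (Q 0 * odd_defect K (i - 1) (l - 1))))"
  using adem_even_sum_t[OF assms] by (simp add: even_defect_def odd_defect_def normal_form cancel_simps)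

lemma odd_defect_t:
  assumes "i \<le> 2 * l - 2" "i \<le> int K"
  shows "odd_defect K i l * t = t * odd_defect K i l + r * (t * (Q 0 * odd_defect K (i - 1) l)) + r * even_defect K i l
    + r * (r * odd_defect K i (l - 1))"
  using adem_odd_sum_t[OF assms] by (simp add: even_defect_def odd_defect_def normal_form cancel_simps)

text \<open>The general rule would involve \<open>odd_defect\<close> at (2l - 1, l - 1), which lies
  outside the range of the relations. With the explicit sums the odd defects drop out
  altogether.\<close>

lemma even_defect_boundary_t:
  assumes "0 \<le> l" "l \<le> int K"
  shows "even_defect K (2 * l - 1) l * t = t * even_defect K (2 * l - 1) l + r * (t * (Q 0 * even_defect K (2 * l - 2) l))"
  unfolding even_defect_def adem_sum_boundary[OF assms] by (simp only: normal_form diff_diff_eq) (simp add: cancel_simps P_zero Q_neg)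

text \<open>Of the defects in the general rule, those at (2l, l - 1) and the even one at (2l, l) are
  out of range. A multiple of the admissible \<open>even_defect\<close> at (2l - 1, l) takes their
  place.\<close>

lemma odd_defect_boundary_t:
  assumes "0 \<le> l" "l \<le> int K"
  shows "odd_defect K (2 * l) l * t =
      t * odd_defect K (2 * l) l + r * (t * (Q 0 * odd_defect K (2 * l - 1) l)) + r * (r * (Q 0 * even_defect K (2 * l - 1) l))"
  unfolding even_defect_def odd_defect_def adem_sum_boundary[OF assms] by (simp only: normal_form diff_diff_eq) (simp add: cancel_simps P_zero Q_neg)

text \<open>Only \<open>odd_defect\<close> at (2l - 1, l - 1) is out of range here; it is traded for
  the one at (2l - 2, l - 1), the last admissible first index, at the cost of a factor
  \<open>r * Q 0\<close>.\<close>

lemma odd_defect_boundary_t':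
  assumes "1 \<le> l" "l \<le> int K"
  shows "odd_defect K (2 * l - 1) l * t =
      t * odd_defect K (2 * l - 1) l + r * (t * (Q 0 * odd_defect K (2 * l - 2) l)) + r * even_defect K (2 * l - 1) l
      + r * (r * (r * (Q 0 * odd_defect K (2 * l - 2) (l - 1))))"
proof -
  have "adem_odd_sum K (2 * l - 2) (l - 1) = Q (2 * l - 2) * P (l - 1)"
    using adem_sum_boundary(3)[of "l - 1" K] assms by simp
  then show ?thesis
    using assms unfolding even_defect_def odd_defect_def by (simp only: adem_sum_boundary) (simp only: normal_form diff_diff_eq, simp add: cancel_simps P_zero Q_neg)
qed

lemma even_defect_neg: "i < 0 \<Longrightarrow> even_defect K i l = 0"
  and odd_defect_neg: "i < 0 \<Longrightarrow> odd_defect K i l = 0"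
proof -
  assume i: "i < 0"
  have zbinom: "zbinom n (i - 2 * m) = 0" "zbinom n (i - 2 * m - 1) = 0" if "0 \<le> m" for n m
    using i that by simp_all
  have "of_nat (zbinom n (i - 2 * m)) * (x * P m) = 0" for n m x
    by (cases "m < 0") (simp_all add: zbinom P_neg)
  moreover have "of_nat (zbinom n (i - 2 * m - 1)) * (x * Q m) = 0" for n m x
    by (cases "m < 0") (simp_all add: zbinom Q_neg)
  moreover have "of_nat (zbinom n (i - 2 * m - 1)) * (t * (x * Q m)) = 0" for n m x
    by (cases "m < 0") (simp_all add: zbinom Q_neg)
  ultimately show "even_defect K i l = 0" "odd_defect K i l = 0"
    using i by (simp_all add: even_defect_def odd_defect_def adem_even_sum_def adem_odd_sum_def P_neg)
qed

text \<open>For the annihilator \<open>L\<close> of \<open>x\<close> this carries the Adem relations over from \<open>x\<close> to \<open>\<tau>x\<close>.\<close>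

lemma left_ideal_t:
  assumes add: "\<And>x y. x \<in> L \<Longrightarrow> y \<in> L \<Longrightarrow> x + y \<in> L"
    and mult: "\<And>x y. y \<in> L \<Longrightarrow> x * y \<in> L"
    and even_defect: "\<And>i l. i < 2 * l \<Longrightarrow> i \<le> int K \<Longrightarrow> l \<le> int K \<Longrightarrow> even_defect K i l \<in> L"
    and odd_defect: "\<And>i l. i \<le> 2 * l \<Longrightarrow> i \<le> int K \<Longrightarrow> l \<le> int K \<Longrightarrow> odd_defect K i l \<in> L"
    and K: "i \<le> int K" "l \<le> int K"
  shows "i < 2 * l \<Longrightarrow> even_defect K i l * t \<in> L"
    and "i \<le> 2 * l \<Longrightarrow> odd_defect K i l * t \<in> L"
proof -
  have zero: "0 \<in> L"
    using mult[OF odd_defect[of "-1" 0], of 0] by simp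
  show "even_defect K i l * t \<in> L" if "i < 2 * l"
  proof (cases "i = 2 * l - 1")
    case True
    show ?thesis
    proof (cases "i < 0")
      case False
      then have "0 \<le> l" using True by simp
      then show ?thesis
        unfolding True using K that True
        by (subst even_defect_boundary_t) (auto intro!: add mult even_defect)
    qed (simp add: even_defect_neg zero)
  next
    case False
    with that show ?thesis
      using K by (subst even_defect_t) (auto intro!: add mult even_defect odd_defect)
  qed
  show "odd_defect K i l * t \<in> L" if il: "i \<le> 2 * l"
  proof (cases "i < 0")
    case True
    then show ?thesis by (simp add: odd_defect_neg zero)
  next
    case False
    consider "i = 2 * l" | "i = 2 * l - 1" | "i \<le> 2 * l - 2"
      using il by linarith
    then show ?thesis
    proof cases
      case 1
      with False K have "0 \<le> l" "2 * l \<le> int K" by simp_all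
      then show ?thesis
        unfolding 1 by (subst odd_defect_boundary_t) (linarith | intro add mult even_defect odd_defect)+
    next
      case 2
      with False K have "1 \<le> l" "2 * l - 1 \<le> int K" by simp_all
      moreover have "l \<le> int K" using \<open>2 * l - 1 \<le> int K\<close> \<open>1 \<le> l\<close> by linarith
      ultimately show ?thesis
        unfolding 2 odd_defect_boundary_t'[OF \<open>1 \<le> l\<close> \<open>l \<le> int K\<close>]
        by (intro add mult even_defect odd_defect) simp_all
    next
      case 3
      with False K have "0 < l" by simp
      with 3 K show ?thesis
        unfolding odd_defect_t[OF 3 K(1)] by (intro add mult even_defect odd_defect) simp_all
    qed
  qed
qed

end

section \<open>Binomial coefficients modulo two\<close>

lemma even_binomial:
  "even ((2 * n) choose (2 * k)) \<longleftrightarrow> even (n choose k)"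
  "even ((2 * n) choose Suc (2 * k))"
proof -
  \<comment> \<open>Lucas' theorem for the last binary digit. Raising the upper index by two applies
    Pascal's rule twice, and the middle term then occurs with coefficient 2.\<close>
  have "(even ((2 * n) choose (2 * k)) \<longleftrightarrow> even (n choose k)) \<and> even ((2 * n) choose Suc (2 * k))" for k
  proof (induction n arbitrary: k)
    case 0
    then show ?case by (cases k) auto
  next
    case (Suc n)
    have e: "2 * Suc n = Suc (Suc (2 * n))" "\<And>k. 2 * Suc k = Suc (Suc (2 * k))" by simp_all
    show ?case
    proof (cases k)
      case 0
      then show ?thesis by simp
    next
      case (Suc k')
      then show ?thesis
        using Suc.IH[of k'] Suc.IH[of "Suc k'"] unfolding Suc e by simp
    qed
  qed
  then show "even ((2 * n) choose (2 * k)) \<longleftrightarrow> even (n choose k)" "even ((2 * n) choose Suc (2 * k))"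
    by blast+
qed

lemma even_binomial_Suc:
  "even (Suc (2 * n) choose (2 * k)) \<longleftrightarrow> even (n choose k)"
  "even (Suc (2 * n) choose Suc (2 * k)) \<longleftrightarrow> even (n choose k)"
proof -
  show "even (Suc (2 * n) choose (2 * k)) \<longleftrightarrow> even (n choose k)"
  proof (cases k)
    case (Suc k')
    have e: "2 * Suc k' = Suc (Suc (2 * k'))" by simp
    show ?thesis
      using even_binomial(1)[of n "Suc k'"] even_binomial(2)[of n k'] unfolding Suc e by simp
  qed simp
  show "even (Suc (2 * n) choose Suc (2 * k)) \<longleftrightarrow> even (n choose k)"
    using even_binomial[of n k] by simp
qed

lemma sum_parity:
  fixes f :: "nat \<Rightarrow> 'a::comm_monoid_add"
  shows "(\<Sum>j\<in>{0..i}. f j) =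
    (\<Sum>m\<in>{0..i}. (if 2 * m \<le> i then f (2 * m) else 0) + (if Suc (2 * m) \<le> i then f (Suc (2 * m)) else 0))"
proof -
  define F where "F j = (if j \<le> i then f j else 0)" for j
  have *: "(\<Sum>m\<in>{0..n}. F (2 * m) + F (Suc (2 * m))) = (\<Sum>j\<in>{0..Suc (2 * n)}. F j)" for n
    by (induction n) (simp_all add: add.assoc)
  have "(\<Sum>j\<in>{0..i}. f j) = (\<Sum>j\<in>{0..Suc (2 * i)}. F j)"
    by (rule sum.mono_neutral_cong_left) (auto simp: F_def)
  then show ?thesis
    unfolding *[symmetric] by (simp add: F_def)
qed

section \<open>From the halved indices back to the Adem relations of the presentation\<close>

context motivic_squares
begin

definition Sqe :: "nat \<Rightarrow> 'e" where
  "Sqe n = (if even n then P (int (n div 2)) else Q (int (n div 2)))"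

lemma Sqe_even: "Sqe (2 * n) = P (int n)" and Sqe_odd: "Sqe (Suc (2 * n)) = Q (int n)"
  by (simp_all add: Sqe_def)

lemma of_nat_parity: "even n = even m \<Longrightarrow> of_nat n = (of_nat m :: 'e)"
proof -
  have "of_nat n = (if even n then 0 else 1 :: 'e)" for n
    by (induction n) (auto simp: char_two)
  then show "even n = even m \<Longrightarrow> of_nat n = (of_nat m :: 'e)" by metis
qed

lemma sum_int_nat:
  fixes f :: "int \<Rightarrow> 'e"
  assumes "i \<le> K" "\<And>m. m < 0 \<or> int i < m \<Longrightarrow> f m = 0"
  shows "(\<Sum>m\<in>{-2..int K}. f m) = (\<Sum>m\<in>{0..i}. f (int m))"
proof -
  have "(\<Sum>m\<in>{-2..int K}. f m) = (\<Sum>m\<in>{0..int i}. f m)"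
    using assms by (intro sum.mono_neutral_right) auto
  also have "\<dots> = (\<Sum>m\<in>{0..i}. f (int m))"
    by (rule sum.reindex_bij_witness[of _ int nat]) auto
  finally show ?thesis .
qed

text \<open>\<open>adem_term\<close>, \<open>rho_term\<close> and \<open>adem_sum\<close> copy the
  shape of \<open>adem_rhs\<close> literally, so that the image of \<open>adem_rhs\<close> under a
  representation can be matched term by term.\<close>

definition adem_term :: "nat \<Rightarrow> nat \<Rightarrow> nat \<Rightarrow> 'e" where
  "adem_term a b j = of_nat ((b - 1 - j) choose (a - 2 * j)) *
     (if even a \<and> even b \<and> odd j then t else 1) * Sqe (a + b - j) * Sqe j"

definition rho_term :: "nat \<Rightarrow> nat \<Rightarrow> nat \<Rightarrow> 'e" where
  "rho_term a b j = of_nat ((b - 1 - j) choose (2 * (a div 2) - 2 * j)) * r * Sqe (a + b - 1 - j) * Sqe j"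

definition adem_sum :: "nat \<Rightarrow> nat \<Rightarrow> 'e" where
  "adem_sum a b = (\<Sum>j \<in> {0..a div 2}. adem_term a b j)
   + (if even (a + b) then 0 else \<Sum>j \<in> {j \<in> {0..a div 2}. odd j}. rho_term a b j)"

lemma odd_sum:
  fixes f :: "nat \<Rightarrow> 'e"
  shows "(\<Sum>j \<in> {j \<in> {0..i}. odd j}. f j) = (\<Sum>m\<in>{0..i}. if Suc (2 * m) \<le> i then f (Suc (2 * m)) else 0)"
proof -
  have "(\<Sum>j \<in> {j \<in> {0..i}. odd j}. f j) = (\<Sum>j \<in> {0..i}. if odd j then f j else 0)"
    by (rule sum.inter_filter) simp
  then show ?thesis by (subst (asm) sum_parity) (simp add: if_distrib cong: if_cong)
qed

lemma adem_even_sum_nat: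
  assumes "i \<le> K"
  shows "adem_even_sum K (int i) (int l) = (\<Sum>m\<in>{0..i}.
      of_nat (zbinom (int l - 1 - int m) (int i - 2 * int m)) * (P (int i + int l - int m) * P (int m))
     + of_nat (zbinom (int l - 1 - int m) (int i - 2 * int m - 1)) * (t * (Q (int i + int l - int m - 1) * Q (int m))))"
  unfolding adem_even_sum_def by (rule sum_int_nat) (use assms in \<open>auto simp: P_neg Q_neg\<close>)

lemma adem_odd_sum_nat:
  assumes "i \<le> K"
  shows "adem_odd_sum K (int i) (int l) = (\<Sum>m\<in>{0..i}.
      of_nat (zbinom (int l - int m) (int i - 2 * int m)) * (Q (int i + int l - int m) * P (int m))
     + of_nat (zbinom (int l - int m - 1) (int i - 2 * int m - 1)) *
       ((P (int i + int l - int m) + r * Q (int i + int l - int m - 1)) * Q (int m)))"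
  unfolding adem_odd_sum_def by (rule sum_int_nat) (use assms in \<open>auto simp: P_neg Q_neg\<close>)

lemma Sqe_intro: "n = 2 * k \<Longrightarrow> Sqe n = P (int k)" "n = Suc (2 * k) \<Longrightarrow> Sqe n = Q (int k)"
  by (simp_all add: Sqe_def)

lemma binomial_intro:
  "n = 2 * a \<Longrightarrow> k = 2 * b \<Longrightarrow> of_nat (n choose k) = (of_nat (a choose b) :: 'e)"
  "n = Suc (2 * a) \<Longrightarrow> k = 2 * b \<Longrightarrow> of_nat (n choose k) = (of_nat (a choose b) :: 'e)"
  "n = Suc (2 * a) \<Longrightarrow> k = Suc (2 * b) \<Longrightarrow> of_nat (n choose k) = (of_nat (a choose b) :: 'e)"
  "n = 2 * a \<Longrightarrow> k = Suc (2 * b) \<Longrightarrow> of_nat (n choose k) = (0 :: 'e)"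
  using of_nat_parity[of "n choose k" 0] by (auto intro!: of_nat_parity simp: even_binomial even_binomial_Suc simp del: binomial_Suc_Suc)

lemma div_two_double: "2 * i div 2 = (i::nat)" "Suc (2 * i) div 2 = i"
  by auto

lemma adem_term_eqI:
  "of_nat ((b - 1 - j) choose (a - 2 * j)) = (c :: 'e) \<Longrightarrow> Sqe (a + b - j) = x \<Longrightarrow> Sqe j = y \<Longrightarrow>
    adem_term a b j = c * (if even a \<and> even b \<and> odd j then t else 1) * x * y"
  by (simp add: adem_term_def)

lemma rho_term_eqI:
  "of_nat ((b - 1 - j) choose (2 * (a div 2) - 2 * j)) = (c :: 'e) \<Longrightarrow> Sqe (a + b - 1 - j) = x \<Longrightarrow> Sqe j = y \<Longrightarrow>
    rho_term a b j = c * r * x * y"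
  by (simp add: rho_term_def)

text \<open>This and the following lemmas run through the parities: the suffix \<open>ee\<close>,
  \<open>eo\<close>, \<open>oe\<close> or \<open>oo\<close> gives those of a and b, the last word
  that of j. Each time the upper and lower entries of the binomial coefficient are halved by the
  matching case of \<open>binomial_intro\<close>.\<close>

lemma adem_term_ee_even:
  assumes "i < 2 * l" "2 * m \<le> i"
  shows "adem_term (2 * i) (2 * l) (2 * m) = of_nat ((l - 1 - m) choose (i - 2 * m)) * (P (int (i + l - m)) * P (int m))"
  by (subst adem_term_eqI[OF binomial_intro(2)[of _ "l - 1 - m" _ "i - 2 * m"]
      Sqe_intro(1)[of _ "i + l - m"] Sqe_intro(1)[of _ m]])
    (use assms in \<open>auto simp: mult.assoc\<close>)

lemma adem_term_ee_odd:
  assumes "i < 2 * l" "Suc (2 * m) \<le> i"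
  shows "adem_term (2 * i) (2 * l) (Suc (2 * m)) = of_nat ((l - 1 - m) choose (i - 2 * m - 1)) * (t * (Q (int (i + l - m - 1)) * Q (int m)))"
  by (subst adem_term_eqI[OF binomial_intro(1)[of _ "l - 1 - m" _ "i - 2 * m - 1"]
      Sqe_intro(2)[of _ "i + l - m - 1"] Sqe_intro(2)[of _ m]])
    (use assms in \<open>auto simp: mult.assoc\<close>)

lemma adem_term_eo_even:
  assumes "i \<le> 2 * l" "2 * m \<le> i"
  shows "adem_term (2 * i) (Suc (2 * l)) (2 * m) = of_nat ((l - m) choose (i - 2 * m)) * (Q (int (i + l - m)) * P (int m))"
  by (subst adem_term_eqI[OF binomial_intro(1)[of _ "l - m" _ "i - 2 * m"]
      Sqe_intro(2)[of _ "i + l - m"] Sqe_intro(1)[of _ m]])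
    (use assms in \<open>auto simp: mult.assoc\<close>)

lemma adem_term_eo_odd:
  assumes "i \<le> 2 * l" "Suc (2 * m) \<le> i"
  shows "adem_term (2 * i) (Suc (2 * l)) (Suc (2 * m)) = of_nat ((l - m - 1) choose (i - 2 * m - 1)) * (P (int (i + l - m)) * Q (int m))"
  by (subst adem_term_eqI[OF binomial_intro(2)[of _ "l - m - 1" _ "i - 2 * m - 1"]
      Sqe_intro(1)[of _ "i + l - m"] Sqe_intro(2)[of _ m]])
    (use assms in \<open>auto simp: mult.assoc\<close>)

lemma rho_term_eo:
  assumes "i \<le> 2 * l" "Suc (2 * m) \<le> i"
  shows "rho_term (2 * i) (Suc (2 * l)) (Suc (2 * m)) = of_nat ((l - m - 1) choose (i - 2 * m - 1)) * (r * (Q (int (i + l - m - 1)) * Q (int m)))"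
  by (subst rho_term_eqI[OF binomial_intro(2)[of _ "l - m - 1" _ "i - 2 * m - 1"]
      Sqe_intro(2)[of _ "i + l - m - 1"] Sqe_intro(2)[of _ m]])
    (use assms in \<open>auto simp: mult.assoc\<close>)

lemma adem_term_oe_even:
  assumes "i < 2 * l" "2 * m \<le> i"
  shows "adem_term (Suc (2 * i)) (2 * l) (2 * m) = of_nat ((l - 1 - m) choose (i - 2 * m)) * (Q (int (i + l - m)) * P (int m))"
  by (subst adem_term_eqI[OF binomial_intro(3)[of _ "l - 1 - m" _ "i - 2 * m"]
      Sqe_intro(2)[of _ "i + l - m"] Sqe_intro(1)[of _ m]])
    (use assms in \<open>auto simp: mult.assoc\<close>)

text \<open>An even number over an odd number is an even binomial coefficient.\<close>

lemma adem_term_oe_odd: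
  assumes "i < 2 * l" "Suc (2 * m) \<le> i"
  shows "adem_term (Suc (2 * i)) (2 * l) (Suc (2 * m)) = 0"
  by (subst adem_term_eqI[OF binomial_intro(4)[of _ "l - 1 - m" _ "i - 2 * m - 1"]
      Sqe_intro(1)[of _ "i + l - m"] Sqe_intro(2)[of _ m]])
    (use assms in \<open>auto simp: mult.assoc\<close>)

lemma rho_term_oe:
  assumes "i < 2 * l" "Suc (2 * m) \<le> i"
  shows "rho_term (Suc (2 * i)) (2 * l) (Suc (2 * m)) = of_nat ((l - 1 - m) choose (i - 2 * m - 1)) * (r * (Q (int (i + l - m - 1)) * Q (int m)))"
  by (subst rho_term_eqI[OF binomial_intro(1)[of _ "l - 1 - m" _ "i - 2 * m - 1"]
      Sqe_intro(2)[of _ "i + l - m - 1"] Sqe_intro(2)[of _ m]])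
    (use assms in \<open>auto simp: mult.assoc\<close>)

lemma adem_term_oo_even:
  assumes "i \<le> 2 * l" "2 * m \<le> i"
  shows "adem_term (Suc (2 * i)) (Suc (2 * l)) (2 * m) = 0"
  by (subst adem_term_eqI[OF binomial_intro(4)[of _ "l - m" _ "i - 2 * m"]
      Sqe_intro(1)[of _ "Suc (i + l - m)"] Sqe_intro(1)[of _ m]])
    (use assms in \<open>auto simp: mult.assoc\<close>)

lemma adem_term_oo_odd:
  assumes "i \<le> 2 * l" "Suc (2 * m) \<le> i"
  shows "adem_term (Suc (2 * i)) (Suc (2 * l)) (Suc (2 * m)) = of_nat ((l - m - 1) choose (i - 2 * m - 1)) * (Q (int (i + l - m)) * Q (int m))"
  by (subst adem_term_eqI[OF binomial_intro(3)[of _ "l - m - 1" _ "i - 2 * m - 1"]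
      Sqe_intro(2)[of _ "i + l - m"] Sqe_intro(2)[of _ m]])
    (use assms in \<open>auto simp: mult.assoc\<close>)

lemma zbinom_nat_cong: "x = int n \<Longrightarrow> y = int k \<Longrightarrow> zbinom x y = n choose k"
  by (simp add: zbinom_def)

lemma adem_even_even:
  assumes il: "i < 2 * l" and K: "i \<le> K"
  shows "adem_sum (2 * i) (2 * l) = adem_even_sum K (int i) (int l)"
  unfolding adem_even_sum_nat[OF K] adem_sum_def div_two_double sum_parity[of "adem_term (2 * i) (2 * l)" i]
proof (simp, rule sum.cong[OF refl], goal_cases)
  case (1 m)
  have c: "zbinom (int l - 1 - int m) (int i - 2 * int m) = (if 2 * m \<le> i then (l - 1 - m) choose (i - 2 * m) else 0)"
    "zbinom (int l - 1 - int m) (int i - 2 * int m - 1) = (if Suc (2 * m) \<le> i then (l - 1 - m) choose (i - 2 * m - 1) else 0)"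
    using il by (auto intro!: zbinom_nat_cong)
  have n: "int i + int l - int m = int (i + l - m)" if "2 * m \<le> i"
    using that by auto
  have n': "int (i + l - m) - 1 = int (i + l - Suc m)" if "Suc (2 * m) \<le> i"
    using that by auto
  show ?case
    unfolding c using adem_term_ee_even[OF il] adem_term_ee_odd[OF il] by (auto simp: n n' simp del: of_nat_diff)
qed

lemma adem_even_odd:
  assumes il: "i \<le> 2 * l" and K: "i \<le> K"
  shows "adem_sum (2 * i) (Suc (2 * l)) = adem_odd_sum K (int i) (int l)"
  unfolding adem_odd_sum_nat[OF K] adem_sum_def div_two_double odd_sum
    sum_parity[of "adem_term (2 * i) (Suc (2 * l))" i]
proof (simp add: sum.distrib[symmetric], rule sum.cong[OF refl], goal_cases)
  case (1 m)
  have c: "zbinom (int l - int m) (int i - 2 * int m) = (if 2 * m \<le> i then (l - m) choose (i - 2 * m) else 0)"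
    "zbinom (int l - int m - 1) (int i - 2 * int m - 1) = (if Suc (2 * m) \<le> i then (l - m - 1) choose (i - 2 * m - 1) else 0)"
    using il by (auto intro!: zbinom_nat_cong)
  have n: "int i + int l - int m = int (i + l - m)" if "2 * m \<le> i"
    using that by auto
  have n': "int (i + l - m) - 1 = int (i + l - Suc m)" if "Suc (2 * m) \<le> i"
    using that by auto
  show ?case
    unfolding c using adem_term_eo_even[OF il] adem_term_eo_odd[OF il] rho_term_eo[OF il]
    by (auto simp: n n' distrib_left distrib_right mult.assoc add.assoc simp del: of_nat_diff)
qed

text \<open>The source of the rho-terms for odd a and even b: \<open>Q 0\<close> passes
  \<open>t\<close> at the cost of \<open>r\<close>, and kills the \<open>Q i\<close> behind
  it.\<close>

lemma Q_zero_t_QQ: "Q 0 * (t * (Q i * x)) = r * (Q i * x)"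
  by (simp add: left_commutations P_zero Q_neg)

lemma adem_odd_even:
  assumes il: "i < 2 * l" and K: "i \<le> K"
  shows "adem_sum (Suc (2 * i)) (2 * l) = Q 0 * adem_even_sum K (int i) (int l)"
  unfolding adem_even_sum_nat[OF K] adem_sum_def div_two_double odd_sum sum_distrib_left
    sum_parity[of "adem_term (Suc (2 * i)) (2 * l)" i]
proof (simp add: sum.distrib[symmetric], rule sum.cong[OF refl], goal_cases)
  case (1 m)
  have c: "zbinom (int l - 1 - int m) (int i - 2 * int m) = (if 2 * m \<le> i then (l - 1 - m) choose (i - 2 * m) else 0)"
    "zbinom (int l - 1 - int m) (int i - 2 * int m - 1) = (if Suc (2 * m) \<le> i then (l - 1 - m) choose (i - 2 * m - 1) else 0)"
    using il by (auto intro!: zbinom_nat_cong)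
  have n: "int i + int l - int m = int (i + l - m)" if "2 * m \<le> i"
    using that by auto
  have n': "int (i + l - m) - 1 = int (i + l - Suc m)" if "Suc (2 * m) \<le> i"
    using that by auto
  show ?case
    unfolding c using adem_term_oe_even[OF il] adem_term_oe_odd[OF il] rho_term_oe[OF il]
    by (auto simp: n n' distrib_left of_nat_left_commute left_commutations(6) Q_zero_t_QQ simp del: of_nat_diff)
qed

text \<open>\<open>Q 0\<close> annihilates every summand that begins with \<open>Q\<close>. This
  removes both the terms with even j and the rho-terms of \<open>adem_odd_sum\<close>, in agreement
  with the relation for two odd indices.\<close>

lemma adem_odd_odd:
  assumes il: "i \<le> 2 * l" and K: "i \<le> K"
  shows "adem_sum (Suc (2 * i)) (Suc (2 * l)) = Q 0 * adem_odd_sum K (int i) (int l)"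
  unfolding adem_odd_sum_nat[OF K] adem_sum_def div_two_double odd_sum sum_distrib_left
    sum_parity[of "adem_term (Suc (2 * i)) (Suc (2 * l))" i]
proof (simp, rule sum.cong[OF refl], goal_cases)
  case (1 m)
  have c: "zbinom (int l - int m) (int i - 2 * int m) = (if 2 * m \<le> i then (l - m) choose (i - 2 * m) else 0)"
    "zbinom (int l - int m - 1) (int i - 2 * int m - 1) = (if Suc (2 * m) \<le> i then (l - m - 1) choose (i - 2 * m - 1) else 0)"
    using il by (auto intro!: zbinom_nat_cong)
  have n: "int i + int l - int m = int (i + l - m)" if "2 * m \<le> i"
    using that by auto
  show ?case
    unfolding c using adem_term_oo_even[OF il] adem_term_oo_odd[OF il]
    by (auto simp: n distrib_left distrib_right mult.assoc of_nat_left_commute left_commutations(3,6,7) simp del: of_nat_diff)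
qed

lemma adem_relation:
  assumes even_defect: "\<And>K i l. i < 2 * l \<Longrightarrow> i \<le> int K \<Longrightarrow> l \<le> int K \<Longrightarrow> even_defect K i l = 0"
    and odd_defect: "\<And>K i l. i \<le> 2 * l \<Longrightarrow> i \<le> int K \<Longrightarrow> l \<le> int K \<Longrightarrow> odd_defect K i l = 0"
    and ab: "a < 2 * b"
  shows "Sqe a * Sqe b = adem_sum a b"
proof -
  define i l where "i = a div 2" and "l = b div 2"
  \<comment> \<open>The bound \<open>K = i + l\<close> dominates both indices; any such bound gives
    the same sum.\<close>
  have A': "P (int i) * P (int l) = adem_even_sum (i + l) (int i) (int l)" if "i < 2 * l"
    using even_defect[of "int i" "int l" "i + l"] that by (simp add: even_defect_def add_eq_zero_iff)
  have B': "P (int i) * Q (int l) = adem_odd_sum (i + l) (int i) (int l)" if "i \<le> 2 * l"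
    using odd_defect[of "int i" "int l" "i + l"] that by (simp add: odd_defect_def add_eq_zero_iff)
  have Q: "Q (int i) * x = Q 0 * (P (int i) * x)" for x
    by (simp add: left_commutations)
  consider "a = 2 * i" "b = 2 * l" | "a = 2 * i" "b = Suc (2 * l)"
    | "a = Suc (2 * i)" "b = 2 * l" | "a = Suc (2 * i)" "b = Suc (2 * l)"
    unfolding i_def l_def by (metis odd_two_times_div_two_succ even_two_times_div_two Suc_eq_plus1)
  then show ?thesis
  proof cases
    case 1
    with ab A' show ?thesis by (simp add: Sqe_even adem_even_even[of _ _ "i + l"])
  next
    case 2
    with ab B' show ?thesis by (simp add: Sqe_even Sqe_odd adem_even_odd[of _ _ "i + l"])
  next
    case 3
    with ab A' show ?thesis by (simp add: Sqe_even Sqe_odd adem_odd_even[of _ _ "i + l"] Q)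
  next
    case 4
    with ab B' show ?thesis by (simp add: Sqe_odd adem_odd_odd[of _ _ "i + l"] Q)
  qed
qed

end

section \<open>The action on the cohomology of the cofiber of \<open>\<eta>\<close>\<close>

text \<open>The cohomology \<open>F\<^sub>2[\<rho>][\<tau>]\<close> of a point.\<close>

type_synonym cpoly = "bit poly poly"

definition tpoly :: cpoly where "tpoly = [:0, 1:]"
definition rpoly :: cpoly where "rpoly = [:[:0, 1:]:]"

lemma bit_poly_add_self: "x + x = (0 :: bit poly)"
  by (rule poly_eqI, simp only: coeff_add) simp

lemma cpoly_add_self: "x + x = (0 :: cpoly)"
  by (rule poly_eqI, simp only: coeff_add bit_poly_add_self) simp

text \<open>The Cartan formula for \<open>P i\<close> and \<open>Q i\<close> of \<open>a + \<tau>f\<close>, in terms of their values on \<open>f\<close>.\<close>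

definition sq_pair_step :: "bit poly \<Rightarrow> (int \<Rightarrow> cpoly) \<times> (int \<Rightarrow> cpoly) \<Rightarrow> (int \<Rightarrow> cpoly) \<times> (int \<Rightarrow> cpoly)" where
  "sq_pair_step a pq =
    (\<lambda>i. (if i = 0 then [:a:] else 0) + tpoly * fst pq i + rpoly * (tpoly * snd pq (i - 1)),
     \<lambda>i. tpoly * snd pq i + (rpoly * fst pq i + rpoly * (rpoly * snd pq (i - 1))))"

text \<open>Both families come from one recursion, since the value of each at tau f involves the
  values of both at f.\<close>

definition sq_pair :: "cpoly \<Rightarrow> (int \<Rightarrow> cpoly) \<times> (int \<Rightarrow> cpoly)" where
  "sq_pair f = fold_coeffs sq_pair_step f (\<lambda>_. 0, \<lambda>_. 0)"

definition ptP :: "int \<Rightarrow> cpoly \<Rightarrow> cpoly" where "ptP i f = fst (sq_pair f) i"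
definition ptQ :: "int \<Rightarrow> cpoly \<Rightarrow> cpoly" where "ptQ i f = snd (sq_pair f) i"

text \<open>\<open>fold_coeffs\<close> does not see the coefficient in \<open>pCons 0 0 = 0\<close>;
  this is harmless because the step with a = 0 fixes the zero pair.\<close>

lemma sq_pair_pCons: "sq_pair (pCons a f) = sq_pair_step a (sq_pair f)"
  by (cases "a = 0"; cases "f = 0") (simp_all add: sq_pair_def, simp add: sq_pair_step_def fun_eq_iff)

lemma ptP_pCons: "ptP i (pCons a f) = (if i = 0 then [:a:] else 0) + tpoly * ptP i f + rpoly * (tpoly * ptQ (i - 1) f)"
  and ptQ_pCons: "ptQ i (pCons a f) = tpoly * ptQ i f + (rpoly * ptP i f + rpoly * (rpoly * ptQ (i - 1) f))"
  by (simp_all only: ptP_def ptQ_def sq_pair_pCons sq_pair_step_def fst_conv snd_conv)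

lemma pt_zero [simp]: "ptP i 0 = 0" "ptQ i 0 = 0"
  by (simp_all add: ptP_def ptQ_def sq_pair_def)

lemma pt_add: "ptP i (f + g) = ptP i f + ptP i g \<and> ptQ i (f + g) = ptQ i f + ptQ i g"
  by (induction f g arbitrary: i rule: poly_induct2)
    (simp_all add: ptP_pCons ptQ_pCons algebra_simps)

lemmas ptP_add = pt_add[THEN conjunct1] and ptQ_add = pt_add[THEN conjunct2]

lemma pt_R: "ptP i (rpoly * f) = rpoly * ptP i f \<and> ptQ i (rpoly * f) = rpoly * ptQ i f"
proof (induction f arbitrary: i)
  case (pCons a f)
  have "rpoly * pCons a f = pCons ([:0, 1:] * a) (rpoly * f)" by (simp add: rpoly_def)
  moreover have "Polynomial.smult a rpoly = [:pCons 0 a:]" by (simp add: rpoly_def)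
  ultimately show ?case
    using pCons.IH by (simp only: ptP_pCons ptQ_pCons) (simp add: algebra_simps)
qed simp

lemmas ptP_R = pt_R[THEN conjunct1] and ptQ_R = pt_R[THEN conjunct2]

lemma ptP_T: "ptP i (tpoly * f) = tpoly * ptP i f + rpoly * (tpoly * ptQ (i - 1) f)"
  and ptQ_T: "ptQ i (tpoly * f) = tpoly * ptQ i f + (rpoly * ptP i f + rpoly * (rpoly * ptQ (i - 1) f))"
  using ptP_pCons[of i 0 f] ptQ_pCons[of i 0 f] by (simp_all add: tpoly_def)

lemma ptP_const: "ptP i [:a:] = (if i = 0 then [:a:] else 0)" and ptQ_const [simp]: "ptQ i [:a:] = 0"
  using ptP_pCons[of i a 0] ptQ_pCons[of i a 0] by simp_all

lemma pCons_T: "pCons a f = [:a:] + tpoly * f"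
  by (simp add: tpoly_def)

lemma pt_vanish_neg: "i < 0 \<Longrightarrow> ptP i f = 0 \<and> ptQ i f = 0"
  by (induction f arbitrary: i) (simp_all add: ptP_pCons ptQ_pCons)

lemma ptP_zero: "ptP 0 f = f"
  by (induction f) (simp_all add: ptP_pCons pt_vanish_neg pCons_T[symmetric])

lemma cpoly_char_two_left: "x + (x + y) = (y :: cpoly)"
  by (metis add.assoc add_0 cpoly_add_self)

lemma ptQ_zero_pt: "ptQ 0 (ptP i f) = ptQ i f \<and> ptQ 0 (ptQ i f) = 0"
proof (induction f arbitrary: i)
  case (pCons a f)
  show ?case
    unfolding ptP_pCons[of _ a f] ptQ_pCons[of _ a f]
    by (simp add: ptQ_add ptQ_R ptQ_T ptP_zero pCons.IH pt_vanish_neg distrib_left cpoly_add_self cpoly_char_two_left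
        mult.left_commute add.assoc add.left_commute add.commute)
qed simp

text \<open>The pair \<open>(f, g)\<close> stands for \<open>f + g e\<close>.\<close>

type_synonym cone = "cpoly \<times> cpoly"

text \<open>Additivity is all that can be asked for, as the squares do not commute with tau. Making
  the endomorphisms a type of class \<open>ring_1\<close> allows \<open>motivic_squares\<close> to
  be interpreted in them.\<close>

typedef endo = "{f :: cone \<Rightarrow> cone. \<forall>x y. f (x + y) = f x + f y}"
  morphisms app Endo
  by (rule exI[of _ id]) simp

setup_lifting type_definition_endo

lemma app_add [simp]: "app a (x + y) = app a x + app a y"
  using app[of a] by blast

lemma app_zero [simp]: "app a 0 = 0"
  using app_add[of a 0 0] by simp

lemma endo_eqI: "(\<And>x. app a x = app b x) \<Longrightarrow> a = b"
  by (simp add: app_inject[symmetric] fun_eq_iff)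

instantiation endo :: ring_1
begin

lift_definition zero_endo :: endo is "\<lambda>_. 0" by simp
lift_definition one_endo :: endo is "\<lambda>x. x" by simp
lift_definition plus_endo :: "endo \<Rightarrow> endo \<Rightarrow> endo" is "\<lambda>f g x. f x + g x"
  by (simp add: add_ac)
lift_definition minus_endo :: "endo \<Rightarrow> endo \<Rightarrow> endo" is "\<lambda>f g x. f x - g x"
  by (simp add: algebra_simps)
lift_definition uminus_endo :: "endo \<Rightarrow> endo" is "\<lambda>f x. - f x"
  by simp
lift_definition times_endo :: "endo \<Rightarrow> endo \<Rightarrow> endo" is "\<lambda>f g x. f (g x)"
  by simp

instance
proof
  show "(0::endo) \<noteq> 1"
  proof
    assume "(0::endo) = 1"
    then have "app 0 (1, 0) = app 1 (1, 0)" by simp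
    then show False by (simp add: zero_endo.rep_eq one_endo.rep_eq zero_prod_def)
  qed
qed (rule endo_eqI, simp add: zero_endo.rep_eq one_endo.rep_eq plus_endo.rep_eq minus_endo.rep_eq
    uminus_endo.rep_eq times_endo.rep_eq)+

end

lemma app_simps [simp]:
  "app 0 x = 0" "app 1 x = x" "app (a + b) x = app a x + app b x" "app (a * b) x = app a (app b x)"
  by (simp_all add: zero_endo.rep_eq one_endo.rep_eq plus_endo.rep_eq times_endo.rep_eq)

lemma app_sum: "app (\<Sum>i\<in>I. f i) x = (\<Sum>i\<in>I. app (f i) x)"
  by (induction I rule: infinite_finite_induct) auto

definition scale :: "cpoly \<Rightarrow> endo" where
  "scale c = Endo (\<lambda>x. (c * fst x, c * snd x))"

text \<open>The Cartan formula for f + g e: \<open>P 0\<close> fixes 1, \<open>P 1\<close> sends 1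
  to e, all other squares kill 1, and all squares except \<open>P 0\<close> kill e. In particular no
  product of two odd squares contributes. The index shift by one in the second component is the cell
  e.\<close>

definition PE :: "int \<Rightarrow> endo" where
  "PE i = Endo (\<lambda>x. (ptP i (fst x), ptP i (snd x) + ptP (i - 1) (fst x)))"

definition QE :: "int \<Rightarrow> endo" where
  "QE i = Endo (\<lambda>x. (ptQ i (fst x), ptQ i (snd x) + ptQ (i - 1) (fst x)))"

lemma app_ops: "app (scale c) x = (c * fst x, c * snd x)"
  "app (PE i) x = (ptP i (fst x), ptP i (snd x) + ptP (i - 1) (fst x))"
  "app (QE i) x = (ptQ i (fst x), ptQ i (snd x) + ptQ (i - 1) (fst x))"
proof -
  show "app (scale c) x = (c * fst x, c * snd x)"
    unfolding scale_def by (subst Endo_inverse) (auto simp: distrib_left)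
  show "app (PE i) x = (ptP i (fst x), ptP i (snd x) + ptP (i - 1) (fst x))"
    unfolding PE_def by (subst Endo_inverse) (auto simp: ptP_add)
  show "app (QE i) x = (ptQ i (fst x), ptQ i (snd x) + ptQ (i - 1) (fst x))"
    unfolding QE_def by (subst Endo_inverse) (auto simp: ptQ_add)
qed

lemmas pt_neg = pt_vanish_neg[THEN conjunct1] pt_vanish_neg[THEN conjunct2]

interpretation E: motivic_squares "scale tpoly" "scale rpoly" PE QE
proof
  fix i :: int
  show "x + x = 0" for x :: endo
    by (rule endo_eqI) (simp add: prod_eq_iff cpoly_add_self)
  show "scale tpoly * scale rpoly = scale rpoly * scale tpoly"
    by (rule endo_eqI) (simp add: app_ops mult.left_commute)
  show "PE i * scale rpoly = scale rpoly * PE i" "QE i * scale rpoly = scale rpoly * QE i"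
    by (rule endo_eqI, simp add: app_ops ptP_R ptQ_R distrib_left)+
  show "PE i * scale tpoly = scale tpoly * PE i + scale rpoly * (scale tpoly * QE (i - 1))"
    by (rule endo_eqI) (simp add: app_ops ptP_T distrib_left ac_simps)
  show "QE i * scale tpoly = scale tpoly * QE i + (scale rpoly * PE i + scale rpoly * (scale rpoly * QE (i - 1)))"
    by (rule endo_eqI) (simp add: app_ops ptQ_T distrib_left ac_simps)
  show "i < 0 \<Longrightarrow> PE i = 0" "i < 0 \<Longrightarrow> QE i = 0"
    by (rule endo_eqI, simp add: app_ops pt_neg zero_prod_def)+
  show "PE 0 = 1"
    by (rule endo_eqI) (simp add: app_ops pt_neg ptP_zero)
  show "QE 0 * PE i = QE i" "QE 0 * QE i = 0"
    by (rule endo_eqI, simp add: app_ops pt_neg ptQ_add ptQ_zero_pt zero_prod_def)+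
qed

lemma scale_even_defect: "E.even_defect K i l * scale rpoly = scale rpoly * E.even_defect K i l"
  and scale_odd_defect: "E.odd_defect K i l * scale rpoly = scale rpoly * E.odd_defect K i l"
  by (simp_all only: E.even_defect_def E.odd_defect_def E.adem_even_sum_def E.adem_odd_sum_def sum_distrib_left sum_distrib_right
      distrib_left distrib_right E.normal_form)

lemma app_generator:
  "app (QE i) (1, 0) = 0" "app (QE i) (0, 1) = 0"
  "app (PE i) (1, 0) = (if i = 0 then (1, 0) else if i = 1 then (0, 1) else 0)"
  "app (PE i) (0, 1) = (if i = 0 then (0, 1) else 0)"
  using ptP_const[of _ 1] ptQ_const[of _ 1] by (auto simp: app_ops zero_prod_def one_pCons)

definition adem_zero :: "cone \<Rightarrow> bool" where
  "adem_zero x \<longleftrightarrow> (\<forall>K i l. i \<le> int K \<longrightarrow> l \<le> int K \<longrightarrow>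
     (i < 2 * l \<longrightarrow> app (E.even_defect K i l) x = 0) \<and> (i \<le> 2 * l \<longrightarrow> app (E.odd_defect K i l) x = 0))"

lemma adem_zero_add: "adem_zero x \<Longrightarrow> adem_zero y \<Longrightarrow> adem_zero (x + y)"
  by (simp add: adem_zero_def)

lemma adem_zero_R:
  assumes "adem_zero x" shows "adem_zero (app (scale rpoly) x)"
proof -
  have "app a (app (scale rpoly) x) = 0" if "a * scale rpoly = scale rpoly * a" "app a x = 0" for a
  proof -
    have "app (a * scale rpoly) x = 0" unfolding that(1) by (simp add: that(2))
    then show ?thesis by simp
  qed
  then show ?thesis
    using assms by (auto simp: adem_zero_def scale_even_defect scale_odd_defect)
qed

lemma adem_zero_T:
  assumes "adem_zero x" shows "adem_zero (app (scale tpoly) x)"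
  unfolding adem_zero_def
proof (intro allI impI conjI)
  fix K i l assume K: "i \<le> int K" "l \<le> int K"
  have even_defect: "app (E.even_defect K i l) x = 0" if "i < 2 * l" "i \<le> int K" "l \<le> int K" for i l
    using assms that by (simp add: adem_zero_def)
  have odd_defect: "app (E.odd_defect K i l) x = 0" if "i \<le> 2 * l" "i \<le> int K" "l \<le> int K" for i l
    using assms that by (simp add: adem_zero_def)
  have "E.even_defect K i l * scale tpoly \<in> {a. app a x = 0}" if "i < 2 * l"
    by (rule E.left_ideal_t(1)[OF _ _ _ _ K that]) (simp_all add: even_defect odd_defect)
  then show "i < 2 * l \<Longrightarrow> app (E.even_defect K i l) (app (scale tpoly) x) = 0" by simp
  have "E.odd_defect K i l * scale tpoly \<in> {a. app a x = 0}" if "i \<le> 2 * l"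
    by (rule E.left_ideal_t(2)[OF _ _ _ _ K that]) (simp_all add: even_defect odd_defect)
  then show "i \<le> 2 * l \<Longrightarrow> app (E.odd_defect K i l) (app (scale tpoly) x) = 0" by simp
qed

text \<open>The case that degree reasons do not settle: \<open>PE 0 * PE 1\<close> really sends 1 to
  e. For i = 0 only m = 0 survives in the sum, and it gives \<open>PE l\<close> a second
  time.\<close>

lemma even_defect_zero:
  assumes "0 < l" shows "E.even_defect K 0 l = 0"
proof -
  let ?f = "\<lambda>m. of_nat (zbinom (l - 1 - m) (0 - 2 * m)) * (PE (0 + l - m) * PE m)
     + of_nat (zbinom (l - 1 - m) (0 - 2 * m - 1)) * (scale tpoly * (QE (0 + l - m - 1) * QE m))"
  have "?f m = 0" if "m \<noteq> 0" for m
    using that by (cases "m < 0") (simp_all add: E.P_neg E.Q_neg)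
  then have "E.adem_even_sum K 0 l = sum ?f {0}"
    unfolding E.adem_even_sum_def by (intro sum.mono_neutral_right) auto
  moreover have "zbinom (l - 1) 0 = 1" using assms by simp
  ultimately have "E.adem_even_sum K 0 l = PE l * PE 0" by simp
  then have "E.even_defect K 0 l = PE l + PE l" by (simp only: E.even_defect_def E.P_zero mult_1_left mult_1_right)
  then show ?thesis by (simp only: E.char_two)
qed

lemma app_generator_twice:
  "app (QE j) (app (PE m) (1, 0)) = 0" "app (QE j) (app (PE m) (0, 1)) = 0"
  "m \<noteq> 0 \<Longrightarrow> j \<noteq> 0 \<Longrightarrow> app (PE j) (app (PE m) (1, 0)) = 0"
  "m \<noteq> 0 \<Longrightarrow> app (PE j) (app (PE m) (0, 1)) = 0"
  "j \<ge> 1 \<Longrightarrow> app (PE j) (app (PE m) (0, 1)) = 0"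
  "j + m \<ge> 2 \<Longrightarrow> app (PE j) (app (PE m) (1, 0)) = 0"
  by (simp_all add: app_generator)

text \<open>Every term of an odd defect contains an odd square, which kills both generators and
  their images under \<open>PE\<close>. In an even defect with i, l \<ge> 1 the two indices add up
  to at least 2, while a nonzero product of two \<open>PE\<close> on a generator has total index at
  most 1.\<close>

lemma adem_zero_gen: "adem_zero (1, 0)" "adem_zero (0, 1)"
proof -
  have odd_defect: "app (E.odd_defect K i l) (1, 0) = 0" "app (E.odd_defect K i l) (0, 1) = 0" for K i l
    by (simp_all only: E.odd_defect_def E.adem_odd_sum_def app_sum app_simps app_generator(1,2) app_generator_twice app_zero sum.neutral_const add_0)
  have even_defect: "app (E.even_defect K i l) (1, 0) = 0 \<and> app (E.even_defect K i l) (0, 1) = 0" if il: "i < 2 * l" for K i l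
  proof -
    consider "i < 0" | "i = 0" | "1 \<le> i" "1 \<le> l" using il by linarith
    then show ?thesis
    proof cases
      case 2
      with il show ?thesis by (simp add: even_defect_zero)
    next
      case 3
      have "app (PE (i + l - m)) (app (PE m) (0, 1)) = 0" for m
        using 3 by (cases "m = 0") (simp_all add: app_generator_twice)
      moreover have "app (PE (i + l - m)) (app (PE m) (1, 0)) = 0" for m
        using 3 by (simp add: app_generator_twice)
      moreover have "app (PE i) (app (PE l) (1, 0)) = 0" "app (PE i) (app (PE l) (0, 1)) = 0"
        using 3 by (simp_all add: app_generator_twice)
      ultimately show ?thesis
        by (simp only: E.even_defect_def E.adem_even_sum_def app_sum app_simps app_generator(1,2) app_zero sum.neutral_const add_0)
    qed (simp add: E.even_defect_neg)
  qed
  show "adem_zero (1, 0)" "adem_zero (0, 1)"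
    using even_defect odd_defect by (simp_all add: adem_zero_def)
qed

lemma cone_induct:
  assumes add: "\<And>x y. C x \<Longrightarrow> C y \<Longrightarrow> C (x + y)"
    and tpoly: "\<And>x. C x \<Longrightarrow> C (app (scale tpoly) x)" and rpoly: "\<And>x. C x \<Longrightarrow> C (app (scale rpoly) x)"
    and gen: "C (1, 0)" "C (0, 1)" "C 0"
  shows "C x"
proof -
  have R': "[:pCons b a:] = [:[:b:]:] + rpoly * [:a:]" for a b by (simp add: rpoly_def)
  have bit: "[:[:b:]:] = 0 \<or> [:[:b:]:] = (1 :: cpoly)" for b :: bit
    by (cases b) (simp_all add: one_pCons)
  have 1: "C ([:a:], 0) \<and> C (0, [:a:])" for a
  proof (induction a)
    case 0
    then show ?case using gen by (simp add: zero_prod_def)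
  next
    case (pCons b a)
    have "C ([:[:b:]:], 0) \<and> C (0, [:[:b:]:])"
      using bit[of b] gen by (auto simp: zero_prod_def)
    then have "C (([:[:b:]:], 0) + app (scale rpoly) ([:a:], 0)) \<and> C ((0, [:[:b:]:]) + app (scale rpoly) (0, [:a:]))"
      using pCons.IH by (intro conjI add rpoly) auto
    then show ?case unfolding R'[of b a] by (simp add: app_ops)
  qed
  have 2: "C (f, 0) \<and> C (0, f)" for f
  proof (induction f)
    case 0
    then show ?case using gen by (simp add: zero_prod_def)
  next
    case (pCons a f)
    have "C (([:a:], 0) + app (scale tpoly) (f, 0)) \<and> C ((0, [:a:]) + app (scale tpoly) (0, f))"
      using 1[of a] pCons.IH by (intro conjI add tpoly) auto
    then show ?case unfolding pCons_T[of a f] by (simp add: app_ops)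
  qed
  show ?thesis
    using add[of "(fst x, 0)" "(0, snd x)"] 2 by simp
qed

lemma adem_zero: "adem_zero x"
proof (rule cone_induct[of adem_zero])
  show "adem_zero 0" by (simp add: adem_zero_def)
qed (fact adem_zero_add adem_zero_T adem_zero_R adem_zero_gen)+

lemma act_adem:
  assumes "a < 2 * b" shows "E.Sqe a * E.Sqe b = E.adem_sum a b"
proof (rule E.adem_relation[OF _ _ assms])
  fix K i l assume K: "i \<le> int K" "l \<le> int K"
  show "E.even_defect K i l = 0" if "i < 2 * l"
    using adem_zero K that unfolding adem_zero_def by (intro endo_eqI) simp
  show "E.odd_defect K i l = 0" if "i \<le> 2 * l"
    using adem_zero K that unfolding adem_zero_def by (intro endo_eqI) simp
qed

section \<open>The representation of the Steenrod algebra\<close>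

fun gen_op :: "steenrod_gen \<Rightarrow> endo" where
  "gen_op Tau = scale tpoly"
| "gen_op Rho = scale rpoly"
| "gen_op (Sq i) = E.Sqe i"

definition word_op :: "steenrod_word \<Rightarrow> endo" where
  "word_op w = prod_list (map gen_op (letters w))"

lemma word_op_add: "word_op (v + w) = word_op v * word_op w"
  by (simp add: word_op_def plus_steenrod_word_def)

lemma word_op_zero: "word_op 0 = 1"
  by (simp add: word_op_def zero_steenrod_word_def)

text \<open>Coefficients in the field with two elements are determined by the support, so summing
  over \<open>keys\<close> is the linear extension of \<open>word_op\<close>.\<close>

definition free_act :: "free_steenrod \<Rightarrow> endo" where
  "free_act x = (\<Sum>w\<in>Poly_Mapping.keys x. word_op w)"

lemma free_act_superset:
  assumes "finite S" "Poly_Mapping.keys x \<subseteq> S"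
  shows "free_act x = (\<Sum>w\<in>S. if Poly_Mapping.lookup x w = 1 then word_op w else 0)"
  unfolding free_act_def using assms
  by (intro sum.mono_neutral_cong_left) (auto simp: in_keys_iff)

lemma free_act_add: "free_act (x + y) = free_act x + free_act y"
proof -
  let ?S = "Poly_Mapping.keys x \<union> Poly_Mapping.keys y"
  have "free_act (x + y) = (\<Sum>w\<in>?S. if Poly_Mapping.lookup (x + y) w = 1 then word_op w else 0)"
    by (rule free_act_superset) (use keys_add[of x y] in auto)
  \<comment> \<open>A word in both supports cancels on the left because 1 + 1 = 0 in
    \<open>bit\<close>, and on the right because its operator is added twice.\<close>
  also have "\<dots> = (\<Sum>w\<in>?S. (if Poly_Mapping.lookup x w = 1 then word_op w else 0) + (if Poly_Mapping.lookup y w = 1 then word_op w else 0))"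
    by (rule sum.cong) (auto simp: lookup_add E.char_two)
  also have "\<dots> = free_act x + free_act y"
    by (simp add: sum.distrib free_act_superset[of ?S x] free_act_superset[of ?S y])
  finally show ?thesis .
qed

lemma free_act_zero: "free_act 0 = 0"
  by (simp add: free_act_def)

lemma free_act_sum: "free_act (\<Sum>i\<in>I. f i) = (\<Sum>i\<in>I. free_act (f i))"
  by (induction I rule: infinite_finite_induct) (auto simp: free_act_add free_act_zero)

lemma free_char_two: "x + x = (0 :: free_steenrod)"
  by (rule poly_mapping_eqI) (simp add: lookup_add)

lemma free_minus: "x - y = (x + y :: free_steenrod)"
  by (rule poly_mapping_eqI) (simp add: lookup_add lookup_minus)

lemma free_act_single: "free_act (Poly_Mapping.single w 1) = word_op w"
  by (simp add: free_act_def)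

lemma free_decomp: "x = (\<Sum>w\<in>Poly_Mapping.keys x. Poly_Mapping.single w (1 :: bit))"
  by (rule poly_mapping_eqI) (auto simp: lookup_sum lookup_single when_def in_keys_iff)

lemma free_act_mult: "free_act (x * y) = free_act x * free_act y"
proof -
  have "x * y = (\<Sum>v\<in>Poly_Mapping.keys x. \<Sum>w\<in>Poly_Mapping.keys y. Poly_Mapping.single (v + w) 1)"
    by (subst free_decomp[of x], subst free_decomp[of y])
      (simp add: sum_product mult_single)
  then have "free_act (x * y) = (\<Sum>v\<in>Poly_Mapping.keys x. \<Sum>w\<in>Poly_Mapping.keys y. word_op v * word_op w)"
    by (simp add: free_act_sum free_act_single word_op_add)
  then show ?thesis by (simp add: free_act_def sum_product)
qed

lemma free_act_one: "free_act 1 = 1"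
  using free_act_single[of 0] by (simp add: word_op_zero)

lemma free_act_gen: "free_act (gen g) = gen_op g"
  by (simp add: gen_def free_act_single word_op_def)

lemma free_act_of_nat: "free_act (of_nat n) = of_nat n"
  by (induction n) (auto simp: free_act_zero free_act_one free_act_add)

lemma free_act_minus: "free_act (x - y) = free_act x + free_act y"
  by (simp add: free_minus free_act_add)

lemma free_act_adem_rhs: "free_act (adem_rhs a b) = E.adem_sum a b"
  unfolding adem_rhs_def E.adem_sum_def E.adem_term_def E.rho_term_def
  by (auto simp: free_act_add free_act_sum free_act_mult free_act_of_nat free_act_gen free_act_one free_act_zero if_distrib[of free_act]
      intro!: arg_cong2[of _ _ _ _ "(+)"] sum.cong)

lemma free_act_relation: "x \<in> steenrod_relations \<Longrightarrow> free_act x = 0"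
proof (induction rule: steenrod_relations.induct)
  case Sq_zero
  have "E.Sqe 0 = 1" by (simp add: E.Sqe_def E.P_zero)
  then show ?case by (simp add: free_act_minus free_act_gen free_act_one E.char_two)
next
  case (rho_central g)
  have "gen_op g * scale rpoly = scale rpoly * gen_op g"
    by (cases g) (simp_all add: E.r_t E.Sqe_def E.P_r E.Q_r)
  then show ?case by (simp add: free_act_minus free_act_gen free_act_mult E.char_two)
next
  case Sq_one_tau
  have "E.Sqe 1 = QE 0" by (simp add: E.Sqe_def)
  then show ?case
    by (simp add: free_act_minus free_act_gen free_act_mult free_act_add E.Q_t E.P_zero E.Q_neg E.char_two)
next
  case (Sq_even_tau i)
  have "E.Sqe (2 * i) = PE (int i)" by (rule E.Sqe_intro) simp
  moreover have "E.Sqe (2 * i - 1) = QE (int (i - 1))"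
    by (rule E.Sqe_intro) (use Sq_even_tau in simp)
  ultimately show ?case using Sq_even_tau
    by (simp add: free_act_minus free_act_gen free_act_mult free_act_add E.P_t E.char_two mult.assoc of_nat_diff)
next
  case (Sq_odd_tau i)
  have "E.Sqe (2 * i) = PE (int i)" "E.Sqe (2 * i + 1) = QE (int i)" by (rule E.Sqe_intro; simp)+
  moreover have "E.Sqe (2 * i - 1) = QE (int (i - 1))"
    by (rule E.Sqe_intro) (use Sq_odd_tau in simp)
  ultimately show ?case using Sq_odd_tau
    by (simp add: free_act_minus free_act_gen free_act_mult free_act_add E.Q_t E.char_two mult.assoc add.assoc of_nat_diff)
next
  case (adem a b)
  then show ?case
    by (simp add: free_act_minus free_act_gen free_act_mult free_act_adem_rhs act_adem E.char_two)
qed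

section \<open>The quotient algebra and its action\<close>

abbreviation FR :: "free_steenrod ring" where "FR \<equiv> ring_of_type_algebra"

lemma FR_simps [simp]: "carrier FR = UNIV" "x \<otimes>\<^bsub>FR\<^esub> y = x * y" "x \<oplus>\<^bsub>FR\<^esub> y = x + y" "\<one>\<^bsub>FR\<^esub> = 1" "\<zero>\<^bsub>FR\<^esub> = 0"
  by (simp_all add: ring_of_type_algebra_def)

lemma FR_ring: "ring FR"
proof (rule ringI)
  show "abelian_group FR"
  proof (rule abelian_groupI)
    show "\<exists>y\<in>carrier FR. y \<oplus>\<^bsub>FR\<^esub> x = \<zero>\<^bsub>FR\<^esub>" for x
      by (rule bexI[of _ x]) (simp_all add: free_char_two)
  qed (simp_all add: add_ac)
  show "Group.monoid FR"
    by (rule monoidI) (simp_all add: mult.assoc)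
qed (simp_all add: distrib_left distrib_right)

interpretation FR: ring FR by (rule FR_ring)

lemma FR_a_inv [simp]: "\<ominus>\<^bsub>FR\<^esub> x = x"
  using FR.minus_equality[of x x] by (simp add: free_char_two)

lemma steenrod_ideal: "ideal steenrod_ideal FR"
  unfolding steenrod_ideal_def by (rule FR.genideal_ideal) simp

text \<open>The kernel of the representation is a two-sided ideal containing the relations, and
  \<open>genideal\<close> is the smallest such ideal.\<close>

lemma steenrod_ideal_acts_zero: "x \<in> steenrod_ideal \<Longrightarrow> free_act x = 0"
proof -
  have "ideal {x. free_act x = 0} FR"
  proof (rule idealI[OF FR_ring])
    show "subgroup {x. free_act x = 0} (add_monoid FR)"
      by (rule FR.add.subgroupI) (use free_act_zero in \<open>auto simp: free_act_add\<close>)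
  qed (auto simp: free_act_mult)
  then have "steenrod_ideal \<subseteq> {x. free_act x = 0}"
    unfolding steenrod_ideal_def by (rule FR.genideal_minimal) (auto simp: free_act_relation)
  then show "x \<in> steenrod_ideal \<Longrightarrow> free_act x = 0" by blast
qed

abbreviation AR_add :: "steenrod \<Rightarrow> steenrod \<Rightarrow> steenrod" (infixl \<open>\<boxplus>\<close> 65) where
  "x \<boxplus> y \<equiv> x \<oplus>\<^bsub>AR\<^esub> y"

abbreviation AR_mult :: "steenrod \<Rightarrow> steenrod \<Rightarrow> steenrod" (infixl \<open>\<cdot>\<close> 70) where
  "x \<cdot> y \<equiv> x \<otimes>\<^bsub>AR\<^esub> y"

lemma AR_ring: "ring AR"
  unfolding AR_def by (rule ideal.quotient_is_ring[OF steenrod_ideal])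

interpretation AR: ring AR by (rule AR_ring)

abbreviation cl where "cl \<equiv> steenrod_class"

lemma cl_hom: "cl \<in> ring_hom FR AR"
  unfolding AR_def steenrod_class_def[abs_def] by (rule ideal.rcos_ring_hom[OF steenrod_ideal])

lemma cl_simps: "cl (x + y) = cl x \<boxplus> cl y" "cl (x * y) = cl x \<cdot> cl y" "cl 1 = \<one>\<^bsub>AR\<^esub>" "cl 0 = \<zero>\<^bsub>AR\<^esub>"
  "cl x \<in> carrier AR"
  using ring_hom_add[OF cl_hom, of x y] ring_hom_mult[OF cl_hom, of x y] ring_hom_one[OF cl_hom]
    ring_hom_closed[OF cl_hom, of x] ring_hom_zero[OF cl_hom FR_ring AR_ring] by simp_all

lemma AR_elem: "x \<in> carrier AR \<Longrightarrow> \<exists>y. x = cl y"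
  by (auto simp: AR_def FactRing_def A_RCOSETS_def' steenrod_class_def)

lemma cl_eq: "cl x = cl y \<Longrightarrow> x + y \<in> steenrod_ideal"
proof -
  assume "cl x = cl y"
  moreover have "x \<in> cl x"
    unfolding steenrod_class_def
    using abelian_subgroup.a_rcos_self[OF abelian_subgroupI3, OF ideal.axioms(1)[OF steenrod_ideal]] FR.is_abelian_group
    by simp
  ultimately have "x \<in> cl y" by simp
  then obtain h where "h \<in> steenrod_ideal" "x = h + y"
    unfolding steenrod_class_def a_r_coset_def' by auto
  then show "x + y \<in> steenrod_ideal"
    by (simp add: add.assoc free_char_two)
qed

definition act :: "steenrod \<Rightarrow> endo" where
  "act x = free_act (SOME y. cl y = x)"

text \<open>Independence of the chosen representative: two of them differ by an element of the
  ideal, which acts as zero.\<close>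

lemma act_cl: "act (cl x) = free_act x"
proof -
  have "cl (SOME y. cl y = cl x) = cl x" by (rule someI) simp
  then have "free_act ((SOME y. cl y = cl x) + x) = 0"
    by (intro steenrod_ideal_acts_zero cl_eq)
  then show ?thesis by (simp add: act_def free_act_add E.add_eq_zero_iff)
qed

lemma act_simps:
  assumes "x \<in> carrier AR" "y \<in> carrier AR"
  shows "act (x \<boxplus> y) = act x + act y" "act (x \<cdot> y) = act x * act y"
proof -
  obtain a b where ab: "x = cl a" "y = cl b" using assms AR_elem by blast
  show "act (x \<boxplus> y) = act x + act y"
    unfolding ab cl_simps(1)[symmetric] act_cl by (rule free_act_add)
  show "act (x \<cdot> y) = act x * act y"
    unfolding ab cl_simps(2)[symmetric] act_cl by (rule free_act_mult)
qed

lemma act_gens: "act tau = scale tpoly" "act rho = scale rpoly" "act (SqR i) = E.Sqe i"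
  "act \<zero>\<^bsub>AR\<^esub> = 0" "act \<one>\<^bsub>AR\<^esub> = 1"
  using act_cl[of 0] act_cl[of 1]
  by (simp_all only: tau_def rho_def SqR_def act_cl free_act_gen gen_op.simps cl_simps free_act_zero free_act_one)

lemma cl_relation:
  assumes "x - y \<in> steenrod_relations" shows "cl x = cl y"
proof -
  have "steenrod_relations \<subseteq> steenrod_ideal"
    unfolding steenrod_ideal_def by (rule FR.genideal_self) simp
  with assms have "x + y \<in> steenrod_ideal"
    unfolding free_minus by blast
  moreover have "cl h = \<zero>\<^bsub>AR\<^esub>" if "h \<in> steenrod_ideal" for h
    using abelian_subgroup.a_rcos_const[OF abelian_subgroupI3, OF ideal.axioms(1)[OF steenrod_ideal]] FR.is_abelian_group that
    by (simp add: steenrod_class_def AR_def FactRing_def)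
  ultimately have "cl (x + y) = \<zero>\<^bsub>AR\<^esub>" by blast
  then have "cl (x + y + y) = cl y"
    unfolding cl_simps(1)[of "x + y" y] by (simp add: cl_simps(5))
  then show ?thesis by (simp add: add.assoc free_char_two)
qed

lemma AR_char_two: "x \<in> carrier AR \<Longrightarrow> x \<boxplus> x = \<zero>\<^bsub>AR\<^esub>"
proof -
  assume "x \<in> carrier AR"
  then obtain y where "x = cl y" using AR_elem by blast
  then show ?thesis by (simp add: cl_simps(1)[symmetric] cl_simps(4) free_char_two)
qed

lemma AR_a_inv: "x \<in> carrier AR \<Longrightarrow> \<ominus>\<^bsub>AR\<^esub> x = x"
  by (intro AR.minus_equality AR_char_two)

lemma gens_closed [simp]: "tau \<in> carrier AR" "rho \<in> carrier AR" "SqR i \<in> carrier AR"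
  by (simp_all add: tau_def rho_def SqR_def cl_simps)

section \<open>Adem and Cartan relations in low degrees\<close>

lemma of_nat_free: "of_nat n = (if even n then 0 else 1 :: free_steenrod)"
  by (induction n) (auto simp: free_char_two)

abbreviation sq1 where "sq1 \<equiv> SqR 1"
abbreviation sq2 where "sq2 \<equiv> SqR 2"

lemma SqR_adem:
  assumes "0 < a" "a < 2 * b" shows "SqR a \<cdot> SqR b = cl (adem_rhs a b)"
  using cl_relation[OF steenrod_relations.adem[OF assms]] by (simp add: SqR_def cl_simps)

lemma SqR_zero: "SqR 0 = \<one>\<^bsub>AR\<^esub>"
  using cl_relation[OF steenrod_relations.Sq_zero] by (simp add: SqR_def cl_simps)

lemma cl_fSq: "cl (fSq i) = SqR i" "cl ftau = tau" "cl frho = rho"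
  by (simp_all add: SqR_def tau_def rho_def)

lemma adem_rhs_one: "adem_rhs 1 b = of_nat (b - 1) * fSq (1 + b) * fSq 0"
proof -
  have "{j \<in> {0..1 div 2::nat}. odd j} = {}"
  proof (intro equals0I)
    fix j :: nat assume "j \<in> {j \<in> {0..1 div 2}. odd j}"
    then have "j \<le> 0" "odd j" by auto
    then show False by simp
  qed
  then show ?thesis unfolding adem_rhs_def by (simp only:) simp
qed

lemma adem_rhs_two:
  "adem_rhs 2 2 = ftau * fSq 3 * fSq 1"
  "adem_rhs 2 3 = fSq 5 * fSq 0 + fSq 4 * fSq 1 + frho * fSq 3 * fSq 1"
proof -
  have i: "{0..2 div 2::nat} = {0, 1}" by auto
  have o: "{j \<in> {0, 1::nat}. odd j} = {1}" by (auto elim: oddE)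
  have b: "Suc 0 choose 2 = 0" "2 choose 2 = 1" by (simp_all add: binomial_eq_0)
  show "adem_rhs 2 2 = ftau * fSq 3 * fSq 1"
    unfolding adem_rhs_def i by (simp add: b)
  show "adem_rhs 2 3 = fSq 5 * fSq 0 + fSq 4 * fSq 1 + frho * fSq 3 * fSq 1"
    unfolding adem_rhs_def i o by (simp add: b)
qed

lemma low_adem:
  "sq1 \<cdot> sq1 = \<zero>\<^bsub>AR\<^esub>"
  "sq1 \<cdot> sq2 = SqR 3"
  "sq1 \<cdot> SqR 3 = \<zero>\<^bsub>AR\<^esub>"
  "sq1 \<cdot> SqR 4 = SqR 5"
  "sq1 \<cdot> SqR 5 = \<zero>\<^bsub>AR\<^esub>"
  "sq2 \<cdot> sq2 = tau \<cdot> (SqR 3 \<cdot> sq1)"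
  "sq2 \<cdot> SqR 3 = SqR 5 \<boxplus> SqR 4 \<cdot> sq1 \<boxplus> rho \<cdot> (SqR 3 \<cdot> sq1)"
proof -
  have one: "sq1 \<cdot> SqR b = (if odd b then \<zero>\<^bsub>AR\<^esub> else SqR (Suc b))" if "1 \<le> b" for b
  proof -
    have "sq1 \<cdot> SqR b = cl (of_nat (b - 1) * fSq (1 + b) * fSq 0)"
      unfolding adem_rhs_one[symmetric] by (rule SqR_adem) (use that in auto)
    with that show ?thesis by (simp add: of_nat_free cl_simps cl_fSq SqR_zero)
  qed
  show "sq1 \<cdot> sq1 = \<zero>\<^bsub>AR\<^esub>" "sq1 \<cdot> sq2 = SqR 3" "sq1 \<cdot> SqR 3 = \<zero>\<^bsub>AR\<^esub>"
    "sq1 \<cdot> SqR 4 = SqR 5" "sq1 \<cdot> SqR 5 = \<zero>\<^bsub>AR\<^esub>"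
    by (subst one; simp)+
  show "sq2 \<cdot> sq2 = tau \<cdot> (SqR 3 \<cdot> sq1)"
    by (subst SqR_adem) (simp_all only: adem_rhs_two cl_simps cl_fSq AR.m_assoc gens_closed, simp_all?)
  show "sq2 \<cdot> SqR 3 = SqR 5 \<boxplus> SqR 4 \<cdot> sq1 \<boxplus> rho \<cdot> (SqR 3 \<cdot> sq1)"
    by (subst SqR_adem) (simp_all only: adem_rhs_two cl_simps cl_fSq SqR_zero AR.m_assoc gens_closed, simp_all?)
qed

lemma rho_comm:
  "tau \<cdot> rho = rho \<cdot> tau" "SqR i \<cdot> rho = rho \<cdot> SqR i"
  using cl_relation[OF steenrod_relations.rho_central[of Tau]]
    cl_relation[OF steenrod_relations.rho_central[of "Sq i"]]
  by (simp_all only: cl_simps cl_fSq)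

lemma sq_tau:
  "sq1 \<cdot> tau = tau \<cdot> sq1 \<boxplus> rho"
  "sq2 \<cdot> tau = tau \<cdot> sq2 \<boxplus> rho \<cdot> (tau \<cdot> sq1)"
  using cl_relation[OF steenrod_relations.Sq_one_tau] cl_relation[OF steenrod_relations.Sq_even_tau[of 1]]
  by (simp_all add: cl_simps cl_fSq AR.m_assoc)

section \<open>The polynomial subring on tau and rho\<close>

definition rho_poly :: "bit poly \<Rightarrow> free_steenrod" where
  "rho_poly a = fold_coeffs (\<lambda>b y. (if b = 1 then 1 else 0) + frho * y) a 0"

lemma rho_poly_pCons: "rho_poly (pCons b a) = (if b = 1 then 1 else 0) + frho * rho_poly a"
  by (cases "b = 0"; cases "a = 0") (simp_all add: rho_poly_def)

lemma rho_poly_zero [simp]: "rho_poly 0 = 0"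
  by (simp add: rho_poly_def)

lemma rho_poly_add: "rho_poly (a + b) = rho_poly a + rho_poly b"
proof (induction a b rule: poly_induct2)
  case (pCons a p b q)
  have "2 = (0 :: free_steenrod)"
    using free_char_two[of 1] by (simp only: one_add_one)
  then have "(if a + b = 1 then 1 else 0) = (if a = 1 then 1 else 0) + (if b = 1 then 1 else 0 :: free_steenrod)"
    by (cases a; cases b) simp_all
  then show ?case
    by (simp only: add_pCons rho_poly_pCons pCons.IH distrib_left add_ac)
qed simp

text \<open>Horner evaluation at \<open>ftau\<close> and \<open>frho\<close>. These do not commute
  in the free algebra, so the evaluation becomes multiplicative only for the classes
  \<open>coef\<close>.\<close>

definition tau_poly :: "cpoly \<Rightarrow> free_steenrod" where
  "tau_poly f = fold_coeffs (\<lambda>a y. rho_poly a + ftau * y) f 0"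

lemma tau_poly_pCons: "tau_poly (pCons a f) = rho_poly a + ftau * tau_poly f"
  by (cases "a = 0"; cases "f = 0") (simp_all add: tau_poly_def)

lemma tau_poly_zero [simp]: "tau_poly 0 = 0"
  by (simp add: tau_poly_def)

lemma tau_poly_add: "tau_poly (f + g) = tau_poly f + tau_poly g"
  by (induction f g rule: poly_induct2) (simp_all add: tau_poly_pCons rho_poly_add distrib_left add_ac)

definition coef :: "cpoly \<Rightarrow> steenrod" where
  "coef f = cl (tau_poly f)"

lemma coef_closed [simp]: "coef f \<in> carrier AR"
  by (simp add: coef_def cl_simps)

lemma coef_zero [simp]: "coef 0 = \<zero>\<^bsub>AR\<^esub>"
  by (simp add: coef_def cl_simps)

lemma coef_one: "coef 1 = \<one>\<^bsub>AR\<^esub>"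
  by (simp add: coef_def one_pCons tau_poly_pCons rho_poly_pCons cl_simps)

lemma coef_add: "coef (f + g) = coef f \<boxplus> coef g"
  by (simp add: coef_def tau_poly_add cl_simps)

lemma coef_T: "coef (tpoly * f) = tau \<cdot> coef f"
proof -
  have "tpoly * f = pCons 0 f" by (simp add: tpoly_def)
  then show ?thesis by (simp add: coef_def tau_poly_pCons cl_simps cl_fSq)
qed

lemma coef_R: "coef (rpoly * f) = rho \<cdot> coef f"
proof (induction f)
  case (pCons a f)
  have e: "rpoly * pCons a f = pCons (pCons 0 a) (rpoly * f)" by (simp add: rpoly_def)
  have "coef (rpoly * pCons a f) = rho \<cdot> cl (rho_poly a) \<boxplus> tau \<cdot> coef (rpoly * f)"
    unfolding e by (simp add: coef_def tau_poly_pCons rho_poly_pCons cl_simps cl_fSq)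
  also have "\<dots> = rho \<cdot> cl (rho_poly a) \<boxplus> rho \<cdot> (tau \<cdot> coef f)"
    unfolding pCons.IH by (simp add: AR.m_assoc[symmetric] rho_comm)
  also have "\<dots> = rho \<cdot> coef (pCons a f)"
    by (simp add: coef_def tau_poly_pCons cl_simps cl_fSq AR.r_distr)
  finally show ?case .
qed simp

lemma cpoly_induct [case_names zero one tpoly rpoly add]:
  assumes zero: "C 0" and one: "C 1" and tpoly: "\<And>f. C f \<Longrightarrow> C (tpoly * f)" and rpoly: "\<And>f. C f \<Longrightarrow> C (rpoly * f)"
    and add: "\<And>f g. C f \<Longrightarrow> C g \<Longrightarrow> C (f + g)"
  shows "C f"
proof -
  have const: "C [:a:]" for a
  proof (induction a)
    case (pCons b a)
    have "[:pCons b a:] = [:[:b:]:] + rpoly * [:a:]" by (simp add: rpoly_def)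
    moreover have "[:[:b:]:] = 0 \<or> [:[:b:]:] = (1 :: cpoly)"
      by (cases b) (simp_all add: one_pCons)
    ultimately show ?case using zero one rpoly[OF pCons.IH] add by metis
  qed (simp add: zero)
  show ?thesis
  proof (induction f)
    case (pCons a f)
    then show ?case using pCons_T[of a f] const[of a] tpoly[of f] add by metis
  qed (rule zero)
qed

lemma act_coef: "act (coef f) = scale f"
proof (induction f rule: cpoly_induct)
  case zero
  show ?case by (rule endo_eqI) (simp add: act_gens app_ops zero_prod_def)
next
  case one
  show ?case by (rule endo_eqI) (simp add: coef_one act_gens app_ops)
next
  case (tpoly f)
  show ?case by (rule endo_eqI) (simp add: coef_T act_simps act_gens tpoly app_ops mult.assoc)
next
  case (rpoly f)
  show ?case by (rule endo_eqI) (simp add: coef_R act_simps act_gens rpoly app_ops mult.assoc)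
next
  case (add f g)
  show ?case by (rule endo_eqI) (simp add: coef_add act_simps add app_ops distrib_right)
qed

text \<open>Acting on the generator 1 recovers the polynomial. So tau and rho are algebraically
  independent in \<open>AR\<close>, and together with \<open>M2R_coef\<close> this identifies
  \<open>M2R\<close> with the polynomial ring.\<close>

lemma coef_inj: "coef f = coef g \<Longrightarrow> f = g"
proof -
  assume "coef f = coef g"
  then have "app (scale f) (1, 0) = app (scale g) (1, 0)" by (metis act_coef)
  then show "f = g" by (simp add: app_ops)
qed

section \<open>The subrings \<open>M2R\<close> and \<open>A1R\<close>\<close>

lemma M2R_simps [simp]: "\<zero>\<^bsub>M2R\<^esub> = \<zero>\<^bsub>AR\<^esub>" "\<one>\<^bsub>M2R\<^esub> = \<one>\<^bsub>AR\<^esub>" "x \<oplus>\<^bsub>M2R\<^esub> y = x \<boxplus> y" "x \<otimes>\<^bsub>M2R\<^esub> y = x \<cdot> y"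
  "\<zero>\<^bsub>A1R\<^esub> = \<zero>\<^bsub>AR\<^esub>" "\<one>\<^bsub>A1R\<^esub> = \<one>\<^bsub>AR\<^esub>" "x \<oplus>\<^bsub>A1R\<^esub> y = x \<boxplus> y" "x \<otimes>\<^bsub>A1R\<^esub> y = x \<cdot> y"
  by (simp_all add: M2R_def A1R_def)

lemma M2R_carrier: "carrier M2R = generate_ring AR {tau, rho}"
  and A1R_carrier: "carrier A1R = generate_ring AR {tau, rho, sq1, sq2}"
  by (simp_all add: M2R_def A1R_def)

lemma M2R_ring: "ring M2R" and A1R_ring: "ring A1R"
  unfolding M2R_def A1R_def by (rule AR.generate_ring_is_ring; simp)+

lemma M2R_sub: "carrier M2R \<subseteq> carrier A1R" and A1R_sub: "carrier A1R \<subseteq> carrier AR"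
  unfolding M2R_carrier A1R_carrier
  by (rule AR.mono_generate_ring, simp, simp) (rule AR.generate_ring_incl, simp)

lemma A1R_gens [simp]: "tau \<in> carrier A1R" "rho \<in> carrier A1R" "sq1 \<in> carrier A1R" "sq2 \<in> carrier A1R"
  unfolding A1R_carrier by (auto intro: generate_ring.incl)

lemma M2R_gens [simp]: "tau \<in> carrier M2R" "rho \<in> carrier M2R"
  unfolding M2R_carrier by (auto intro: generate_ring.incl)

lemma coef_M2R: "coef f \<in> carrier M2R"
proof (induction f rule: cpoly_induct)
  case zero show ?case using ring.ring_simprules(2)[OF M2R_ring] by simp
next
  case one show ?case using ring.ring_simprules(6)[OF M2R_ring] by (simp add: coef_one)
next
  case (tpoly f) then show ?case using ring.ring_simprules(5)[OF M2R_ring, of tau] by (simp add: coef_T)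
next
  case (rpoly f) then show ?case using ring.ring_simprules(5)[OF M2R_ring, of rho] by (simp add: coef_R)
next
  case (add f g) then show ?case using ring.ring_simprules(1)[OF M2R_ring] by (simp add: coef_add)
qed

text \<open>Stability need only be tested on generators; inverses cause no trouble since -h = h.
  Starting from x = 1 it bounds the generated subring, and it also serves to show that a set is
  closed under left multiplication.\<close>

lemma generate_ring_stable:
  assumes H: "H \<subseteq> carrier AR" and S: "S \<subseteq> carrier AR"
    and add: "\<And>x y. x \<in> S \<Longrightarrow> y \<in> S \<Longrightarrow> x \<boxplus> y \<in> S"
    and gen: "\<And>h x. h \<in> H \<Longrightarrow> x \<in> S \<Longrightarrow> h \<cdot> x \<in> S"
    and a: "a \<in> generate_ring AR H" and x: "x \<in> S"
  shows "a \<cdot> x \<in> S"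
  using a x
proof (induction arbitrary: x)
  case one
  then show ?case using S by auto
next
  case (a_inv h)
  then have "h \<in> carrier AR" using AR.generate_ring_in_carrier[OF H] by blast
  then show ?case using a_inv by (simp add: AR_a_inv)
next
  case (eng_add h h')
  moreover have "h \<in> carrier AR" "h' \<in> carrier AR" "x \<in> carrier AR"
    using eng_add AR.generate_ring_in_carrier[OF H] S by auto
  ultimately show ?case by (simp add: AR.l_distr add)
next
  case (eng_mult h h')
  moreover have "h \<in> carrier AR" "h' \<in> carrier AR" "x \<in> carrier AR"
    using eng_mult AR.generate_ring_in_carrier[OF H] S by auto
  ultimately show ?case by (simp add: AR.m_assoc)
qed (rule gen)

lemma M2R_coef: "a \<in> carrier M2R \<Longrightarrow> \<exists>f. a = coef f"
proof -
  assume "a \<in> carrier M2R"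
  then have "a \<cdot> \<one>\<^bsub>AR\<^esub> \<in> range coef"
    unfolding M2R_carrier
  proof (rule generate_ring_stable[rotated 4])
    show "\<one>\<^bsub>AR\<^esub> \<in> range coef" using coef_one by (metis rangeI)
  qed (auto simp: coef_add[symmetric] coef_T[symmetric] coef_R[symmetric])
  moreover have "a \<in> carrier AR" using \<open>a \<in> carrier M2R\<close> M2R_sub A1R_sub by auto
  ultimately show ?thesis by auto
qed

section \<open>The monomial basis of \<open>A1R\<close>\<close>

lemma A1R_in_AR [simp]: "x \<in> carrier A1R \<Longrightarrow> x \<in> carrier AR"
  using A1R_sub by blast

lemma coef_A1R [simp]: "coef f \<in> carrier A1R"
  using coef_M2R M2R_sub by blast

lemma A1R_closed [simp]:
  "x \<in> carrier A1R \<Longrightarrow> y \<in> carrier A1R \<Longrightarrow> x \<boxplus> y \<in> carrier A1R"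
  "x \<in> carrier A1R \<Longrightarrow> y \<in> carrier A1R \<Longrightarrow> x \<cdot> y \<in> carrier A1R"
  "\<one>\<^bsub>AR\<^esub> \<in> carrier A1R" "\<zero>\<^bsub>AR\<^esub> \<in> carrier A1R"
  using ring.ring_simprules(1,2,5,6)[OF A1R_ring] by simp_all

text \<open>The alternating words in \<open>sq1\<close> and \<open>sq2\<close> of length at most
  four, where the two of length four coincide. Repeated letters and longer words are removed by
  \<open>quotient_relations\<close>.\<close>

definition sq_basis :: "nat \<Rightarrow> steenrod" where
  "sq_basis k = [\<one>\<^bsub>AR\<^esub>, sq1, sq2, sq1 \<cdot> sq2, sq2 \<cdot> sq1, sq1 \<cdot> (sq2 \<cdot> sq1),
     sq2 \<cdot> (sq1 \<cdot> sq2), sq2 \<cdot> (sq1 \<cdot> (sq2 \<cdot> sq1))] ! k"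

lemma less_8_iff: "k < 8 \<longleftrightarrow> k = 0 \<or> k = 1 \<or> k = 2 \<or> k = 3 \<or> k = 4 \<or> k = 5 \<or> k = 6 \<or> k = (7::nat)"
  by auto

lemma lessThan_8: "{..<8} = {0, 1, 2, 3, 4, 5, 6, 7::nat}"
  by (auto simp: less_8_iff)

lemma sq_basis_simps:
  "sq_basis 0 = \<one>\<^bsub>AR\<^esub>" "sq_basis 1 = sq1" "sq_basis (Suc 0) = sq1" "sq_basis 2 = sq2" "sq_basis 3 = sq1 \<cdot> sq2"
  "sq_basis 4 = sq2 \<cdot> sq1" "sq_basis 5 = sq1 \<cdot> (sq2 \<cdot> sq1)"
  "sq_basis 6 = sq2 \<cdot> (sq1 \<cdot> sq2)" "sq_basis 7 = sq2 \<cdot> (sq1 \<cdot> (sq2 \<cdot> sq1))"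
  by (simp_all add: sq_basis_def)

lemma sq_basis_A1R [simp]: "k < 8 \<Longrightarrow> sq_basis k \<in> carrier A1R"
  using A1R_gens(3) by (subst (asm) less_8_iff) (elim disjE; simp add: sq_basis_simps)

lemma quotient_relations:
  "sq1 \<cdot> sq1 = \<zero>\<^bsub>AR\<^esub>"
  "sq2 \<cdot> sq2 = tau \<cdot> (sq1 \<cdot> (sq2 \<cdot> sq1))"
  "sq1 \<cdot> (sq2 \<cdot> (sq1 \<cdot> sq2)) = sq2 \<cdot> (sq1 \<cdot> (sq2 \<cdot> sq1))"
proof -
  note [simp del] = One_nat_def
  show q: "sq1 \<cdot> sq1 = \<zero>\<^bsub>AR\<^esub>" by (rule low_adem)
  show "sq2 \<cdot> sq2 = tau \<cdot> (sq1 \<cdot> (sq2 \<cdot> sq1))"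
    unfolding low_adem(6) low_adem(2)[symmetric] by (simp add: AR.m_assoc)
  \<comment> \<open>Both sides of the last relation equal \<open>SqR 5 \<cdot> sq1\<close>: the Adem
    relation for \<open>sq2 \<cdot> SqR 3\<close> is multiplied by \<open>sq1\<close> once from the
    left and once from the right, and in each case a single summand survives.\<close>
  have "sq1 \<cdot> (SqR 4 \<cdot> sq1) = SqR 5 \<cdot> sq1"
    by (simp add: AR.m_assoc[symmetric] low_adem(4))
  moreover have "sq1 \<cdot> (rho \<cdot> (SqR 3 \<cdot> sq1)) = rho \<cdot> ((sq1 \<cdot> SqR 3) \<cdot> sq1)"
    by (simp add: AR.m_assoc[symmetric] rho_comm)
  ultimately have 1: "sq1 \<cdot> (sq2 \<cdot> SqR 3) = SqR 5 \<cdot> sq1"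
    by (simp add: low_adem(3,5,7) AR.r_distr)
  have "(SqR 4 \<cdot> sq1) \<cdot> sq1 = \<zero>\<^bsub>AR\<^esub>" "(rho \<cdot> (SqR 3 \<cdot> sq1)) \<cdot> sq1 = \<zero>\<^bsub>AR\<^esub>"
    by (simp_all add: AR.m_assoc q)
  then have 2: "(sq2 \<cdot> SqR 3) \<cdot> sq1 = SqR 5 \<cdot> sq1"
    by (simp add: low_adem(7) AR.l_distr)
  show "sq1 \<cdot> (sq2 \<cdot> (sq1 \<cdot> sq2)) = sq2 \<cdot> (sq1 \<cdot> (sq2 \<cdot> sq1))"
    using 1 2 by (simp add: low_adem(2)[symmetric] AR.m_assoc)
qed

definition lin_comb :: "(nat \<Rightarrow> cpoly) \<Rightarrow> steenrod" where
  "lin_comb c = (\<Oplus>\<^bsub>AR\<^esub>k\<in>{..<8}. coef (c k) \<cdot> sq_basis k)"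

lemma lin_comb_closed [simp]: "lin_comb c \<in> carrier AR"
  by (auto simp: lin_comb_def intro!: AR.finsum_closed)

lemma lin_comb_add: "lin_comb (\<lambda>k. c k + d k) = lin_comb c \<boxplus> lin_comb d"
  unfolding lin_comb_def
  by (subst AR.finsum_addf[symmetric]) (rule AR.finsum_cong' | force simp: coef_add AR.l_distr)+

lemma lin_comb_T: "lin_comb (\<lambda>k. tpoly * c k) = tau \<cdot> lin_comb c"
  unfolding lin_comb_def
  by (subst AR.finsum_rdistr) (rule AR.finsum_cong' | force simp: coef_T AR.m_assoc)+

lemma lin_comb_R: "lin_comb (\<lambda>k. rpoly * c k) = rho \<cdot> lin_comb c"
  unfolding lin_comb_def
  by (subst AR.finsum_rdistr) (rule AR.finsum_cong' | force simp: coef_R AR.m_assoc)+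

lemma lin_comb_zero: "lin_comb (\<lambda>k. 0) = \<zero>\<^bsub>AR\<^esub>"
  unfolding lin_comb_def by (rule AR.add.finprod_one_eqI) auto

lemma lin_comb_basis:
  assumes "k < 8" shows "lin_comb (\<lambda>j. if j = k then 1 else 0) = sq_basis k"
proof -
  have "lin_comb (\<lambda>j. if j = k then 1 else 0) = (\<Oplus>\<^bsub>AR\<^esub>j\<in>{..<8}. if k = j then sq_basis j else \<zero>\<^bsub>AR\<^esub>)"
    unfolding lin_comb_def by (rule AR.finsum_cong') (auto simp: coef_one)
  also have "\<dots> = sq_basis k"
    by (rule AR.finsum_singleton) (use assms in auto)
  finally show ?thesis .
qed

lemma A1R_lin_comb:
  assumes "x \<in> carrier A1R" shows "\<exists>c. x = lin_comb c"
proof -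
  let ?S = "range lin_comb"
  \<comment> \<open>The elements of the span whose multiples by \<open>sq1\<close> and
    \<open>sq2\<close> stay in the span. It contains the monomials and is closed under sums, tau and
    rho, hence is all of \<open>?S\<close>. That y itself lies in \<open>?S\<close> is used for the
    summand \<open>rho \<cdot> y\<close> of \<open>sq1 \<cdot> (tau \<cdot> y)\<close>.\<close>
  let ?S' = "{y \<in> carrier AR. y \<in> ?S \<and> sq1 \<cdot> y \<in> ?S \<and> sq2 \<cdot> y \<in> ?S}"
  have add: "x \<boxplus> y \<in> ?S" if "x \<in> ?S" "y \<in> ?S" for x y
    using that by (auto simp: lin_comb_add[symmetric])
  have tau: "tau \<cdot> x \<in> ?S" if "x \<in> ?S" for x
    using that by (auto simp: lin_comb_T[symmetric])
  have rho: "rho \<cdot> x \<in> ?S" if "x \<in> ?S" for x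
    using that by (auto simp: lin_comb_R[symmetric])
  have zero: "\<zero>\<^bsub>AR\<^esub> \<in> ?S" using lin_comb_zero by (metis rangeI)
  have basis: "sq_basis k \<in> ?S" if "k < 8" for k
    using lin_comb_basis[OF that] by (metis rangeI)
  note b = basis[of 0] basis[of 1] basis[of 2] basis[of 3] basis[of 4] basis[of 5] basis[of 6] basis[of 7]
  note b = b[unfolded sq_basis_simps, simplified]
  have q: "sq1 \<cdot> (sq1 \<cdot> x) = \<zero>\<^bsub>AR\<^esub>"
    "sq2 \<cdot> (sq2 \<cdot> x) = tau \<cdot> (sq1 \<cdot> (sq2 \<cdot> (sq1 \<cdot> x)))"
    "sq1 \<cdot> (sq2 \<cdot> (sq1 \<cdot> (sq2 \<cdot> x))) = sq2 \<cdot> (sq1 \<cdot> (sq2 \<cdot> (sq1 \<cdot> x)))"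
    if "x \<in> carrier AR" for x
    using that quotient_relations by (simp_all add: AR.m_assoc[symmetric])
  have S': "sq_basis k \<in> ?S'" if "k < 8" for k
  proof -
    note r = quotient_relations[unfolded One_nat_def] q[unfolded One_nat_def]
    have "sq1 \<cdot> sq_basis k \<in> ?S \<and> sq2 \<cdot> sq_basis k \<in> ?S"
      using that b zero unfolding less_8_iff
      by (elim disjE) (simp_all add: sq_basis_simps r tau)
    then show ?thesis using basis[OF that] that by simp
  qed
  have add': "x \<boxplus> y \<in> ?S'" if "x \<in> ?S'" "y \<in> ?S'" for x y
    using that by (auto simp: AR.r_distr intro!: add)
  have rho': "rho \<cdot> x \<in> ?S'" if "x \<in> ?S'" for x
  proof -
    have "SqR i \<cdot> (rho \<cdot> x) = rho \<cdot> (SqR i \<cdot> x)" for i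
      using that by (simp add: AR.m_assoc[symmetric] rho_comm)
    then show ?thesis using that by (auto intro!: rho)
  qed
  have tau': "tau \<cdot> x \<in> ?S'" if "x \<in> ?S'" for x
  proof -
    have x: "x \<in> carrier AR" using that by simp
    have "sq1 \<cdot> (tau \<cdot> x) = tau \<cdot> (sq1 \<cdot> x) \<boxplus> rho \<cdot> x"
      "sq2 \<cdot> (tau \<cdot> x) = tau \<cdot> (sq2 \<cdot> x) \<boxplus> rho \<cdot> (tau \<cdot> (sq1 \<cdot> x))"
      using x sq_tau by (simp_all add: AR.m_assoc[symmetric] AR.l_distr)
    moreover have "tau \<cdot> (sq1 \<cdot> x) \<boxplus> rho \<cdot> x \<in> ?S"
      "tau \<cdot> (sq2 \<cdot> x) \<boxplus> rho \<cdot> (tau \<cdot> (sq1 \<cdot> x)) \<in> ?S" "tau \<cdot> x \<in> ?S"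
      using that by (blast intro: add tau rho)+
    ultimately show ?thesis using x by simp
  qed
  have zero': "\<zero>\<^bsub>AR\<^esub> \<in> ?S'" using zero by simp
  have coef': "coef f \<cdot> sq_basis k \<in> ?S'" if "k < 8" for f k
  proof (induction f rule: cpoly_induct)
    case zero
    show ?case using zero' that by simp
  next
    case one
    show ?case using S'[OF that] that by (simp add: coef_one)
  next
    case (tpoly f)
    show ?case using tau'[OF tpoly] that by (simp add: coef_T AR.m_assoc)
  next
    case (rpoly f)
    show ?case using rho'[OF rpoly] that by (simp add: coef_R AR.m_assoc)
  next
    case (add f g)
    show ?case using add'[OF add] that by (simp add: coef_add AR.l_distr)
  qed
  have fin: "(\<Oplus>\<^bsub>AR\<^esub>k\<in>F. coef (c k) \<cdot> sq_basis k) \<in> ?S'" if "finite F" "F \<subseteq> {..<8}" for c F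
    using that
  proof (induction F)
    case empty
    show ?case using zero' by simp
  next
    case (insert k F)
    then have "coef (c k) \<cdot> sq_basis k \<boxplus> (\<Oplus>\<^bsub>AR\<^esub>k\<in>F. coef (c k) \<cdot> sq_basis k) \<in> ?S'"
      by (intro add' coef') simp_all
    moreover have "(\<Oplus>\<^bsub>AR\<^esub>k\<in>insert k F. coef (c k) \<cdot> sq_basis k) =
        coef (c k) \<cdot> sq_basis k \<boxplus> (\<Oplus>\<^bsub>AR\<^esub>k\<in>F. coef (c k) \<cdot> sq_basis k)"
      using insert by (intro AR.finsum_insert) auto
    ultimately show ?case by (simp only:)
  qed
  have stable: "x \<in> ?S'" if "x \<in> ?S" for x
    using that fin[of "{..<8}"] by (auto simp only: lin_comb_def[symmetric])
  have "x \<cdot> \<one>\<^bsub>AR\<^esub> \<in> ?S"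
    using assms unfolding A1R_carrier
  proof (rule generate_ring_stable[rotated 4])
    show "\<one>\<^bsub>AR\<^esub> \<in> ?S" using basis[of 0] by (simp add: sq_basis_simps)
    show "h \<cdot> y \<in> ?S" if "h \<in> {tau, rho, sq1, sq2}" "y \<in> ?S" for h y
      using that stable[OF that(2)] tau rho by auto
  qed (use add in auto)
  then show ?thesis using assms by auto
qed

lemma act_finsum:
  assumes "finite F" "f \<in> F \<rightarrow> carrier AR"
  shows "act (\<Oplus>\<^bsub>AR\<^esub>k\<in>F. f k) = (\<Sum>k\<in>F. act (f k))"
  using assms
proof (induction F)
  case (insert k F)
  then show ?case
    by (subst AR.finsum_insert) (auto simp: act_simps AR.finsum_closed)
qed (simp add: act_gens)

lemma act_sq: "act sq1 = QE 0" "act sq2 = PE 1"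
proof -
  have "E.Sqe 1 = QE (int 0)" "E.Sqe 2 = PE (int 1)" by (rule E.Sqe_intro; simp)+
  then show "act sq1 = QE 0" "act sq2 = PE 1" by (simp_all add: act_gens)
qed

lemma act_lin_comb: "act (lin_comb c) = (\<Sum>k\<in>{..<8}. scale (c k) * act (sq_basis k))"
  unfolding lin_comb_def by (subst act_finsum) (auto simp: act_simps act_coef)

lemma tpoly_rpoly_nonzero [simp]: "tpoly \<noteq> 0" "rpoly \<noteq> 0"
  by (simp_all add: tpoly_def rpoly_def)

lemma ptP_one: "ptP i 1 = (if i = 0 then 1 else 0)" "ptQ i 1 = 0"
  using ptP_const[of i 1] ptQ_const[of i 1] by (auto simp: one_pCons)

lemma lin_comb_independent:
  assumes "act (lin_comb c) = 0" "k < 8" shows "c k = 0"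
proof -
  have *: "(\<Sum>k\<in>{..<8}. app (scale (c k)) (app (act (sq_basis k)) x)) = 0" for x
    using assms(1) app_sum[of "\<lambda>k. scale (c k) * act (sq_basis k)" "{..<8}" x] by (simp add: act_lin_comb)
  have qT: "ptQ 0 (tpoly * f) = tpoly * ptQ 0 f + rpoly * f" for f
    by (simp add: ptQ_T ptP_zero pt_neg)
  have pT: "ptP 1 (tpoly * f) = tpoly * ptP 1 f + rpoly * (tpoly * ptQ 0 f)" for f
    by (simp add: ptP_T)
  have qR: "ptQ 0 (rpoly * f) = rpoly * ptQ 0 f" and pR: "ptP 1 (rpoly * f) = rpoly * ptP 1 f" for f
    by (simp_all add: ptQ_R ptP_R)
  have a: "app (act sq1) (f, g) = (ptQ 0 f, ptQ 0 g)" "app (act sq2) (f, g) = (ptP 1 f, ptP 1 g + f)" for f g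
    by (simp_all add: act_sq act_sq(1)[unfolded One_nat_def] app_ops pt_neg ptP_zero)
  have v: "ptQ 0 1 = 0" "ptP 1 1 = 0" "ptQ 0 tpoly = rpoly" "ptP 1 tpoly = 0" "ptQ 0 rpoly = 0" "ptP 1 rpoly = 0"
    using qT[of 1] pT[of 1] qR[of 1] pR[of 1] by (simp_all add: ptP_one)
  have v2: "ptQ 0 (tpoly * tpoly) = 0" "ptP 1 (tpoly * tpoly) = rpoly * (tpoly * rpoly)"
    using qT[of tpoly] pT[of tpoly] by (simp_all add: v mult.commute cpoly_add_self)
  have v3: "ptQ 0 (tpoly * (tpoly * tpoly)) = rpoly * (tpoly * tpoly)" "ptP 1 (tpoly * (tpoly * tpoly)) = tpoly * (rpoly * (tpoly * rpoly))"
    using qT[of "tpoly * tpoly"] pT[of "tpoly * tpoly"] by (simp_all add: v2)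
  have v4: "ptQ 0 (tpoly * rpoly) = rpoly * rpoly" "ptP 1 (tpoly * rpoly) = 0"
    using qT[of rpoly] pT[of rpoly] by (simp_all add: v)
  note vals = v v2 v3 v4 qR pR a sq_basis_simps act_simps act_gens(5) app_ops zero_prod_def
    v[unfolded One_nat_def] v2[unfolded One_nat_def] v3[unfolded One_nat_def]
    a[unfolded One_nat_def] pR[unfolded One_nat_def]
  \<comment> \<open>A triangular system, each evaluation giving one equation per component. Up to
    coefficients already known to vanish, the values are (c 0, c 2) at 1, rho (c 1, c 3 + c 4) at
    tau, rho^3 (c 3, c 6) at tau^2 and rho^4 (c 5, c 7) at tau^3.\<close>
  have "c 0 = 0 \<and> c 2 = 0"
    using *[of "(1, 0)"] unfolding lessThan_8 by (simp add: vals)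
  moreover from this have "c 1 = 0 \<and> c 3 + c 4 = 0"
    using *[of "(tpoly, 0)"] unfolding lessThan_8 by (simp add: vals distrib_right[symmetric])
  moreover from calculation have "c 3 = 0 \<and> c 6 = 0"
    using *[of "(tpoly * tpoly, 0)"] unfolding lessThan_8 by (simp add: vals)
  moreover from calculation have "c 5 = 0 \<and> c 7 = 0"
    using *[of "(tpoly * (tpoly * tpoly), 0)"] unfolding lessThan_8 by (simp add: vals)
  ultimately show ?thesis using assms(2) unfolding less_8_iff by auto
qed

lemma A1R_faithful:
  assumes "x \<in> carrier A1R" "act x = 0" shows "x = \<zero>\<^bsub>AR\<^esub>"
proof -
  obtain c where c: "x = lin_comb c" using A1R_lin_comb assms by blast
  then have "c k = 0" if "k < 8" for k using lin_comb_independent[of c k] that assms by simp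
  then show ?thesis unfolding c lin_comb_def by (intro AR.add.finprod_one_eqI) auto
qed

lemma lin_comb_inj:
  assumes "lin_comb c = lin_comb d" "k < 8" shows "c k = d k"
proof -
  have "act (lin_comb (\<lambda>k. c k + d k)) = 0"
    by (simp add: lin_comb_add act_simps assms E.char_two)
  from lin_comb_independent[OF this assms(2)] have "c k + d k = 0" .
  then show ?thesis by (metis add.assoc add_0 add_0_right cpoly_add_self)
qed

text \<open>The powers of the ideal \<open>(\<tau>,\<rho>)\<close>.\<close>

fun filt :: "nat \<Rightarrow> steenrod set" where
  "filt 0 = carrier A1R"
| "filt (Suc n) = {tau \<cdot> x \<boxplus> rho \<cdot> y | x y. x \<in> filt n \<and> y \<in> filt n}"

lemma filt_A1R: "x \<in> filt n \<Longrightarrow> x \<in> carrier A1R"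
  by (induction n arbitrary: x) auto

text \<open>Membership in the n-th power of (tau, rho) in \<open>F_2[rho][tau]\<close>: i counts tau
  and j counts rho.\<close>

definition order_ge :: "nat \<Rightarrow> cpoly \<Rightarrow> bool" where
  "order_ge n f \<longleftrightarrow> (\<forall>i j. i + j < n \<longrightarrow> coeff (coeff f i) j = 0)"

lemma order_ge_Suc:
  assumes "order_ge n f" "order_ge n g" shows "order_ge (Suc n) (tpoly * f + rpoly * g)"
  unfolding order_ge_def
proof (intro allI impI)
  fix i j assume ij: "i + j < Suc n"
  have "coeff (coeff (tpoly * f) i) j = 0"
    using assms(1) ij by (cases i) (auto simp: tpoly_def order_ge_def coeff_pCons)
  moreover have "coeff (coeff (rpoly * g) i) j = 0"
    using assms(2) ij by (cases j) (auto simp: rpoly_def order_ge_def coeff_pCons)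
  ultimately show "coeff (coeff (tpoly * f + rpoly * g) i) j = 0" by simp
qed

lemma filt_act:
  "x \<in> filt n \<Longrightarrow> order_ge n (fst (app (act x) v)) \<and> order_ge n (snd (app (act x) v))"
proof (induction n arbitrary: x)
  case (Suc n)
  then obtain y z where x: "x = tau \<cdot> y \<boxplus> rho \<cdot> z" "y \<in> filt n" "z \<in> filt n"
    by auto
  then have "y \<in> carrier AR" "z \<in> carrier AR" by (auto dest: filt_A1R)
  then have "app (act x) v = (tpoly * fst (app (act y) v) + rpoly * fst (app (act z) v), tpoly * snd (app (act y) v) + rpoly * snd (app (act z) v))"
    by (simp add: x act_simps act_gens app_ops)
  then show ?case using Suc.IH[OF x(2)] Suc.IH[OF x(3)] by (simp add: order_ge_Suc)
qed (simp add: order_ge_def)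

text \<open>The components of every value of \<open>act x\<close> have infinite order at (tau, rho),
  which for polynomials means zero; faithfulness on \<open>A1R\<close> then gives the claim.\<close>

lemma filt_Inter:
  assumes "\<And>n. x \<in> filt n" shows "x = \<zero>\<^bsub>AR\<^esub>"
proof (rule A1R_faithful)
  show "x \<in> carrier A1R" using assms[of 0] by simp
  have "f = 0" if "\<And>n. order_ge n f" for f
  proof (intro poly_eqI)
    fix i j show "coeff (coeff f i) j = coeff (coeff 0 i) j"
      using that[of "Suc (i + j)"] by (simp add: order_ge_def)
  qed
  then show "act x = 0"
    using filt_act[OF assms] by (intro endo_eqI) (simp add: prod_eq_iff)
qed

section \<open>Bidegrees of the generators and the ideal of tau and rho\<close>

lemma gen_graded: "tau \<in> A1R_grading (0, 1)" "rho \<in> A1R_grading (1, 1)" "sq1 \<in> A1R_grading (1, 0)" "sq2 \<in> A1R_grading (2, 1)"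
proof -
  have "cl (gen g) \<in> AR_grading (gen_bideg g)" for g
    unfolding AR_grading_def by (rule imageI) (simp add: free_homogeneous_def gen_def word_bideg_def)
  from this[of Tau] this[of Rho] this[of "Sq 1"] this[of "Sq 2"]
  show "tau \<in> A1R_grading (0, 1)" "rho \<in> A1R_grading (1, 1)" "sq1 \<in> A1R_grading (1, 0)" "sq2 \<in> A1R_grading (2, 1)"
    using A1R_gens by (simp_all add: A1R_grading_def cl_fSq)
qed

lemma A1R_char_two: "x \<in> carrier A1R \<Longrightarrow> x \<boxplus> x = \<zero>\<^bsub>AR\<^esub>"
  by (simp add: AR_char_two)

lemma A1R_a_inv: "x \<in> carrier A1R \<Longrightarrow> \<ominus>\<^bsub>A1R\<^esub> x = x"
proof -
  interpret A: ring A1R by (rule A1R_ring)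
  show "x \<in> carrier A1R \<Longrightarrow> \<ominus>\<^bsub>A1R\<^esub> x = x"
    using A.minus_equality[of x x] by (simp add: A1R_char_two)
qed

lemma sq_tau_rho_left:
  assumes "x \<in> carrier AR"
  shows "sq1 \<cdot> (tau \<cdot> x) = tau \<cdot> (sq1 \<cdot> x) \<boxplus> rho \<cdot> x"
    "sq2 \<cdot> (tau \<cdot> x) = tau \<cdot> (sq2 \<cdot> x) \<boxplus> rho \<cdot> (tau \<cdot> (sq1 \<cdot> x))"
    "SqR i \<cdot> (rho \<cdot> x) = rho \<cdot> (SqR i \<cdot> x)"
    "tau \<cdot> (rho \<cdot> x) = rho \<cdot> (tau \<cdot> x)"
  using assms sq_tau rho_comm by (simp_all add: AR.m_assoc[symmetric] AR.l_distr)

lemma tau_rho_idealI: "a \<in> carrier A1R \<Longrightarrow> b \<in> carrier A1R \<Longrightarrow> tau \<cdot> a \<boxplus> rho \<cdot> b \<in> tau_rho_ideal"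
  by (auto simp: tau_rho_ideal_def)

lemma tau_rho_ideal_A1R: "x \<in> tau_rho_ideal \<Longrightarrow> x \<in> carrier A1R"
  by (auto simp: tau_rho_ideal_def)

lemma tau_rho_ideal_add:
  assumes "x \<in> tau_rho_ideal" "y \<in> tau_rho_ideal" shows "x \<boxplus> y \<in> tau_rho_ideal"
proof -
  obtain a b c d where x: "x = tau \<cdot> a \<boxplus> rho \<cdot> b" "y = tau \<cdot> c \<boxplus> rho \<cdot> d"
    "a \<in> carrier A1R" "b \<in> carrier A1R" "c \<in> carrier A1R" "d \<in> carrier A1R"
    using assms by (auto simp: tau_rho_ideal_def)
  then have "x \<boxplus> y = tau \<cdot> (a \<boxplus> c) \<boxplus> rho \<cdot> (b \<boxplus> d)"
    by (simp add: AR.r_distr AR.a_ac)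
  then show ?thesis using x by (simp add: tau_rho_idealI)
qed

lemma tau_rho_ideal_gens:
  assumes "x \<in> carrier A1R"
  shows "tau \<cdot> x \<in> tau_rho_ideal" "rho \<cdot> x \<in> tau_rho_ideal"
  using tau_rho_idealI[of x "\<zero>\<^bsub>AR\<^esub>"] tau_rho_idealI[of "\<zero>\<^bsub>AR\<^esub>" x] assms by simp_all

text \<open>Right multiples are immediate, as tau and rho stand on the left. For left multiples a
  generator is moved past them: \<open>sq1\<close> and \<open>sq2\<close> commute with tau up to a
  left multiple of rho.\<close>

lemma tau_rho_ideal_ideal: "ideal tau_rho_ideal A1R"
proof (rule idealI[OF A1R_ring])
  interpret A: ring A1R by (rule A1R_ring)
  show "subgroup tau_rho_ideal (add_monoid A1R)"
  proof (rule A.add.subgroupI)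
    show "tau_rho_ideal \<subseteq> carrier A1R" using tau_rho_ideal_A1R by blast
    show "tau_rho_ideal \<noteq> {}" using tau_rho_ideal_gens[of tau] by auto
    show "\<ominus>\<^bsub>A1R\<^esub> x \<in> tau_rho_ideal" if "x \<in> tau_rho_ideal" for x
      using that by (simp add: A1R_a_inv tau_rho_ideal_A1R)
    show "x \<oplus>\<^bsub>A1R\<^esub> y \<in> tau_rho_ideal" if "x \<in> tau_rho_ideal" "y \<in> tau_rho_ideal" for x y
      using tau_rho_ideal_add that by simp
  qed
  fix a x assume a: "a \<in> tau_rho_ideal" and x: "x \<in> carrier A1R"
  obtain b c where bc: "a = tau \<cdot> b \<boxplus> rho \<cdot> c" "b \<in> carrier A1R" "c \<in> carrier A1R"
    using a by (auto simp: tau_rho_ideal_def)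
  with x show "a \<otimes>\<^bsub>A1R\<^esub> x \<in> tau_rho_ideal"
    by (simp add: AR.l_distr AR.m_assoc tau_rho_idealI)
  have "x \<cdot> a \<in> tau_rho_ideal"
    using x unfolding A1R_carrier
  proof (rule generate_ring_stable[rotated 4])
    show "h \<cdot> y \<in> tau_rho_ideal" if h: "h \<in> {tau, rho, sq1, sq2}" and "y \<in> tau_rho_ideal" for h y
    proof -
      obtain b c where y: "y = tau \<cdot> b \<boxplus> rho \<cdot> c" "b \<in> carrier A1R" "c \<in> carrier A1R"
        using \<open>y \<in> tau_rho_ideal\<close> by (auto simp: tau_rho_ideal_def)
      note g = A1R_gens A1R_gens(3)[unfolded One_nat_def]
      show ?thesis
        using h y g
        by (auto simp: AR.r_distr sq_tau_rho_left sq_tau_rho_left(1,2)[unfolded One_nat_def]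
            intro!: tau_rho_ideal_add tau_rho_ideal_gens)
    qed
  qed (use a tau_rho_ideal_add tau_rho_ideal_A1R in auto)
  then show "x \<otimes>\<^bsub>A1R\<^esub> a \<in> tau_rho_ideal" by simp
qed

section \<open>Bases of left modules\<close>

lemma (in left_module) smult_zero_left: "x \<in> carrier M \<Longrightarrow> \<zero>\<^bsub>R\<^esub> \<odot>\<^bsub>M\<^esub> x = \<zero>\<^bsub>M\<^esub>"
proof -
  assume x: "x \<in> carrier M"
  have "\<zero>\<^bsub>R\<^esub> \<odot>\<^bsub>M\<^esub> x \<oplus>\<^bsub>M\<^esub> \<zero>\<^bsub>R\<^esub> \<odot>\<^bsub>M\<^esub> x = \<zero>\<^bsub>R\<^esub> \<odot>\<^bsub>M\<^esub> x"
    using smult_l_distr[of "\<zero>\<^bsub>R\<^esub>" "\<zero>\<^bsub>R\<^esub>" x] x by simp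
  then show ?thesis
    using smult_closed[of "\<zero>\<^bsub>R\<^esub>" x] x by simp
qed

lemma (in left_module) smult_zero_right: "a \<in> carrier R \<Longrightarrow> a \<odot>\<^bsub>M\<^esub> \<zero>\<^bsub>M\<^esub> = \<zero>\<^bsub>M\<^esub>"
proof -
  assume a: "a \<in> carrier R"
  have "a \<odot>\<^bsub>M\<^esub> \<zero>\<^bsub>M\<^esub> \<oplus>\<^bsub>M\<^esub> a \<odot>\<^bsub>M\<^esub> \<zero>\<^bsub>M\<^esub> = a \<odot>\<^bsub>M\<^esub> \<zero>\<^bsub>M\<^esub>"
    using smult_r_distr[of a "\<zero>\<^bsub>M\<^esub>" "\<zero>\<^bsub>M\<^esub>"] a by simp
  then show ?thesis
    using smult_closed[of a "\<zero>\<^bsub>M\<^esub>"] a by simp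
qed

lemma additive_finsum:
  assumes M: "abelian_monoid M" and N: "abelian_monoid N"
    and h: "\<And>x. x \<in> carrier M \<Longrightarrow> h x \<in> carrier N" and zero: "h \<zero>\<^bsub>M\<^esub> = \<zero>\<^bsub>N\<^esub>"
    and add: "\<And>x y. x \<in> carrier M \<Longrightarrow> y \<in> carrier M \<Longrightarrow> h (x \<oplus>\<^bsub>M\<^esub> y) = h x \<oplus>\<^bsub>N\<^esub> h y"
    and F: "finite F" "f \<in> F \<rightarrow> carrier M"
  shows "h (\<Oplus>\<^bsub>M\<^esub>i\<in>F. f i) = (\<Oplus>\<^bsub>N\<^esub>i\<in>F. h (f i))"
  using F
proof (induction F)
  case empty
  show ?case by (simp add: abelian_monoid.finsum_empty M N zero)
next
  case (insert i F)
  then have "f i \<in> carrier M" "f \<in> F \<rightarrow> carrier M" "(\<Oplus>\<^bsub>M\<^esub>i\<in>F. f i) \<in> carrier M"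
    by (auto intro!: abelian_monoid.finsum_closed[OF M])
  moreover have "(\<lambda>i. h (f i)) \<in> F \<rightarrow> carrier N" "h (f i) \<in> carrier N"
    using insert.prems h by auto
  ultimately show ?case
    using insert by (simp add: abelian_monoid.finsum_insert[OF M] abelian_monoid.finsum_insert[OF N] add)
qed

lemma (in abelian_monoid) finsum_stable:
  assumes "finite F" "\<zero> \<in> S" "\<And>x y. x \<in> S \<Longrightarrow> y \<in> S \<Longrightarrow> x \<oplus> y \<in> S" "S \<subseteq> carrier G" "\<And>i. i \<in> F \<Longrightarrow> f i \<in> S"
  shows "(\<Oplus>i\<in>F. f i) \<in> S"
  using assms(1,5)
proof (induction F)
  case (insert i F)
  then show ?case using assms(4) by (subst finsum_insert) (auto intro!: assms(3))
qed (use assms in simp)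

lemma (in left_module) finsum_smult:
  assumes "finite F" "a \<in> carrier R" "f \<in> F \<rightarrow> carrier M"
  shows "a \<odot>\<^bsub>M\<^esub> (\<Oplus>\<^bsub>M\<^esub>i\<in>F. f i) = (\<Oplus>\<^bsub>M\<^esub>i\<in>F. a \<odot>\<^bsub>M\<^esub> f i)"
  by (rule additive_finsum) (use assms in \<open>auto simp: smult_closed smult_r_distr smult_zero_right M.abelian_monoid_axioms\<close>)

text \<open>The dual-basis form of freeness. Each \<open>coord b\<close> is left linear, so applying
  it turns an equation in the module into an equation in the ring.\<close>

definition module_coords ::
  "('r, 's) ring_scheme \<Rightarrow> ('r, 'm, 't) module_scheme \<Rightarrow> 'm set \<Rightarrow> ('m \<Rightarrow> 'm \<Rightarrow> 'r) \<Rightarrow> bool" where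
  "module_coords R M B coord \<longleftrightarrow>
    (\<forall>b x. x \<in> carrier M \<longrightarrow> coord b x \<in> carrier R) \<and>
    (\<forall>b x y. x \<in> carrier M \<longrightarrow> y \<in> carrier M \<longrightarrow> coord b (x \<oplus>\<^bsub>M\<^esub> y) = coord b x \<oplus>\<^bsub>R\<^esub> coord b y) \<and>
    (\<forall>b a x. x \<in> carrier M \<longrightarrow> a \<in> carrier R \<longrightarrow> coord b (a \<odot>\<^bsub>M\<^esub> x) = a \<otimes>\<^bsub>R\<^esub> coord b x) \<and>
    (\<forall>b b'. b' \<in> B \<longrightarrow> coord b b' = (if b' = b then \<one>\<^bsub>R\<^esub> else \<zero>\<^bsub>R\<^esub>)) \<and>
    (\<forall>x. x \<in> carrier M \<longrightarrow> (\<forall>b\<in>B. coord b x = \<zero>\<^bsub>R\<^esub>) \<longrightarrow> x = \<zero>\<^bsub>M\<^esub>) \<and>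
    (\<forall>x. x \<in> carrier M \<longrightarrow> (\<exists>F. finite F \<and> F \<subseteq> B \<and> x = (\<Oplus>\<^bsub>M\<^esub>b\<in>F. coord b x \<odot>\<^bsub>M\<^esub> b)))"

lemma module_coordsD:
  assumes "module_coords R M B coord"
  shows "x \<in> carrier M \<Longrightarrow> coord b x \<in> carrier R"
    "x \<in> carrier M \<Longrightarrow> y \<in> carrier M \<Longrightarrow> coord b (x \<oplus>\<^bsub>M\<^esub> y) = coord b x \<oplus>\<^bsub>R\<^esub> coord b y"
    "x \<in> carrier M \<Longrightarrow> a \<in> carrier R \<Longrightarrow> coord b (a \<odot>\<^bsub>M\<^esub> x) = a \<otimes>\<^bsub>R\<^esub> coord b x"
    "b' \<in> B \<Longrightarrow> coord b b' = (if b' = b then \<one>\<^bsub>R\<^esub> else \<zero>\<^bsub>R\<^esub>)"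
    "x \<in> carrier M \<Longrightarrow> \<forall>b\<in>B. coord b x = \<zero>\<^bsub>R\<^esub> \<Longrightarrow> x = \<zero>\<^bsub>M\<^esub>"
    "x \<in> carrier M \<Longrightarrow> \<exists>F. finite F \<and> F \<subseteq> B \<and> x = (\<Oplus>\<^bsub>M\<^esub>b\<in>F. coord b x \<odot>\<^bsub>M\<^esub> b)"
  using assms unfolding module_coords_def by blast+

lemma (in left_module) module_coords_zero:
  assumes "module_coords R M B coord" shows "coord b \<zero>\<^bsub>M\<^esub> = \<zero>"
proof -
  have "coord b \<zero>\<^bsub>M\<^esub> = coord b (\<zero> \<odot>\<^bsub>M\<^esub> \<zero>\<^bsub>M\<^esub>)"
    by (simp add: smult_zero_right)
  also have "\<dots> = \<zero>"
    using module_coordsD(1)[OF assms, of "\<zero>\<^bsub>M\<^esub>" b] by (simp add: module_coordsD(3)[OF assms])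
  finally show ?thesis .
qed

definition lspan :: "('r, 's) ring_scheme \<Rightarrow> ('r, 'm, 't) module_scheme \<Rightarrow> 'm set \<Rightarrow> 'm set" where
  "lspan R M B = {x. \<exists>F c. finite F \<and> F \<subseteq> B \<and> c \<in> F \<rightarrow> carrier R \<and> x = (\<Oplus>\<^bsub>M\<^esub>b \<in> F. c b \<odot>\<^bsub>M\<^esub> b)}"

context left_module
begin

lemma finsum_extend:
  assumes "finite F'" "F \<subseteq> F'" "F' \<subseteq> carrier M" "c \<in> F \<rightarrow> carrier R"
  shows "(\<Oplus>\<^bsub>M\<^esub>b\<in>F. c b \<odot>\<^bsub>M\<^esub> b) = (\<Oplus>\<^bsub>M\<^esub>b\<in>F'. (if b \<in> F then c b else \<zero>) \<odot>\<^bsub>M\<^esub> b)"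
  by (rule M.add.finprod_mono_neutral_cong_left) (use assms in \<open>auto simp: smult_zero_left smult_closed subset_iff Pi_iff\<close>)

lemma finsum_comb_add:
  assumes "finite F" "F \<subseteq> carrier M" "c \<in> F \<rightarrow> carrier R" "d \<in> F \<rightarrow> carrier R"
  shows "(\<Oplus>\<^bsub>M\<^esub>b\<in>F. c b \<odot>\<^bsub>M\<^esub> b) \<oplus>\<^bsub>M\<^esub> (\<Oplus>\<^bsub>M\<^esub>b\<in>F. d b \<odot>\<^bsub>M\<^esub> b) = (\<Oplus>\<^bsub>M\<^esub>b\<in>F. (c b \<oplus> d b) \<odot>\<^bsub>M\<^esub> b)"
proof -
  have "(\<Oplus>\<^bsub>M\<^esub>b\<in>F. (c b \<oplus> d b) \<odot>\<^bsub>M\<^esub> b) = (\<Oplus>\<^bsub>M\<^esub>b\<in>F. c b \<odot>\<^bsub>M\<^esub> b \<oplus>\<^bsub>M\<^esub> d b \<odot>\<^bsub>M\<^esub> b)"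
    by (rule M.finsum_cong') (use assms in \<open>auto simp: smult_l_distr smult_closed subset_iff Pi_iff\<close>)
  also have "\<dots> = (\<Oplus>\<^bsub>M\<^esub>b\<in>F. c b \<odot>\<^bsub>M\<^esub> b) \<oplus>\<^bsub>M\<^esub> (\<Oplus>\<^bsub>M\<^esub>b\<in>F. d b \<odot>\<^bsub>M\<^esub> b)"
    by (rule M.finsum_addf) (use assms in \<open>auto simp: smult_closed subset_iff Pi_iff\<close>)
  finally show ?thesis by simp
qed

lemma finsum_comb_smult:
  assumes "finite F" "F \<subseteq> carrier M" "c \<in> F \<rightarrow> carrier R" "a \<in> carrier R"
  shows "a \<odot>\<^bsub>M\<^esub> (\<Oplus>\<^bsub>M\<^esub>b\<in>F. c b \<odot>\<^bsub>M\<^esub> b) = (\<Oplus>\<^bsub>M\<^esub>b\<in>F. (a \<otimes> c b) \<odot>\<^bsub>M\<^esub> b)"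
proof -
  have "a \<odot>\<^bsub>M\<^esub> (\<Oplus>\<^bsub>M\<^esub>b\<in>F. c b \<odot>\<^bsub>M\<^esub> b) = (\<Oplus>\<^bsub>M\<^esub>b\<in>F. a \<odot>\<^bsub>M\<^esub> (c b \<odot>\<^bsub>M\<^esub> b))"
    by (rule finsum_smult) (use assms in \<open>auto simp: smult_closed subset_iff Pi_iff\<close>)
  also have "\<dots> = (\<Oplus>\<^bsub>M\<^esub>b\<in>F. (a \<otimes> c b) \<odot>\<^bsub>M\<^esub> b)"
    by (rule M.finsum_cong') (use assms in \<open>auto simp: smult_closed smult_assoc subset_iff Pi_iff\<close>)
  finally show ?thesis .
qed

lemma lspan_add:
  assumes B: "B \<subseteq> carrier M" and x: "x \<in> lspan R M B" and y: "y \<in> lspan R M B"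
  shows "x \<oplus>\<^bsub>M\<^esub> y \<in> lspan R M B"
proof -
  obtain F c where F: "finite F" "F \<subseteq> B" "c \<in> F \<rightarrow> carrier R" "x = (\<Oplus>\<^bsub>M\<^esub>b\<in>F. c b \<odot>\<^bsub>M\<^esub> b)"
    using x unfolding lspan_def by blast
  obtain F' c' where F': "finite F'" "F' \<subseteq> B" "c' \<in> F' \<rightarrow> carrier R" "y = (\<Oplus>\<^bsub>M\<^esub>b\<in>F'. c' b \<odot>\<^bsub>M\<^esub> b)"
    using y unfolding lspan_def by blast
  let ?e = "\<lambda>F c b. if b \<in> F then c b else \<zero>"
  have "x \<oplus>\<^bsub>M\<^esub> y = (\<Oplus>\<^bsub>M\<^esub>b\<in>F \<union> F'. ?e F c b \<odot>\<^bsub>M\<^esub> b) \<oplus>\<^bsub>M\<^esub> (\<Oplus>\<^bsub>M\<^esub>b\<in>F \<union> F'. ?e F' c' b \<odot>\<^bsub>M\<^esub> b)"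
    unfolding F(4) F'(4) using F F' B
    by (subst finsum_extend[of "F \<union> F'" F c], simp, simp, blast, simp)
      (subst finsum_extend[of "F \<union> F'" F' c'], simp, simp, blast, simp, simp)
  also have "\<dots> = (\<Oplus>\<^bsub>M\<^esub>b\<in>F \<union> F'. (?e F c b \<oplus> ?e F' c' b) \<odot>\<^bsub>M\<^esub> b)"
    by (rule finsum_comb_add) (use F F' B in \<open>auto simp: Pi_iff\<close>)
  finally show ?thesis
    unfolding lspan_def using F F' by (intro CollectI exI[of _ "F \<union> F'"] exI[of _ "\<lambda>b. ?e F c b \<oplus> ?e F' c' b"]) (auto simp: Pi_iff)
qed

lemma lspan_smult_basis:
  assumes "b \<in> B" "b \<in> carrier M" "a \<in> carrier R" shows "a \<odot>\<^bsub>M\<^esub> b \<in> lspan R M B"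
proof -
  have "(\<Oplus>\<^bsub>M\<^esub>b\<in>{b}. a \<odot>\<^bsub>M\<^esub> b) = a \<odot>\<^bsub>M\<^esub> b"
    using assms by (subst M.finsum_insert) (auto simp: smult_closed)
  then show ?thesis
    unfolding lspan_def using assms by (intro CollectI exI[of _ "{b}"] exI[of _ "\<lambda>_. a"]) auto
qed

lemma lspan_zero: "\<zero>\<^bsub>M\<^esub> \<in> lspan R M B"
  unfolding lspan_def by (intro CollectI exI[of _ "{}"]) auto

lemma lspan_smult:
  assumes B: "B \<subseteq> carrier M" and x: "x \<in> lspan R M B" and a: "a \<in> carrier R"
  shows "a \<odot>\<^bsub>M\<^esub> x \<in> lspan R M B"
proof -
  obtain F c where F: "finite F" "F \<subseteq> B" "c \<in> F \<rightarrow> carrier R" "x = (\<Oplus>\<^bsub>M\<^esub>b\<in>F. c b \<odot>\<^bsub>M\<^esub> b)"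
    using x unfolding lspan_def by blast
  then have "a \<odot>\<^bsub>M\<^esub> x = (\<Oplus>\<^bsub>M\<^esub>b\<in>F. (a \<otimes> c b) \<odot>\<^bsub>M\<^esub> b)"
    using B a by (simp add: finsum_comb_smult)
  then show ?thesis
    unfolding lspan_def using F a by (intro CollectI exI[of _ F] exI[of _ "\<lambda>b. a \<otimes> c b"]) auto
qed

lemma lspan_carrier: "B \<subseteq> carrier M \<Longrightarrow> lspan R M B \<subseteq> carrier M"
  unfolding lspan_def by (auto intro!: M.finsum_closed smult_closed simp: Pi_iff subset_iff)

lemma basis_unique:
  assumes B: "module_basis R M B" and F: "finite F" "F \<subseteq> B" "c \<in> F \<rightarrow> carrier R"
    and F': "finite F'" "F' \<subseteq> B" "c' \<in> F' \<rightarrow> carrier R"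
    and eq: "(\<Oplus>\<^bsub>M\<^esub>b\<in>F. c b \<odot>\<^bsub>M\<^esub> b) = (\<Oplus>\<^bsub>M\<^esub>b\<in>F'. c' b \<odot>\<^bsub>M\<^esub> b)"
  shows "(if b \<in> F then c b else \<zero>) = (if b \<in> F' then c' b else \<zero>)"
proof -
  let ?H = "F \<union> F'"
  define u v where "u b = (if b \<in> F then c b else \<zero>)" and "v b = (if b \<in> F' then c' b else \<zero>)" for b
  have H: "finite ?H" "?H \<subseteq> B" "?H \<subseteq> carrier M"
    using F F' B by (auto simp: module_basis_def)
  have uv: "u b \<in> carrier R" "v b \<in> carrier R" for b
    using F F' by (auto simp: u_def v_def)
  let ?S = "\<lambda>c. \<Oplus>\<^bsub>M\<^esub>b\<in>?H. c b \<odot>\<^bsub>M\<^esub> b"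
  have "?S u = ?S v"
    using eq finsum_extend[of ?H F c] finsum_extend[of ?H F' c'] H F F' by (simp add: u_def v_def)
  then have "?S u \<oplus>\<^bsub>M\<^esub> ?S (\<lambda>b. \<ominus> v b) = ?S v \<oplus>\<^bsub>M\<^esub> ?S (\<lambda>b. \<ominus> v b)" by simp
  then have "?S (\<lambda>b. u b \<oplus> (\<ominus> v b)) = ?S (\<lambda>b. v b \<oplus> (\<ominus> v b))"
  proof -
    have "?S w \<oplus>\<^bsub>M\<^esub> ?S (\<lambda>b. \<ominus> v b) = ?S (\<lambda>b. w b \<oplus> (\<ominus> v b))" if "\<And>b. w b \<in> carrier R" for w
      by (rule finsum_comb_add) (use H uv that in auto)
    from this[of u] this[of v] uv show ?thesis
      using \<open>?S u \<oplus>\<^bsub>M\<^esub> ?S (\<lambda>b. \<ominus> v b) = ?S v \<oplus>\<^bsub>M\<^esub> ?S (\<lambda>b. \<ominus> v b)\<close> by metis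
  qed
  also have "\<dots> = \<zero>\<^bsub>M\<^esub>"
    using H uv by (intro M.add.finprod_one_eqI) (auto simp: R.r_neg smult_zero_left)
  finally have "\<forall>b\<in>?H. u b \<oplus> (\<ominus> v b) = \<zero>"
  proof -
    assume z: "?S (\<lambda>b. u b \<oplus> (\<ominus> v b)) = \<zero>\<^bsub>M\<^esub>"
    have "\<forall>F c. finite F \<and> F \<subseteq> B \<and> c \<in> F \<rightarrow> carrier R \<and> (\<Oplus>\<^bsub>M\<^esub>b \<in> F. c b \<odot>\<^bsub>M\<^esub> b) = \<zero>\<^bsub>M\<^esub> \<longrightarrow> (\<forall>b \<in> F. c b = \<zero>)"
      using B unfolding module_basis_def by blast
    from this[rule_format, of ?H "\<lambda>b. u b \<oplus> (\<ominus> v b)"] z H uv show ?thesis by auto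
  qed
  then have "u b = v b" if "b \<in> ?H" for b
  proof -
    have "u b \<oplus> (\<ominus> v b) = \<zero>" using \<open>\<forall>b\<in>?H. u b \<oplus> (\<ominus> v b) = \<zero>\<close> that by blast
    then have "u b \<ominus> v b = \<zero>" by (simp only: a_minus_def)
    then show ?thesis using R.r_right_minus_eq[of "u b" "v b"] uv by blast
  qed
  moreover have "u b = v b" if "b \<notin> ?H" for b
    using that by (simp add: u_def v_def)
  ultimately show ?thesis unfolding u_def v_def by blast
qed

lemma basis_coords:
  assumes B: "module_basis R M B"
  obtains coord where "module_coords R M B coord"
proof -
  define good where "good x F c \<longleftrightarrow> finite F \<and> F \<subseteq> B \<and> c \<in> F \<rightarrow> carrier R \<and> x = (\<Oplus>\<^bsub>M\<^esub>b\<in>F. c b \<odot>\<^bsub>M\<^esub> b)" for x F c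
  define rep where "rep x = (SOME p. good x (fst p) (snd p))" for x
  define coord where "coord b x = (if b \<in> fst (rep x) then snd (rep x) b else \<zero>)" for b x
  have BM: "B \<subseteq> carrier M" using B by (simp add: module_basis_def)
  have rep: "good x (fst (rep x)) (snd (rep x))" if x: "x \<in> carrier M" for x
  proof -
    have "\<exists>p. good x (fst p) (snd p)"
      using B x unfolding module_basis_def good_def by simp
    then show ?thesis unfolding rep_def by (rule someI_ex)
  qed
  have coord: "coord b x = (if b \<in> F then c b else \<zero>)" if x: "x \<in> carrier M" and g: "good x F c" for b x F c
    unfolding coord_def by (rule basis_unique[OF B]) (use rep[OF x] g in \<open>auto simp: good_def\<close>)
  have ext: "\<exists>F. finite F \<and> F \<subseteq> B \<and> (\<forall>b. coord b x \<in> carrier R) \<and> (\<forall>b. b \<notin> F \<longrightarrow> coord b x = \<zero>) \<and> x = (\<Oplus>\<^bsub>M\<^esub>b\<in>F. coord b x \<odot>\<^bsub>M\<^esub> b)"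
    if x: "x \<in> carrier M" for x
  proof (intro exI conjI allI impI)
    note g = rep[OF x, unfolded good_def]
    show "finite (fst (rep x))" "fst (rep x) \<subseteq> B" using g by auto
    show "coord b x \<in> carrier R" for b using g by (auto simp: coord_def)
    show "b \<notin> fst (rep x) \<Longrightarrow> coord b x = \<zero>" for b by (simp add: coord_def)
    have "(\<Oplus>\<^bsub>M\<^esub>b\<in>fst (rep x). coord b x \<odot>\<^bsub>M\<^esub> b) = (\<Oplus>\<^bsub>M\<^esub>b\<in>fst (rep x). snd (rep x) b \<odot>\<^bsub>M\<^esub> b)"
      by (rule M.finsum_cong') (use g BM in \<open>auto simp: coord_def smult_closed subset_iff Pi_iff\<close>)
    then show "x = (\<Oplus>\<^bsub>M\<^esub>b\<in>fst (rep x). coord b x \<odot>\<^bsub>M\<^esub> b)" using g by simp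
  qed
  show thesis
  proof (rule that[of coord], unfold module_coords_def, intro conjI allI impI)
    show c: "coord b x \<in> carrier R" if "x \<in> carrier M" for b x
      using ext[OF that] by blast
    show "\<exists>F. finite F \<and> F \<subseteq> B \<and> x = (\<Oplus>\<^bsub>M\<^esub>b\<in>F. coord b x \<odot>\<^bsub>M\<^esub> b)" if "x \<in> carrier M" for x
      using ext[OF that] by blast
    show "x = \<zero>\<^bsub>M\<^esub>" if x: "x \<in> carrier M" and x0: "\<forall>b\<in>B. coord b x = \<zero>" for x
    proof -
      obtain F where F: "finite F" "F \<subseteq> B" "x = (\<Oplus>\<^bsub>M\<^esub>b\<in>F. coord b x \<odot>\<^bsub>M\<^esub> b)"
        using ext[OF x] by blast
      have "(\<Oplus>\<^bsub>M\<^esub>b\<in>F. coord b x \<odot>\<^bsub>M\<^esub> b) = \<zero>\<^bsub>M\<^esub>"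
        using F BM x0 by (intro M.add.finprod_one_eqI) (auto simp: smult_zero_left subset_iff)
      then show ?thesis using F(3) by simp
    qed
    show "coord b (x \<oplus>\<^bsub>M\<^esub> y) = coord b x \<oplus> coord b y" if xy: "x \<in> carrier M" "y \<in> carrier M" for b x y
    proof -
      obtain F where F: "finite F" "F \<subseteq> B" "\<forall>b. b \<notin> F \<longrightarrow> coord b x = \<zero>" "x = (\<Oplus>\<^bsub>M\<^esub>b\<in>F. coord b x \<odot>\<^bsub>M\<^esub> b)"
        using ext[OF xy(1)] by blast
      obtain F' where F': "finite F'" "F' \<subseteq> B" "\<forall>b. b \<notin> F' \<longrightarrow> coord b y = \<zero>" "y = (\<Oplus>\<^bsub>M\<^esub>b\<in>F'. coord b y \<odot>\<^bsub>M\<^esub> b)"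
        using ext[OF xy(2)] by blast
      let ?H = "F \<union> F'"
      have H: "finite ?H" "?H \<subseteq> carrier M" "?H \<subseteq> B" using F F' BM by auto
      have e: "(if b \<in> F then coord b x else \<zero>) = coord b x" "(if b \<in> F' then coord b y else \<zero>) = coord b y" for b
        using F F' by auto
      have "x = (\<Oplus>\<^bsub>M\<^esub>b\<in>?H. coord b x \<odot>\<^bsub>M\<^esub> b)"
        using finsum_extend[of ?H F "\<lambda>b. coord b x"] F(4) H c[OF xy(1)] unfolding e by simp
      moreover have "y = (\<Oplus>\<^bsub>M\<^esub>b\<in>?H. coord b y \<odot>\<^bsub>M\<^esub> b)"
        using finsum_extend[of ?H F' "\<lambda>b. coord b y"] F'(4) H c[OF xy(2)] unfolding e by simp
      ultimately have "x \<oplus>\<^bsub>M\<^esub> y = (\<Oplus>\<^bsub>M\<^esub>b\<in>?H. (coord b x \<oplus> coord b y) \<odot>\<^bsub>M\<^esub> b)"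
        using finsum_comb_add[of ?H "\<lambda>b. coord b x" "\<lambda>b. coord b y"] H c xy by simp
      then have "good (x \<oplus>\<^bsub>M\<^esub> y) ?H (\<lambda>b. coord b x \<oplus> coord b y)"
        using H c xy by (simp add: good_def)
      from coord[OF _ this] show ?thesis using xy F(3) F'(3) by simp
    qed
    show "coord b (a \<odot>\<^bsub>M\<^esub> x) = a \<otimes> coord b x" if xy: "x \<in> carrier M" "a \<in> carrier R" for b a x
    proof -
      obtain F where F: "finite F" "F \<subseteq> B" "\<forall>b. b \<notin> F \<longrightarrow> coord b x = \<zero>" "x = (\<Oplus>\<^bsub>M\<^esub>b\<in>F. coord b x \<odot>\<^bsub>M\<^esub> b)"
        using ext[OF xy(1)] by blast
      have "a \<odot>\<^bsub>M\<^esub> x = (\<Oplus>\<^bsub>M\<^esub>b\<in>F. (a \<otimes> coord b x) \<odot>\<^bsub>M\<^esub> b)"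
        using finsum_comb_smult[of F "\<lambda>b. coord b x" a] F BM c xy by auto
      then have "good (a \<odot>\<^bsub>M\<^esub> x) F (\<lambda>b. a \<otimes> coord b x)"
        using F c xy by (simp add: good_def)
      from coord[OF _ this] show ?thesis using xy F(3) by (simp add: smult_closed)
    qed
    show "coord b b' = (if b' = b then \<one> else \<zero>)" if "b' \<in> B" for b b'
    proof -
      have b': "b' \<in> carrier M" using that BM by auto
      then have "good b' {b'} (\<lambda>_. \<one>)"
        using that by (auto simp: good_def smult_one M.finsum_insert)
      from coord[OF b' this] show ?thesis by simp
    qed
  qed
qed

end

section \<open>The reduction of a module\<close>

locale A1R_module = left_module A1R M for M :: "(steenrod, 'm, 't) module_scheme"
begin

abbreviation smult_M (infixl \<open>\<bullet>\<close> 70) where "a \<bullet> x \<equiv> a \<odot>\<^bsub>M\<^esub> x"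
abbreviation "N \<equiv> tau_rho_submodule M"
abbreviation red where "red x \<equiv> N +>\<^bsub>M\<^esub> x"

lemma smult_closed' [simp]: "a \<in> carrier A1R \<Longrightarrow> x \<in> carrier M \<Longrightarrow> a \<bullet> x \<in> carrier M"
  by (rule smult_closed)

lemma smult_add: "a \<in> carrier A1R \<Longrightarrow> b \<in> carrier A1R \<Longrightarrow> x \<in> carrier M \<Longrightarrow>
    (a \<boxplus> b) \<bullet> x = a \<bullet> x \<oplus>\<^bsub>M\<^esub> b \<bullet> x"
  "a \<in> carrier A1R \<Longrightarrow> b \<in> carrier A1R \<Longrightarrow> x \<in> carrier M \<Longrightarrow>
    (a \<cdot> b) \<bullet> x = a \<bullet> (b \<bullet> x)"
  "x \<in> carrier M \<Longrightarrow> \<one>\<^bsub>AR\<^esub> \<bullet> x = x" "x \<in> carrier M \<Longrightarrow> \<zero>\<^bsub>AR\<^esub> \<bullet> x = \<zero>\<^bsub>M\<^esub>"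
  using smult_l_distr[of a b x] smult_assoc[of a b x] smult_one[of x] smult_zero_left[of x] by simp_all

lemma char_two: "x \<in> carrier M \<Longrightarrow> x \<oplus>\<^bsub>M\<^esub> x = \<zero>\<^bsub>M\<^esub>"
  using smult_add(1)[of "\<one>\<^bsub>AR\<^esub>" "\<one>\<^bsub>AR\<^esub>" x] by (simp add: smult_add(3,4) A1R_char_two)

lemma a_inv: "x \<in> carrier M \<Longrightarrow> \<ominus>\<^bsub>M\<^esub> x = x"
  by (rule M.minus_equality) (simp_all add: char_two)

lemma tau_rho_swap: "x \<in> carrier M \<Longrightarrow> tau \<bullet> (rho \<bullet> x) = rho \<bullet> (tau \<bullet> x)"
  by (simp add: smult_add(2)[symmetric] rho_comm)

lemma sq_smult:
  assumes "x \<in> carrier M"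
  shows "sq1 \<bullet> (tau \<bullet> x) = tau \<bullet> (sq1 \<bullet> x) \<oplus>\<^bsub>M\<^esub> rho \<bullet> x"
    "sq2 \<bullet> (tau \<bullet> x) = tau \<bullet> (sq2 \<bullet> x) \<oplus>\<^bsub>M\<^esub> rho \<bullet> (tau \<bullet> (sq1 \<bullet> x))"
    "sq1 \<bullet> (rho \<bullet> x) = rho \<bullet> (sq1 \<bullet> x)"
    "sq2 \<bullet> (rho \<bullet> x) = rho \<bullet> (sq2 \<bullet> x)"
  supply One_nat_def [simp del]
  using assms by (simp_all add: smult_add(1,2)[symmetric] rho_comm sq_tau)

text \<open>The counterpart of \<open>generate_ring_stable\<close> for the action on a
  module.\<close>

lemma smult_stable:
  assumes S: "S \<subseteq> carrier M" and add: "\<And>x y. x \<in> S \<Longrightarrow> y \<in> S \<Longrightarrow> x \<oplus>\<^bsub>M\<^esub> y \<in> S"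
    and gen: "\<And>h x. h \<in> {tau, rho, sq1, sq2} \<Longrightarrow> x \<in> S \<Longrightarrow> h \<bullet> x \<in> S"
    and a: "a \<in> carrier A1R" and x: "x \<in> S"
  shows "a \<bullet> x \<in> S"
  using a x unfolding A1R_carrier
proof (induction arbitrary: x)
  case one
  then show ?case using S smult_add(3) by (metis subsetD)
next
  case (a_inv h)
  then have "h \<in> carrier A1R" unfolding A1R_carrier by blast
  then show ?case using a_inv by (simp add: AR_a_inv)
next
  case (eng_add h h')
  then have h: "h \<in> carrier A1R" "h' \<in> carrier A1R" "x \<in> carrier M" unfolding A1R_carrier using S by auto
  show ?case unfolding smult_add(1)[OF h] by (intro add eng_add)
next
  case (eng_mult h h')
  then have h: "h \<in> carrier A1R" "h' \<in> carrier A1R" "x \<in> carrier M" unfolding A1R_carrier using S by auto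
  show ?case unfolding smult_add(2)[OF h] by (intro eng_mult)
qed (rule gen)

lemma NI: "x \<in> carrier M \<Longrightarrow> y \<in> carrier M \<Longrightarrow> tau \<bullet> x \<oplus>\<^bsub>M\<^esub> rho \<bullet> y \<in> N"
  by (auto simp: tau_rho_submodule_def)

lemma NE:
  assumes "n \<in> N" obtains x y where "x \<in> carrier M" "y \<in> carrier M" "n = tau \<bullet> x \<oplus>\<^bsub>M\<^esub> rho \<bullet> y"
  using assms by (auto simp: tau_rho_submodule_def)

lemma N_carrier: "N \<subseteq> carrier M"
  by (auto simp: tau_rho_submodule_def)

lemma N_gens: "x \<in> carrier M \<Longrightarrow> tau \<bullet> x \<in> N" "x \<in> carrier M \<Longrightarrow> rho \<bullet> x \<in> N"
  using NI[of x "\<zero>\<^bsub>M\<^esub>"] NI[of "\<zero>\<^bsub>M\<^esub>" x] by (simp_all add: smult_zero_right)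

lemma N_add: "n \<in> N \<Longrightarrow> n' \<in> N \<Longrightarrow> n \<oplus>\<^bsub>M\<^esub> n' \<in> N"
proof (elim NE)
  fix x y x' y' assume c: "x \<in> carrier M" "y \<in> carrier M" "x' \<in> carrier M" "y' \<in> carrier M"
    and n: "n = tau \<bullet> x \<oplus>\<^bsub>M\<^esub> rho \<bullet> y" "n' = tau \<bullet> x' \<oplus>\<^bsub>M\<^esub> rho \<bullet> y'"
  have "n \<oplus>\<^bsub>M\<^esub> n' = tau \<bullet> (x \<oplus>\<^bsub>M\<^esub> x') \<oplus>\<^bsub>M\<^esub> rho \<bullet> (y \<oplus>\<^bsub>M\<^esub> y')"
    using c unfolding n by (simp add: smult_r_distr M.a_ac)
  then show "n \<oplus>\<^bsub>M\<^esub> n' \<in> N" using c by (simp add: NI)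
qed

lemma N_abelian: "abelian_subgroup N M"
proof (rule abelian_subgroupI3)
  show "additive_subgroup N M"
    unfolding additive_subgroup_def
  proof (rule M.add.subgroupI)
    show "N \<noteq> {}" using N_gens[of "\<zero>\<^bsub>M\<^esub>"] by auto
    show "\<ominus>\<^bsub>M\<^esub> x \<in> N" if "x \<in> N" for x using that N_carrier a_inv[of x] by auto
  qed (use N_carrier N_add in auto)
  show "abelian_group M" by (rule M.abelian_group_axioms)
qed

text \<open>As for the ideal, moving \<open>sq1\<close> or \<open>sq2\<close> past tau leaves an
  error that is a multiple of rho.\<close>

lemma N_smult:
  assumes "a \<in> carrier A1R" "n \<in> N" shows "a \<bullet> n \<in> N"
proof (rule smult_stable[OF N_carrier _ _ assms])
  fix h x assume h: "h \<in> {tau, rho, sq1, sq2}" and "x \<in> N"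
  obtain y z where x: "y \<in> carrier M" "z \<in> carrier M" "x = tau \<bullet> y \<oplus>\<^bsub>M\<^esub> rho \<bullet> z"
    using \<open>x \<in> N\<close> by (rule NE)
  note g = A1R_gens A1R_gens(3)[unfolded One_nat_def]
  show "h \<bullet> x \<in> N"
    using h x(1,2) g unfolding x(3)
    by (auto simp: smult_r_distr sq_smult sq_smult[unfolded One_nat_def] intro!: N_add N_gens)
qed (rule N_add)

lemma N_ideal:
  assumes "a \<in> tau_rho_ideal" "x \<in> carrier M" shows "a \<bullet> x \<in> N"
  using assms by (auto simp: tau_rho_ideal_def smult_add intro!: NI)

lemma red_add: "x \<in> carrier M \<Longrightarrow> y \<in> carrier M \<Longrightarrow> red x <+>\<^bsub>M\<^esub> red y = red (x \<oplus>\<^bsub>M\<^esub> y)"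
  using abelian_subgroup.a_rcos_sum[OF N_abelian] .

lemma red_eq_N: "x \<in> carrier M \<Longrightarrow> red x = N \<longleftrightarrow> x \<in> N"
  using abelian_subgroup.a_rcos_const[OF N_abelian] abelian_subgroup.a_rcos_self[OF N_abelian, of x] by metis

lemma red_absorb: "n \<in> N \<Longrightarrow> x \<in> carrier M \<Longrightarrow> red (n \<oplus>\<^bsub>M\<^esub> x) = red x"
  using N_carrier M.a_coset_add_assoc[of N n x] abelian_subgroup.a_rcos_const[OF N_abelian, of n] by auto

lemma red_elem: "y \<in> red x \<longleftrightarrow> (\<exists>n\<in>N. y = n \<oplus>\<^bsub>M\<^esub> x)"
  by (auto simp: a_r_coset_def')

lemma red_self: "x \<in> carrier M \<Longrightarrow> x \<in> red x"
  by (rule abelian_subgroup.a_rcos_self[OF N_abelian])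

abbreviation FM where "FM \<equiv> F2_tensor M"

lemma FM_simps: "\<zero>\<^bsub>FM\<^esub> = N" "x \<oplus>\<^bsub>FM\<^esub> y = x <+>\<^bsub>M\<^esub> y" "carrier FM = red ` carrier M"
  by (auto simp: F2_tensor_def A_RCOSETS_def')

abbreviation redA where "redA a \<equiv> tau_rho_ideal +>\<^bsub>A1R\<^esub> a"

lemma FA_carrier: "carrier F2A1R = redA ` carrier A1R"
  by (auto simp: F2A1R_def FactRing_def A_RCOSETS_def')

lemma FA_ring: "ring F2A1R"
  unfolding F2A1R_def by (rule ideal.quotient_is_ring[OF tau_rho_ideal_ideal])

lemma redA_hom:
  "a \<in> carrier A1R \<Longrightarrow> b \<in> carrier A1R \<Longrightarrow> redA a \<oplus>\<^bsub>F2A1R\<^esub> redA b = redA (a \<boxplus> b)"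
  "a \<in> carrier A1R \<Longrightarrow> b \<in> carrier A1R \<Longrightarrow> redA a \<otimes>\<^bsub>F2A1R\<^esub> redA b = redA (a \<cdot> b)"
  "redA \<one>\<^bsub>AR\<^esub> = \<one>\<^bsub>F2A1R\<^esub>"
  using ring_hom_add[OF ideal.rcos_ring_hom[OF tau_rho_ideal_ideal], of a b]
    ring_hom_mult[OF ideal.rcos_ring_hom[OF tau_rho_ideal_ideal], of a b]
    ring_hom_one[OF ideal.rcos_ring_hom[OF tau_rho_ideal_ideal]]
  by (simp_all add: F2A1R_def)

lemma I_abelian: "abelian_subgroup tau_rho_ideal A1R"
  by (rule abelian_subgroupI3[OF ideal.axioms(1)[OF tau_rho_ideal_ideal]]) (rule R.abelian_group_axioms)

lemma redA_zero: "a \<in> carrier A1R \<Longrightarrow> redA a = \<zero>\<^bsub>F2A1R\<^esub> \<longleftrightarrow> a \<in> tau_rho_ideal"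
  using abelian_subgroup.a_rcos_const[OF I_abelian, of a] abelian_subgroup.a_rcos_self[OF I_abelian, of a]
  by (auto simp: F2A1R_def FactRing_def)

text \<open>The union over representatives collapses to one coset: replacing a by i + a and x by x'
  = n + x, with i in the ideal and n in \<open>N\<close>, changes the product by
  \<open>i \<bullet> x'\<close> and \<open>a \<bullet> n\<close>, both of which lie in
  \<open>N\<close>.\<close>

lemma FM_smult:
  assumes a: "a \<in> carrier A1R" and x: "x \<in> carrier M"
  shows "redA a \<odot>\<^bsub>FM\<^esub> red x = red (a \<bullet> x)"
proof -
  have "red (a' \<bullet> x') = red (a \<bullet> x)" if a': "a' \<in> redA a" and x': "x' \<in> red x" for a' x'
  proof -
    obtain i where i: "i \<in> tau_rho_ideal" "a' = i \<boxplus> a"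
      using a' by (auto simp: a_r_coset_def')
    obtain n where n: "n \<in> N" "x' = n \<oplus>\<^bsub>M\<^esub> x"
      using x' by (auto simp: red_elem)
    have c: "i \<in> carrier A1R" "n \<in> carrier M" "x' \<in> carrier M"
      using i n x N_carrier tau_rho_ideal_A1R by auto
    have "a' \<bullet> x' = (i \<bullet> x' \<oplus>\<^bsub>M\<^esub> a \<bullet> n) \<oplus>\<^bsub>M\<^esub> a \<bullet> x"
      using a x c unfolding i by (simp add: smult_add) (simp add: n smult_r_distr M.a_assoc)
    moreover have "i \<bullet> x' \<oplus>\<^bsub>M\<^esub> a \<bullet> n \<in> N"
      using N_ideal[OF i(1) c(3)] N_smult[OF a n(1)] by (rule N_add)
    ultimately show ?thesis using a x by (simp add: red_absorb)
  qed
  moreover have "a \<in> redA a" "x \<in> red x"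
    using abelian_subgroup.a_rcos_self[OF I_abelian a] red_self[OF x] .
  ultimately have "(\<Union>a'\<in>redA a. \<Union>x'\<in>red x. red (a' \<bullet> x')) = red (a \<bullet> x)"
    by blast
  then show ?thesis by (simp add: F2_tensor_def)
qed

lemma red_zero: "red \<zero>\<^bsub>M\<^esub> = N"
  using red_eq_N[of "\<zero>\<^bsub>M\<^esub>"] N_gens(1)[of "\<zero>\<^bsub>M\<^esub>"] by (simp add: smult_zero_right)

lemma FM_abelian: "abelian_group FM"
proof -
  have E: "\<exists>x\<in>carrier M. u = red x" if "u \<in> carrier FM" for u
    using that by (auto simp: FM_simps)
  have zero: "\<zero>\<^bsub>FM\<^esub> \<in> carrier FM"
    unfolding FM_simps using red_zero M.zero_closed by (metis imageI)
  have l0: "N <+>\<^bsub>M\<^esub> red x = red x" "red x <+>\<^bsub>M\<^esub> red x = N" if "x \<in> carrier M" for x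
    using red_add[of "\<zero>\<^bsub>M\<^esub>" x] red_add[of x x] that by (simp_all add: red_zero char_two)
  have l_zero: "\<zero>\<^bsub>FM\<^esub> \<oplus>\<^bsub>FM\<^esub> u = u" and inv: "u \<oplus>\<^bsub>FM\<^esub> u = \<zero>\<^bsub>FM\<^esub>" if "u \<in> carrier FM" for u
    using E[OF that] unfolding FM_simps by (auto simp: l0)
  have closed: "u \<oplus>\<^bsub>FM\<^esub> v \<in> carrier FM" and comm: "u \<oplus>\<^bsub>FM\<^esub> v = v \<oplus>\<^bsub>FM\<^esub> u"
    if "u \<in> carrier FM" "v \<in> carrier FM" for u v
    using E[OF that(1)] E[OF that(2)] unfolding FM_simps by (auto simp: red_add M.a_comm)
  have assoc: "u \<oplus>\<^bsub>FM\<^esub> v \<oplus>\<^bsub>FM\<^esub> w = u \<oplus>\<^bsub>FM\<^esub> (v \<oplus>\<^bsub>FM\<^esub> w)"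
    if "u \<in> carrier FM" "v \<in> carrier FM" "w \<in> carrier FM" for u v w
    using E[OF that(1)] E[OF that(2)] E[OF that(3)] unfolding FM_simps by (auto simp: red_add M.a_assoc)
  show ?thesis
  proof (rule abelian_groupI)
    show "\<exists>v\<in>carrier FM. v \<oplus>\<^bsub>FM\<^esub> u = \<zero>\<^bsub>FM\<^esub>" if "u \<in> carrier FM" for u
      using inv that by blast
  qed (fact closed zero l_zero comm assoc)+
qed

lemma FM_left_module: "left_module F2A1R FM"
proof (intro left_module.intro left_module_axioms.intro)
  show "ring F2A1R" by (rule FA_ring)
  show "abelian_group FM" by (rule FM_abelian)
  have E: "\<exists>x\<in>carrier M. u = red x" if "u \<in> carrier FM" for u
    using that by (auto simp: FM_simps)
  have EA: "\<exists>a\<in>carrier A1R. u = redA a" if "u \<in> carrier F2A1R" for u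
    using that by (auto simp: FA_carrier)
  fix u assume u: "u \<in> carrier FM"
  obtain x where x: "x \<in> carrier M" "u = red x" using E[OF u] by blast
  show "\<one>\<^bsub>F2A1R\<^esub> \<odot>\<^bsub>FM\<^esub> u = u"
    unfolding redA_hom(3)[symmetric] x(2) using x(1) by (simp add: FM_smult smult_add)
  fix r assume r: "r \<in> carrier F2A1R"
  obtain a where a: "a \<in> carrier A1R" "r = redA a" using EA[OF r] by blast
  show "r \<odot>\<^bsub>FM\<^esub> u \<in> carrier FM"
    unfolding a(2) x(2) FM_smult[OF a(1) x(1)] FM_simps using a(1) x(1) by simp
  have ax: "a \<bullet> x \<in> carrier M" using a x by simp
  {
    fix v assume "v \<in> carrier FM"
    then obtain y where y: "y \<in> carrier M" "v = red y" using E by blast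
    show "r \<odot>\<^bsub>FM\<^esub> (u \<oplus>\<^bsub>FM\<^esub> v) = r \<odot>\<^bsub>FM\<^esub> u \<oplus>\<^bsub>FM\<^esub> r \<odot>\<^bsub>FM\<^esub> v"
      unfolding a(2) x(2) y(2) FM_simps using a(1) x(1) y(1)
      by (simp add: red_add FM_smult smult_r_distr)
  next
    fix s assume "s \<in> carrier F2A1R"
    then obtain b where b: "b \<in> carrier A1R" "s = redA b" using EA by blast
    show "(r \<oplus>\<^bsub>F2A1R\<^esub> s) \<odot>\<^bsub>FM\<^esub> u = r \<odot>\<^bsub>FM\<^esub> u \<oplus>\<^bsub>FM\<^esub> s \<odot>\<^bsub>FM\<^esub> u"
      unfolding a(2) x(2) b(2) FM_simps using a(1) x(1) b(1)
      by (simp add: red_add FM_smult redA_hom smult_add)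
    show "(r \<otimes>\<^bsub>F2A1R\<^esub> s) \<odot>\<^bsub>FM\<^esub> u = r \<odot>\<^bsub>FM\<^esub> (s \<odot>\<^bsub>FM\<^esub> u)"
      unfolding a(2) x(2) b(2) using a(1) x(1) b(1)
      by (simp add: FM_smult redA_hom smult_add)
  }
qed

lemma red_finsum:
  assumes "finite F" "f \<in> F \<rightarrow> carrier M"
  shows "red (\<Oplus>\<^bsub>M\<^esub>i\<in>F. f i) = (\<Oplus>\<^bsub>FM\<^esub>i\<in>F. red (f i))"
proof (rule additive_finsum[OF _ _ _ _ _ assms])
  show "abelian_monoid FM" using FM_abelian by (rule abelian_group.axioms(1))
  show "red \<zero>\<^bsub>M\<^esub> = \<zero>\<^bsub>FM\<^esub>"
    by (simp add: FM_simps red_zero)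
qed (auto simp: FM_simps red_add M.abelian_monoid_axioms)

end

text \<open>Bidegrees are pairs, and quantifiers over a bidegree d are to remain quantifiers over a
  single variable.\<close>

declare split_paired_All [simp del]

section \<open>Bigraded modules and Nakayama's lemma\<close>

locale A1R_bigraded = bigraded_left_module A1R M A1R_grading G
  for M :: "(steenrod, 'm, 't) module_scheme" and G :: "int \<times> int \<Rightarrow> 'm set"

sublocale A1R_bigraded \<subseteq> A1R_module M
  by unfold_locales

context A1R_bigraded
begin

lemma G_carrier: "G d \<subseteq> carrier M"
  using additive_subgroup.a_subset[OF graded_subgroup] .

lemma G_zero: "\<zero>\<^bsub>M\<^esub> \<in> G d"
  using additive_subgroup.zero_closed[OF graded_subgroup] .

lemma G_add: "x \<in> G d \<Longrightarrow> y \<in> G d \<Longrightarrow> x \<oplus>\<^bsub>M\<^esub> y \<in> G d"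
  using additive_subgroup.a_closed[OF graded_subgroup] .

definition decomp :: "'m \<Rightarrow> (int \<times> int \<Rightarrow> 'm) \<Rightarrow> bool" where
  "decomp x f \<longleftrightarrow> (\<forall>d. f d \<in> G d) \<and> finite {d. f d \<noteq> \<zero>\<^bsub>M\<^esub>} \<and> x = (\<Oplus>\<^bsub>M\<^esub>d \<in> {d. f d \<noteq> \<zero>\<^bsub>M\<^esub>}. f d)"

definition comp :: "'m \<Rightarrow> int \<times> int \<Rightarrow> 'm" where
  "comp x = (THE f. decomp x f)"

lemma decomp_ex1: "x \<in> carrier M \<Longrightarrow> \<exists>!f. decomp x f"
  unfolding decomp_def by (rule graded_decomposition)

lemma decomp_comp: "x \<in> carrier M \<Longrightarrow> decomp x (comp x)"
  unfolding comp_def by (rule theI'[OF decomp_ex1])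

lemma comp_eq: "x \<in> carrier M \<Longrightarrow> decomp x f \<Longrightarrow> comp x = f"
  unfolding comp_def by (rule the1_equality[OF decomp_ex1])

lemma decomp_superset:
  assumes "\<forall>d. f d \<in> G d" "finite D" "{d. f d \<noteq> \<zero>\<^bsub>M\<^esub>} \<subseteq> D"
  shows "decomp x f \<longleftrightarrow> x = (\<Oplus>\<^bsub>M\<^esub>d \<in> D. f d)"
proof -
  have "f d \<in> carrier M" for d using assms(1) G_carrier by blast
  then have "(\<Oplus>\<^bsub>M\<^esub>d \<in> {d. f d \<noteq> \<zero>\<^bsub>M\<^esub>}. f d) = (\<Oplus>\<^bsub>M\<^esub>d \<in> D. f d)"
    by (intro M.add.finprod_mono_neutral_cong_left) (use assms in auto)
  moreover have "finite {d. f d \<noteq> \<zero>\<^bsub>M\<^esub>}" using assms(2,3) finite_subset by blast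
  ultimately show ?thesis unfolding decomp_def using assms(1) by simp
qed

lemma comp_in_G: "x \<in> carrier M \<Longrightarrow> comp x d \<in> G d"
  using decomp_comp[of x] unfolding decomp_def by blast

lemma comp_closed [simp]: "x \<in> carrier M \<Longrightarrow> comp x d \<in> carrier M"
  using comp_in_G G_carrier by blast

lemma comp_finite: "x \<in> carrier M \<Longrightarrow> finite {d. comp x d \<noteq> \<zero>\<^bsub>M\<^esub>}"
  using decomp_comp by (simp add: decomp_def)

lemma comp_sum: "x \<in> carrier M \<Longrightarrow> x = (\<Oplus>\<^bsub>M\<^esub>d \<in> {d. comp x d \<noteq> \<zero>\<^bsub>M\<^esub>}. comp x d)"
  using decomp_comp[of x] unfolding decomp_def by blast

lemma comp_homogeneous:
  assumes "x \<in> G e" shows "comp x d = (if d = e then x else \<zero>\<^bsub>M\<^esub>)"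
proof -
  have x: "x \<in> carrier M" using assms G_carrier[of e] by blast
  have "(\<Oplus>\<^bsub>M\<^esub>d \<in> {e}. if d = e then x else \<zero>\<^bsub>M\<^esub>) = x"
    using x by (simp add: M.finsum_insert)
  then have "decomp x (\<lambda>d. if d = e then x else \<zero>\<^bsub>M\<^esub>)"
    using assms G_zero by (subst decomp_superset[of _ "{e}"]) auto
  from comp_eq[OF x this] show ?thesis by simp
qed

lemma comp_add:
  assumes "x \<in> carrier M" "y \<in> carrier M"
  shows "comp (x \<oplus>\<^bsub>M\<^esub> y) d = comp x d \<oplus>\<^bsub>M\<^esub> comp y d"
proof -
  let ?D = "{d. comp x d \<noteq> \<zero>\<^bsub>M\<^esub>} \<union> {d. comp y d \<noteq> \<zero>\<^bsub>M\<^esub>}"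
  have D: "finite ?D" using comp_finite assms by simp
  have ex: "(\<Oplus>\<^bsub>M\<^esub>d \<in> ?D. comp x d) = x"
    by (rule decomp_superset[OF _ D, THEN iffD1, symmetric]) (use assms comp_in_G decomp_comp in blast)+
  have ey: "(\<Oplus>\<^bsub>M\<^esub>d \<in> ?D. comp y d) = y"
    by (rule decomp_superset[OF _ D, THEN iffD1, symmetric]) (use assms comp_in_G decomp_comp in blast)+
  have "(\<Oplus>\<^bsub>M\<^esub>d \<in> ?D. comp x d \<oplus>\<^bsub>M\<^esub> comp y d) = (\<Oplus>\<^bsub>M\<^esub>d \<in> ?D. comp x d) \<oplus>\<^bsub>M\<^esub> (\<Oplus>\<^bsub>M\<^esub>d \<in> ?D. comp y d)"
    by (rule M.finsum_addf) (use assms in auto)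
  then have s: "x \<oplus>\<^bsub>M\<^esub> y = (\<Oplus>\<^bsub>M\<^esub>d \<in> ?D. comp x d \<oplus>\<^bsub>M\<^esub> comp y d)"
    unfolding ex ey by (rule sym)
  have hG: "\<forall>d. comp x d \<oplus>\<^bsub>M\<^esub> comp y d \<in> G d"
    using assms by (intro allI G_add comp_in_G)
  have hD: "{d. comp x d \<oplus>\<^bsub>M\<^esub> comp y d \<noteq> \<zero>\<^bsub>M\<^esub>} \<subseteq> ?D"
    using assms by auto
  have "decomp (x \<oplus>\<^bsub>M\<^esub> y) (\<lambda>d. comp x d \<oplus>\<^bsub>M\<^esub> comp y d)"
    by (rule decomp_superset[OF hG D hD, THEN iffD2, OF s])
  from comp_eq[OF _ this] assms show ?thesis by simp
qed

lemma graded_induct [consumes 1, case_names homogeneous add]: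
  assumes x: "x \<in> carrier M" and hom: "\<And>d x. x \<in> G d \<Longrightarrow> C x"
    and add: "\<And>x y. x \<in> carrier M \<Longrightarrow> y \<in> carrier M \<Longrightarrow> C x \<Longrightarrow> C y \<Longrightarrow> C (x \<oplus>\<^bsub>M\<^esub> y)"
  shows "C x"
proof -
  have "(\<Oplus>\<^bsub>M\<^esub>d \<in> {d. comp x d \<noteq> \<zero>\<^bsub>M\<^esub>}. comp x d) \<in> {x \<in> carrier M. C x}"
    by (rule M.finsum_stable) (use x add hom[OF G_zero] hom[OF comp_in_G[OF x]] comp_finite in auto)
  then show ?thesis unfolding comp_sum[OF x, symmetric] by simp
qed

lemma comp_smult:
  assumes h: "h \<in> A1R_grading e" and x: "x \<in> carrier M"
  shows "comp (h \<bullet> x) d = h \<bullet> comp x (d - e)"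
proof -
  have hA: "h \<in> carrier A1R" using h by (simp add: A1R_grading_def)
  show ?thesis using x
  proof (induction x rule: graded_induct)
    case (homogeneous d' x)
    have "(d = e + d') = (d - e = d')" by (auto simp: algebra_simps)
    then show ?case
      using comp_homogeneous[OF smult_graded[OF h homogeneous]] comp_homogeneous[OF homogeneous] hA
      by (simp add: smult_zero_right)
  next
    case (add x y)
    then show ?case using hA by (simp add: smult_r_distr comp_add)
  qed
qed

lemma gen_homogeneous:
  assumes "h \<in> {tau, rho, sq1, sq2}"
  obtains e where "h \<in> A1R_grading e" "0 \<le> snd e"
  using assms gen_graded by auto

lemma gen_A1R: "h \<in> {tau, rho, sq1, sq2} \<Longrightarrow> h \<in> carrier A1R"
  using A1R_gens by blast

text \<open>All four algebra generators have nonnegative weight, so no component can lie below the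
  weights occurring in a finite generating set.\<close>

lemma weights_bounded_below:
  assumes "finitely_generated_module A1R M"
  obtains w where "\<And>x d. x \<in> carrier M \<Longrightarrow> snd d < w \<Longrightarrow> comp x d = \<zero>\<^bsub>M\<^esub>"
proof -
  obtain S where S: "finite S" "S \<subseteq> carrier M"
    and gen: "\<forall>x \<in> carrier M. \<exists>c \<in> S \<rightarrow> carrier A1R. x = (\<Oplus>\<^bsub>M\<^esub>s \<in> S. c s \<bullet> s)"
    using assms unfolding finitely_generated_module_def by blast
  define D where "D = (\<Union>s\<in>S. {d. comp s d \<noteq> \<zero>\<^bsub>M\<^esub>})"
  have D: "finite D" unfolding D_def using S comp_finite by auto
  \<comment> \<open>Inserting 0 makes the set nonempty even if all module generators are
    zero.\<close>
  define w where "w = Min (insert 0 (snd ` D))"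
  define L where "L = {x \<in> carrier M. \<forall>d. snd d < w \<longrightarrow> comp x d = \<zero>\<^bsub>M\<^esub>}"
  have SL: "s \<in> L" if "s \<in> S" for s
  proof -
    have "comp s d = \<zero>\<^bsub>M\<^esub>" if "snd d < w" for d
    proof (rule ccontr)
      assume "comp s d \<noteq> \<zero>\<^bsub>M\<^esub>"
      then have "d \<in> D" unfolding D_def using \<open>s \<in> S\<close> by blast
      then have "w \<le> snd d" unfolding w_def using D by (intro Min_le) auto
      then show False using that by simp
    qed
    then show ?thesis unfolding L_def using that S by auto
  qed
  have add: "x \<oplus>\<^bsub>M\<^esub> y \<in> L" if "x \<in> L" "y \<in> L" for x y
    using that by (auto simp: L_def comp_add)
  have smult: "a \<bullet> x \<in> L" if "a \<in> carrier A1R" "x \<in> L" for a x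
  proof (rule smult_stable[OF _ add _ that])
    fix h y assume h: "h \<in> {tau, rho, sq1, sq2}" and y: "y \<in> L"
    obtain e where e: "h \<in> A1R_grading e" "0 \<le> snd e" using gen_homogeneous[OF h] .
    have yM: "y \<in> carrier M" using y by (simp add: L_def)
    have "comp (h \<bullet> y) d = \<zero>\<^bsub>M\<^esub>" if d: "snd d < w" for d
    proof -
      have "snd (d - e) < w" using d e(2) by simp
      then have "comp y (d - e) = \<zero>\<^bsub>M\<^esub>" using y unfolding L_def by blast
      then show ?thesis using gen_A1R[OF h] by (simp add: comp_smult[OF e(1) yM] smult_zero_right)
    qed
    then show "h \<bullet> y \<in> L" using yM gen_A1R[OF h] by (simp add: L_def)
  qed (auto simp: L_def)
  have "x \<in> L" if x: "x \<in> carrier M" for x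
  proof -
    obtain c where c: "c \<in> S \<rightarrow> carrier A1R" "x = (\<Oplus>\<^bsub>M\<^esub>s \<in> S. c s \<bullet> s)" using gen x by blast
    have "\<zero>\<^bsub>M\<^esub> \<in> L" using comp_homogeneous[OF G_zero] by (simp add: L_def)
    then have "(\<Oplus>\<^bsub>M\<^esub>s \<in> S. c s \<bullet> s) \<in> L"
    proof (rule M.finsum_stable[OF S(1) _ add])
      show "L \<subseteq> carrier M" by (auto simp: L_def)
      show "c s \<bullet> s \<in> L" if "s \<in> S" for s using c(1) that by (auto intro: smult SL)
    qed
    then show ?thesis using c(2) by simp
  qed
  then show thesis by (intro that[of w]) (simp add: L_def)
qed

lemma graded_nakayama:
  assumes fg: "finitely_generated_module A1R M" and B: "B \<subseteq> (\<Union>d. G d)"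
    and span: "\<And>x. x \<in> carrier M \<Longrightarrow> \<exists>l\<in>lspan A1R M B. \<exists>n\<in>N. x = l \<oplus>\<^bsub>M\<^esub> n"
  shows "carrier M \<subseteq> lspan A1R M B"
proof -
  define L where "L = lspan A1R M B"
  have BM: "B \<subseteq> carrier M" using B G_carrier by blast
  have LM: "L \<subseteq> carrier M" unfolding L_def by (rule lspan_carrier[OF BM])
  have L_add: "x \<oplus>\<^bsub>M\<^esub> y \<in> L" if "x \<in> L" "y \<in> L" for x y
    using that lspan_add[OF BM] by (simp add: L_def)
  have L_smult: "a \<bullet> x \<in> L" if "a \<in> carrier A1R" "x \<in> L" for a x
    using that lspan_smult[OF BM] by (simp add: L_def)
  have L_zero: "\<zero>\<^bsub>M\<^esub> \<in> L" by (simp add: L_def lspan_zero)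
  \<comment> \<open>The span contains the components of its elements because \<open>B\<close> is
    homogeneous. This is shown by checking that \<open>Z\<close> contains \<open>B\<close> and is
    stable under sums and the action.\<close>
  define Z where "Z = {x \<in> carrier M. \<forall>d. comp x d \<in> L}"
  have Z_add: "x \<oplus>\<^bsub>M\<^esub> y \<in> Z" if "x \<in> Z" "y \<in> Z" for x y
    using that by (auto simp: Z_def comp_add L_add)
  have Z_smult: "a \<bullet> x \<in> Z" if "a \<in> carrier A1R" "x \<in> Z" for a x
  proof (rule smult_stable[OF _ Z_add _ that])
    fix h y assume h: "h \<in> {tau, rho, sq1, sq2}" and y: "y \<in> Z"
    obtain e where e: "h \<in> A1R_grading e" using gen_homogeneous[OF h] by blast
    then show "h \<bullet> y \<in> Z" using y gen_A1R[OF h] by (simp add: Z_def comp_smult L_smult)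
  qed (auto simp: Z_def)
  have BZ: "b \<in> Z" if b: "b \<in> B" for b
  proof -
    obtain d where d: "b \<in> G d" using B b by blast
    have "b \<in> L"
      using lspan_smult_basis[of b B "\<one>\<^bsub>AR\<^esub>"] b BM smult_add(3) unfolding L_def by auto
    then show ?thesis using d b BM L_zero by (auto simp: Z_def comp_homogeneous[OF d])
  qed
  have "\<zero>\<^bsub>M\<^esub> \<in> Z" using comp_homogeneous[OF G_zero] L_zero by (simp add: Z_def)
  then have LZ: "x \<in> Z" if "x \<in> L" for x
  proof -
    obtain F c where F: "finite F" "F \<subseteq> B" "c \<in> F \<rightarrow> carrier A1R" "x = (\<Oplus>\<^bsub>M\<^esub>b\<in>F. c b \<bullet> b)"
      using \<open>x \<in> L\<close> unfolding L_def lspan_def by blast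
    show ?thesis
      unfolding F(4)
    proof (rule M.finsum_stable[OF F(1) \<open>\<zero>\<^bsub>M\<^esub> \<in> Z\<close> Z_add])
      show "Z \<subseteq> carrier M" by (auto simp: Z_def)
      show "c b \<bullet> b \<in> Z" if "b \<in> F" for b using F(2,3) that by (auto intro: Z_smult BZ)
    qed
  qed
  obtain w where w: "\<And>x d. x \<in> carrier M \<Longrightarrow> snd d < w \<Longrightarrow> comp x d = \<zero>\<^bsub>M\<^esub>"
    using weights_bounded_below[OF fg] by blast
  \<comment> \<open>Induction on the weight above w. Modulo the span, a component of x is tau times
    a component of y plus rho times a component of z, both of weight one less.\<close>
  have comp_L: "comp x d \<in> L" if "x \<in> carrier M" "snd d < w + int k" for x d k
    using that
  proof (induction k arbitrary: x d)
    case 0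
    then show ?case by (simp add: w L_zero)
  next
    case (Suc k)
    obtain l n where l: "l \<in> L" and n: "n \<in> N" and x: "x = l \<oplus>\<^bsub>M\<^esub> n"
      using span[OF Suc.prems(1)] unfolding L_def by blast
    obtain y z where yz: "y \<in> carrier M" "z \<in> carrier M" "n = tau \<bullet> y \<oplus>\<^bsub>M\<^esub> rho \<bullet> z"
      using n by (rule NE)
    have "l \<in> carrier M" using l LM by blast
    then have "comp x d = comp l d \<oplus>\<^bsub>M\<^esub> (tau \<bullet> comp y (d - (0, 1)) \<oplus>\<^bsub>M\<^esub> rho \<bullet> comp z (d - (1, 1)))"
      unfolding x yz(3) using yz(1,2)
      by (simp add: comp_add comp_smult[OF gen_graded(1)] comp_smult[OF gen_graded(2)])
    moreover have "comp l d \<in> L" using LZ[OF l] by (simp add: Z_def)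
    moreover have "comp y (d - (0, 1)) \<in> L" "comp z (d - (1, 1)) \<in> L"
      using Suc.prems(2) by (intro Suc.IH yz, simp)+
    ultimately show ?case by (simp add: L_add L_smult)
  qed
  \<comment> \<open>The number of steps is chosen so that snd d < w + k; for snd d < w it is
    0.\<close>
  have cL: "comp x d \<in> L" if "x \<in> carrier M" for x d
    by (rule comp_L[OF that, of d "nat (snd d - w + 1)"]) simp
  have fin: "(\<Oplus>\<^bsub>M\<^esub>d \<in> {d. comp x d \<noteq> \<zero>\<^bsub>M\<^esub>}. comp x d) \<in> L" if "x \<in> carrier M" for x
    by (rule M.finsum_stable[OF comp_finite[OF that] L_zero L_add LM cL[OF that]])
  have "x \<in> L" if "x \<in> carrier M" for x
    using fin[OF that] unfolding comp_sum[OF that, symmetric] .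
  then show ?thesis by (auto simp: L_def)
qed

end

section \<open>Coordinates with respect to the monomial basis\<close>

lemma coef_mult: "coef (f * g) = coef f \<cdot> coef g"
  by (induction f rule: cpoly_induct)
    (simp_all add: coef_one coef_T coef_R coef_add mult.assoc AR.m_assoc distrib_right AR.l_distr)

lemma lin_comb_smult: "lin_comb (\<lambda>k. f * c k) = coef f \<cdot> lin_comb c"
  unfolding lin_comb_def
  by (subst AR.finsum_rdistr) (rule AR.finsum_cong' | force simp: coef_mult AR.m_assoc)+

text \<open>The choice is harmless for k < 8 by \<open>lin_comb_inj\<close>; values at larger k are
  arbitrary.\<close>

definition sq_coord :: "nat \<Rightarrow> steenrod \<Rightarrow> cpoly" where
  "sq_coord k a = (SOME c. a = lin_comb c) k"

lemma sq_coord_lin_comb: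
  assumes "k < 8" shows "sq_coord k (lin_comb c) = c k"
proof -
  have "lin_comb c = lin_comb (SOME d. lin_comb c = lin_comb d)" by (rule someI[of "\<lambda>d. lin_comb c = lin_comb d" c, OF refl])
  from lin_comb_inj[OF this assms] show ?thesis unfolding sq_coord_def by simp
qed

lemma sq_coord:
  assumes "k < 8"
  shows "a \<in> carrier A1R \<Longrightarrow> b \<in> carrier A1R \<Longrightarrow> sq_coord k (a \<boxplus> b) = sq_coord k a + sq_coord k b"
    "a \<in> carrier A1R \<Longrightarrow> sq_coord k (coef f \<cdot> a) = f * sq_coord k a"
    "j < 8 \<Longrightarrow> sq_coord k (sq_basis j) = (if j = k then 1 else 0)"
    "sq_coord k \<zero>\<^bsub>AR\<^esub> = 0"
proof -
  show "sq_coord k (a \<boxplus> b) = sq_coord k a + sq_coord k b" if "a \<in> carrier A1R" "b \<in> carrier A1R"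
  proof -
    obtain c where "a = lin_comb c" using A1R_lin_comb[OF \<open>a \<in> carrier A1R\<close>] by blast
    moreover obtain d where "b = lin_comb d" using A1R_lin_comb[OF \<open>b \<in> carrier A1R\<close>] by blast
    ultimately have "a = lin_comb c" "b = lin_comb d" by auto
    then show ?thesis using sq_coord_lin_comb[OF assms] by (simp add: lin_comb_add[symmetric])
  qed
  show "sq_coord k (coef f \<cdot> a) = f * sq_coord k a" if "a \<in> carrier A1R"
  proof -
    obtain c where "a = lin_comb c" using A1R_lin_comb[OF \<open>a \<in> carrier A1R\<close>] by blast
    then show ?thesis using sq_coord_lin_comb[OF assms] by (simp add: lin_comb_smult[symmetric])
  qed
  show "sq_coord k (sq_basis j) = (if j = k then 1 else 0)" if "j < 8"
    using sq_coord_lin_comb[OF assms] by (auto simp: lin_comb_basis[OF that, symmetric])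
  show "sq_coord k \<zero>\<^bsub>AR\<^esub> = 0"
    using sq_coord_lin_comb[OF assms, of "\<lambda>_. 0"] by (simp add: lin_comb_zero)
qed

lemma sq_basis_graded: "k < 8 \<Longrightarrow> \<exists>d. sq_basis k \<in> A1R_grading d"
proof -
  have one: "\<one>\<^bsub>AR\<^esub> \<in> A1R_grading 0"
    using A1R_closed(3) unfolding cl_simps(3)[symmetric]
    by (auto simp: A1R_grading_def AR_grading_def free_homogeneous_def word_bideg_def zero_steenrod_word_def
       intro!: image_eqI[of _ _ 1])
  have mult: "a \<cdot> b \<in> A1R_grading (d + e)" if ab: "a \<in> A1R_grading d" "b \<in> A1R_grading e" for a b d e
  proof -
    obtain x y where x: "x \<in> free_homogeneous d" "a = cl x" and y: "y \<in> free_homogeneous e" "b = cl y"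
      using ab unfolding A1R_grading_def AR_grading_def by blast
    have "x * y \<in> free_homogeneous (d + e)"
      unfolding free_homogeneous_def
    proof (intro CollectI ballI)
      fix w assume "w \<in> Poly_Mapping.keys (x * y)"
      then obtain u v where "w = u + v" "u \<in> Poly_Mapping.keys x" "v \<in> Poly_Mapping.keys y"
        using keys_mult[of x y] by blast
      then show "word_bideg w = d + e"
        using x(1) y(1) by (simp add: free_homogeneous_def word_bideg_def plus_steenrod_word_def)
    qed
    moreover have "a \<cdot> b \<in> carrier A1R"
      using ab by (simp add: A1R_grading_def)
    ultimately show ?thesis
      unfolding A1R_grading_def AR_grading_def x(2) y(2) cl_simps(2)[symmetric] by blast
  qed
  define H where "H = (\<Union>d. A1R_grading d)"
  have "a \<cdot> b \<in> H" if "a \<in> H" "b \<in> H" for a b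
    using that mult unfolding H_def by blast
  moreover have "\<one>\<^bsub>AR\<^esub> \<in> H" "sq1 \<in> H" "sq2 \<in> H"
    using one gen_graded unfolding H_def by blast+
  ultimately have "k < 8 \<Longrightarrow> sq_basis k \<in> H"
    by (subst (asm) less_8_iff, elim disjE) (simp_all add: sq_basis_simps)
  then show "k < 8 \<Longrightarrow> \<exists>d. sq_basis k \<in> A1R_grading d"
    unfolding H_def by blast
qed

section \<open>Freeness\<close>

lemma M2R_in_A1R: "a \<in> carrier M2R \<Longrightarrow> a \<in> carrier A1R"
  using M2R_sub by blast

lemma M2R_regular:
  assumes "c \<in> carrier M2R" "d \<in> carrier M2R" "tau \<cdot> c \<boxplus> rho \<cdot> d = \<zero>\<^bsub>AR\<^esub>"
  shows "\<exists>m\<in>carrier M2R. c = rho \<cdot> m"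
proof -
  obtain f where f: "c = coef f" using M2R_coef[OF assms(1)] by blast
  obtain g where g: "d = coef g" using M2R_coef[OF assms(2)] by blast
  have "coef (tpoly * f + rpoly * g) = coef 0"
    using assms(3) by (simp only: f g coef_add coef_T coef_R coef_zero)
  then have 0: "tpoly * f + rpoly * g = 0" by (rule coef_inj)
  \<comment> \<open>Writing g = g0 + tau g', the equation reads rho g0 + tau (f + rho g') = 0. Its
    part of positive degree in tau gives f = rho g' in characteristic two.\<close>
  obtain g0 g' where g': "g = pCons g0 g'" by (cases g)
  have "tpoly * f = pCons 0 f" "rpoly * pCons g0 g' = pCons ([:0, 1:] * g0) (rpoly * g')"
    by (simp_all add: tpoly_def rpoly_def)
  with 0 have "pCons ([:0, 1:] * g0) (f + rpoly * g') = 0" by (simp only: g' add_pCons add_0)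
  then have "f + rpoly * g' = 0" by (simp only: pCons_eq_0_iff)
  then have "f + (rpoly * g' + rpoly * g') = rpoly * g'" by (simp only: add.assoc[symmetric] add_0)
  then have "c = rho \<cdot> coef g'" by (simp only: cpoly_add_self add_0_right f coef_R)
  then show ?thesis using coef_M2R[of g'] by blast
qed

lemma M2R_rho_cancel:
  assumes "c \<in> carrier M2R" "rho \<cdot> c = \<zero>\<^bsub>AR\<^esub>" shows "c = \<zero>\<^bsub>AR\<^esub>"
proof -
  obtain f where f: "c = coef f" using M2R_coef[OF assms(1)] by blast
  have "coef (rpoly * f) = coef 0" using assms(2) by (simp add: f coef_R)
  then have "rpoly * f = 0" by (rule coef_inj)
  then show ?thesis by (simp add: f)
qed

context A1R_bigraded
begin

lemma M2R_left_module: "left_module M2R M"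
proof (intro left_module.intro left_module_axioms.intro)
  show "ring M2R" by (rule M2R_ring)
  show "abelian_group M" by (rule M.abelian_group_axioms)
qed (simp_all add: M2R_in_A1R smult_add smult_r_distr)

lemma lin_comb_smult_span:
  assumes B: "B \<subseteq> carrier M" and b: "b \<in> B"
  shows "lin_comb c \<bullet> b \<in> lspan M2R M ((\<lambda>(k, b). sq_basis k \<bullet> b) ` ({..<8} \<times> B))"
    (is "_ \<in> lspan M2R M ?E")
proof -
  have E: "?E \<subseteq> carrier M" using B by auto
  have bM: "b \<in> carrier M" using B b by blast
  let ?S = "{a \<in> carrier A1R. a \<bullet> b \<in> lspan M2R M ?E}"
  have "lin_comb c \<in> ?S"
    unfolding lin_comb_def
  proof (rule AR.finsum_stable)
    show "\<zero>\<^bsub>AR\<^esub> \<in> ?S"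
      using bM left_module.lspan_zero[OF M2R_left_module] by (simp add: smult_add)
    show "x \<boxplus> y \<in> ?S"
      if "x \<in> ?S" "y \<in> ?S" for x y
      using that bM left_module.lspan_add[OF M2R_left_module E] by (simp add: smult_add)
    show "coef (c k) \<cdot> sq_basis k \<in> ?S" if "k \<in> {..<8}" for k
    proof -
      have "coef (c k) \<bullet> (sq_basis k \<bullet> b) \<in> lspan M2R M ?E"
        by (rule left_module.lspan_smult_basis[OF M2R_left_module]) (use that b bM coef_M2R in auto)
      then show ?thesis using that bM by (simp add: smult_add)
    qed
  qed auto
  then show ?thesis by blast
qed

lemma free_imp_M2R_basis:
  assumes B: "module_basis A1R M B"
  shows "module_basis M2R M ((\<lambda>(k, b). sq_basis k \<bullet> b) ` ({..<8} \<times> B))"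
    (is "module_basis M2R M ?E")
proof -
  have BM: "B \<subseteq> carrier M" using B by (simp add: module_basis_def)
  then have E: "?E \<subseteq> carrier M" by auto
  obtain coord where c: "module_coords A1R M B coord"
    using basis_coords[OF B] .
  note coord = module_coordsD[OF c] and coord_zero = module_coords_zero[OF c, simplified]
  show ?thesis
    unfolding module_basis_def
  proof (intro conjI ballI allI impI)
    show "?E \<subseteq> carrier M" by (rule E)
  next
    fix x assume x: "x \<in> carrier M"
    obtain F where F: "finite F" "F \<subseteq> B" "x = (\<Oplus>\<^bsub>M\<^esub>b\<in>F. coord b x \<bullet> b)"
      using coord(6)[OF x] by blast
    have "(\<Oplus>\<^bsub>M\<^esub>b\<in>F. coord b x \<bullet> b) \<in> lspan M2R M ?E"
    proof (rule M.finsum_stable[OF F(1) left_module.lspan_zero[OF M2R_left_module] left_module.lspan_add[OF M2R_left_module E]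
          left_module.lspan_carrier[OF M2R_left_module E]])
      fix b assume b: "b \<in> F"
      obtain c where c: "coord b x = lin_comb c" using A1R_lin_comb[OF coord(1)[OF x]] by blast
      show "coord b x \<bullet> b \<in> lspan M2R M ?E"
        unfolding c by (rule lin_comb_smult_span[OF BM]) (use b F in blast)
    qed
    then have "x \<in> lspan M2R M ?E" unfolding F(3)[symmetric] .
    then show "\<exists>F c. finite F \<and> F \<subseteq> ?E \<and> c \<in> F \<rightarrow> carrier M2R \<and> x = (\<Oplus>\<^bsub>M\<^esub>b \<in> F. c b \<bullet> b)"
      unfolding lspan_def by blast
  next
    fix F c e
    assume "finite F \<and> F \<subseteq> ?E \<and> c \<in> F \<rightarrow> carrier M2R \<and> (\<Oplus>\<^bsub>M\<^esub>b \<in> F. c b \<bullet> b) = \<zero>\<^bsub>M\<^esub>"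
      and e: "e \<in> F"
    then have F: "finite F" "F \<subseteq> ?E" "c \<in> F \<rightarrow> carrier M2R" and sum: "(\<Oplus>\<^bsub>M\<^esub>b \<in> F. c b \<bullet> b) = \<zero>\<^bsub>M\<^esub>"
      by blast+
    obtain k b where kb: "k < 8" "b \<in> B" "e = sq_basis k \<bullet> b" using e F(2) by auto
    \<comment> \<open>The coefficient functional dual to \<open>sq_basis k \<bullet> b\<close>:
      first the \<open>A1R\<close>-coordinate at b, then its k-th polynomial coordinate. It is
      linear over \<open>M2R\<close>.\<close>
    define \<psi> where "\<psi> x = sq_coord k (coord b x)" for x
    have "\<forall>e'\<in>F. \<exists>f. c e' = coef f" using F(3) M2R_coef by blast
    then obtain f where f: "\<And>e'. e' \<in> F \<Longrightarrow> c e' = coef (f e')" by metis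
    have \<psi>_E: "\<psi> e' = (if e = e' then 1 else 0)" if e': "e' \<in> F" for e'
    proof -
      obtain j b' where jb: "j < 8" "b' \<in> B" "e' = sq_basis j \<bullet> b'" using e' F(2) by auto
      have "b' \<in> carrier M" using jb BM by blast
      then have "\<psi> e' = (if b' = b \<and> j = k then 1 else 0)"
        using jb kb(1) unfolding \<psi>_def jb(3) by (simp add: coord sq_coord)
      \<comment> \<open>A pair other than (k, b) yields 0 and e yields 1, so distinct pairs
        automatically give distinct elements.\<close>
      moreover have "\<psi> e = 1"
      proof -
        have "b \<in> carrier M" using kb BM by blast
        then show ?thesis using kb(1,2) unfolding \<psi>_def kb(3) by (simp add: coord sq_coord)
      qed
      ultimately show ?thesis using jb(3) kb(3) by auto
    qed
    have eM: "e' \<in> carrier M" if "e' \<in> F" for e' using that F(2) E by blast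
    have cM: "(\<lambda>e'. c e' \<bullet> e') \<in> F \<rightarrow> carrier M"
      using F(3) eM by (auto simp: M2R_in_A1R Pi_iff)
    \<comment> \<open>\<open>coef\<close> carries the values of \<open>\<psi>\<close> into
      \<open>AR\<close>, so that \<open>additive_finsum\<close> can compare the two sums.\<close>
    have "coef (\<psi> (\<Oplus>\<^bsub>M\<^esub>e'\<in>F. c e' \<bullet> e')) = (\<Oplus>\<^bsub>AR\<^esub>e'\<in>F. coef (\<psi> (c e' \<bullet> e')))"
    proof (rule additive_finsum[OF M.abelian_monoid_axioms AR.abelian_monoid_axioms _ _ _ F(1) cM])
      show "coef (\<psi> \<zero>\<^bsub>M\<^esub>) = \<zero>\<^bsub>AR\<^esub>" using kb(1) by (simp add: \<psi>_def coord_zero sq_coord)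
      show "coef (\<psi> (x \<oplus>\<^bsub>M\<^esub> y)) = coef (\<psi> x) \<boxplus> coef (\<psi> y)" if "x \<in> carrier M" "y \<in> carrier M" for x y
        using that kb(1) by (simp add: \<psi>_def coord sq_coord coef_add)
    qed simp
    also have "\<dots> = (\<Oplus>\<^bsub>AR\<^esub>e'\<in>F. if e = e' then coef (f e') else \<zero>\<^bsub>AR\<^esub>)"
    proof (rule AR.finsum_cong')
      fix e' assume e': "e' \<in> F"
      have "\<psi> (c e' \<bullet> e') = f e' * \<psi> e'"
        using eM[OF e'] kb(1) unfolding f[OF e'] by (simp add: \<psi>_def coord sq_coord)
      then show "coef (\<psi> (c e' \<bullet> e')) = (if e = e' then coef (f e') else \<zero>\<^bsub>AR\<^esub>)"
        by (simp add: \<psi>_E[OF e'])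
    qed auto
    also have "\<dots> = coef (f e)"
      by (rule AR.finsum_singleton[OF e F(1)]) simp
    finally have "c e = coef (\<psi> \<zero>\<^bsub>M\<^esub>)" unfolding sum f[OF e] by simp
    also have "\<dots> = \<zero>\<^bsub>AR\<^esub>"
      using kb(1) by (simp add: \<psi>_def coord_zero sq_coord)
    finally show "c e = \<zero>\<^bsub>M2R\<^esub>" by simp
  qed
qed

text \<open>A relation in the reduction lifts to an element tau p + rho q of \<open>N\<close>. Its
  coordinates are tau times those of p plus rho times those of q, so the lifted coefficients lie in
  the ideal.\<close>

lemma free_imp_reduction_basis:
  assumes B: "module_basis A1R M B"
  shows "module_basis F2A1R FM (red ` B)"
proof -
  have BM: "B \<subseteq> carrier M" using B by (simp add: module_basis_def)
  then have RB: "red ` B \<subseteq> carrier FM" by (auto simp: FM_simps)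
  obtain coord where c: "module_coords A1R M B coord"
    using basis_coords[OF B] .
  note coord = module_coordsD[OF c] and coord_zero = module_coords_zero[OF c, simplified]
  interpret FM: left_module F2A1R FM by (rule FM_left_module)
  show ?thesis
    unfolding module_basis_def
  proof (intro conjI ballI allI impI)
    show "red ` B \<subseteq> carrier FM" by (rule RB)
  next
    fix u assume "u \<in> carrier FM"
    then obtain x where x: "x \<in> carrier M" "u = red x" by (auto simp: FM_simps)
    obtain F where F: "finite F" "F \<subseteq> B" "x = (\<Oplus>\<^bsub>M\<^esub>b\<in>F. coord b x \<bullet> b)"
      using coord(6)[OF x(1)] by blast
    have "red (\<Oplus>\<^bsub>M\<^esub>b\<in>F. coord b x \<bullet> b) = (\<Oplus>\<^bsub>FM\<^esub>b\<in>F. red (coord b x \<bullet> b))"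
      by (rule red_finsum[OF F(1)]) (use F(2) BM coord(1)[OF x(1)] in auto)
    then have "u = (\<Oplus>\<^bsub>FM\<^esub>b\<in>F. red (coord b x \<bullet> b))" unfolding F(3)[symmetric] x(2) .
    also have "\<dots> \<in> lspan F2A1R FM (red ` B)"
    proof (rule FM.M.finsum_stable[OF F(1) FM.lspan_zero FM.lspan_add[OF RB] FM.lspan_carrier[OF RB]])
      fix b assume b: "b \<in> F"
      then have bM: "b \<in> carrier M" using F(2) BM by blast
      have "redA (coord b x) \<odot>\<^bsub>FM\<^esub> red b \<in> lspan F2A1R FM (red ` B)"
        by (rule FM.lspan_smult_basis) (use b F(2) bM coord(1)[OF x(1)] in \<open>auto simp: FM_simps FA_carrier\<close>)
      then show "red (coord b x \<bullet> b) \<in> lspan F2A1R FM (red ` B)"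
        using FM_smult[OF coord(1)[OF x(1)] bM] by simp
    qed
    finally show "\<exists>F c. finite F \<and> F \<subseteq> red ` B \<and> c \<in> F \<rightarrow> carrier F2A1R \<and> u = (\<Oplus>\<^bsub>FM\<^esub>b \<in> F. c b \<odot>\<^bsub>FM\<^esub> b)"
      unfolding lspan_def by blast
  next
    fix F c u
    assume "finite F \<and> F \<subseteq> red ` B \<and> c \<in> F \<rightarrow> carrier F2A1R \<and> (\<Oplus>\<^bsub>FM\<^esub>b \<in> F. c b \<odot>\<^bsub>FM\<^esub> b) = \<zero>\<^bsub>FM\<^esub>"
      and u: "u \<in> F"
    then have F: "finite F" "F \<subseteq> red ` B" "c \<in> F \<rightarrow> carrier F2A1R" and sum: "(\<Oplus>\<^bsub>FM\<^esub>b \<in> F. c b \<odot>\<^bsub>FM\<^esub> b) = \<zero>\<^bsub>FM\<^esub>"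
      by blast+
    have "\<forall>v\<in>F. \<exists>b. b \<in> B \<and> v = red b" using F(2) by blast
    then obtain g where g: "\<And>v. v \<in> F \<Longrightarrow> g v \<in> B" "\<And>v. v \<in> F \<Longrightarrow> v = red (g v)" by metis
    have "\<forall>v\<in>F. \<exists>a. a \<in> carrier A1R \<and> c v = redA a" using F(3) by (auto simp: FA_carrier Pi_iff)
    then obtain a where a: "\<And>v. v \<in> F \<Longrightarrow> a v \<in> carrier A1R" "\<And>v. v \<in> F \<Longrightarrow> c v = redA (a v)" by metis
    have gM: "g v \<in> carrier M" if "v \<in> F" for v using g(1)[OF that] BM by blast
    define y where "y = (\<Oplus>\<^bsub>M\<^esub>v\<in>F. a v \<bullet> g v)"
    have agM: "(\<lambda>v. a v \<bullet> g v) \<in> F \<rightarrow> carrier M" using a gM by auto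
    have yM: "y \<in> carrier M" unfolding y_def by (rule M.finsum_closed[OF agM])
    have "red y = (\<Oplus>\<^bsub>FM\<^esub>v\<in>F. red (a v \<bullet> g v))"
      unfolding y_def by (rule red_finsum[OF F(1) agM])
    also have "\<dots> = (\<Oplus>\<^bsub>FM\<^esub>v\<in>F. c v \<odot>\<^bsub>FM\<^esub> v)"
    proof (rule FM.M.finsum_cong'[OF refl])
      show "(\<lambda>v. c v \<odot>\<^bsub>FM\<^esub> v) \<in> F \<rightarrow> carrier FM"
        using F RB by (auto intro!: FM.smult_closed)
      fix v assume v: "v \<in> F"
      have "c v \<odot>\<^bsub>FM\<^esub> v = redA (a v) \<odot>\<^bsub>FM\<^esub> red (g v)"
        using a(2)[OF v] g(2)[OF v] by simp
      then show "red (a v \<bullet> g v) = c v \<odot>\<^bsub>FM\<^esub> v"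
        by (simp add: FM_smult[OF a(1)[OF v] gM[OF v]])
    qed
    finally have "y \<in> N" using sum red_eq_N[OF yM] by (simp add: FM_simps)
    then obtain p q where pq: "p \<in> carrier M" "q \<in> carrier M" "y = tau \<bullet> p \<oplus>\<^bsub>M\<^esub> rho \<bullet> q"
      by (rule NE)
    have "coord (g u) y = (\<Oplus>\<^bsub>AR\<^esub>v\<in>F. coord (g u) (a v \<bullet> g v))"
      unfolding y_def
    proof (rule additive_finsum[OF M.abelian_monoid_axioms AR.abelian_monoid_axioms _ _ _ F(1) agM])
      show "coord (g u) \<zero>\<^bsub>M\<^esub> = \<zero>\<^bsub>AR\<^esub>" by (rule coord_zero)
    qed (use coord in auto)
    also have "\<dots> = (\<Oplus>\<^bsub>AR\<^esub>v\<in>F. if u = v then a v else \<zero>\<^bsub>AR\<^esub>)"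
    proof (rule AR.finsum_cong')
      fix v assume v: "v \<in> F"
      have "g v = g u \<longleftrightarrow> u = v" using g(2)[OF v] g(2)[OF u] by metis
      then show "coord (g u) (a v \<bullet> g v) = (if u = v then a v else \<zero>\<^bsub>AR\<^esub>)"
        using a(1)[OF v] gM[OF v] coord(4)[OF g(1)[OF v], of "g u"] by (auto simp: coord(3))
    qed (use a in auto)
    also have "\<dots> = a u"
      by (rule AR.finsum_singleton[OF u F(1)]) (use a in auto)
    finally have "a u = tau \<cdot> coord (g u) p \<boxplus> rho \<cdot> coord (g u) q"
      unfolding pq(3) using pq(1,2) by (simp add: coord)
    then have "a u \<in> tau_rho_ideal" using coord(1) pq by (simp add: tau_rho_idealI)
    then show "c u = \<zero>\<^bsub>F2A1R\<^esub>" using a[OF u] by (simp add: redA_zero)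
  qed
qed

end

context A1R_bigraded
begin

text \<open>rho, tau is a regular sequence on the polynomial ring, and coordinates in
  \<open>E\<close> carry this over to the module: an element whose coordinates are all divisible by
  rho is itself a multiple of rho.\<close>

lemma M2R_free_regular:
  assumes E: "module_basis M2R M E"
  shows rho_cancel: "x \<in> carrier M \<Longrightarrow> rho \<bullet> x = \<zero>\<^bsub>M\<^esub> \<Longrightarrow> x = \<zero>\<^bsub>M\<^esub>"
    and tau_rho_regular: "x \<in> carrier M \<Longrightarrow> y \<in> carrier M \<Longrightarrow> tau \<bullet> x \<oplus>\<^bsub>M\<^esub> rho \<bullet> y = \<zero>\<^bsub>M\<^esub> \<Longrightarrow>
      \<exists>z\<in>carrier M. x = rho \<bullet> z"
proof -
  interpret M2: left_module M2R M by (rule M2R_left_module)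
  have EM: "E \<subseteq> carrier M" using E by (simp add: module_basis_def)
  obtain coord where c: "module_coords M2R M E coord"
    using M2.basis_coords[OF E] .
  note coord = module_coordsD[OF c] and coord_zero = M2.module_coords_zero[OF c, simplified]
  show "x = \<zero>\<^bsub>M\<^esub>" if x: "x \<in> carrier M" and "rho \<bullet> x = \<zero>\<^bsub>M\<^esub>"
  proof (rule coord(5)[OF x], intro ballI)
    fix b
    have "rho \<cdot> coord b x = \<zero>\<^bsub>AR\<^esub>"
      using coord(3)[OF x, of rho b] \<open>rho \<bullet> x = \<zero>\<^bsub>M\<^esub>\<close> coord_zero by simp
    then show "coord b x = \<zero>\<^bsub>M2R\<^esub>" using M2R_rho_cancel[OF coord(1)[OF x]] by simp
  qed
  show "\<exists>z\<in>carrier M. x = rho \<bullet> z"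
    if x: "x \<in> carrier M" and y: "y \<in> carrier M" and xy: "tau \<bullet> x \<oplus>\<^bsub>M\<^esub> rho \<bullet> y = \<zero>\<^bsub>M\<^esub>"
  proof -
    have "\<exists>m\<in>carrier M2R. coord b x = rho \<cdot> m" for b
    proof (rule M2R_regular[OF coord(1)[OF x] coord(1)[OF y]])
      have "coord b (tau \<bullet> x \<oplus>\<^bsub>M\<^esub> rho \<bullet> y) = tau \<cdot> coord b x \<boxplus> rho \<cdot> coord b y"
        using x y by (simp add: coord)
      then show "tau \<cdot> coord b x \<boxplus> rho \<cdot> coord b y = \<zero>\<^bsub>AR\<^esub>"
        unfolding xy coord_zero by simp
    qed
    then obtain m where m: "\<And>b. m b \<in> carrier M2R" "\<And>b. coord b x = rho \<cdot> m b" by metis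
    obtain F where F: "finite F" "F \<subseteq> E" "x = (\<Oplus>\<^bsub>M\<^esub>b\<in>F. coord b x \<bullet> b)"
      using coord(6)[OF x] by blast
    have FM: "F \<subseteq> carrier M" using F(2) EM by blast
    have "rho \<bullet> (\<Oplus>\<^bsub>M\<^esub>b\<in>F. m b \<bullet> b) = (\<Oplus>\<^bsub>M\<^esub>b\<in>F. (rho \<otimes>\<^bsub>M2R\<^esub> m b) \<bullet> b)"
      by (rule M2.finsum_comb_smult[OF F(1) FM]) (use m in auto)
    also have "\<dots> = (\<Oplus>\<^bsub>M\<^esub>b\<in>F. coord b x \<bullet> b)"
      by (simp add: m(2)[symmetric])
    finally have "x = rho \<bullet> (\<Oplus>\<^bsub>M\<^esub>b\<in>F. m b \<bullet> b)" unfolding F(3)[symmetric] by (rule sym)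
    moreover have "(\<Oplus>\<^bsub>M\<^esub>b\<in>F. m b \<bullet> b) \<in> carrier M"
      by (rule M.finsum_closed) (use FM m(1) M2R_in_A1R in auto)
    ultimately show ?thesis by blast
  qed
qed

lemma reduction_span:
  assumes B: "B \<subseteq> carrier M" and span: "module_basis F2A1R FM (red ` B)" and x: "x \<in> carrier M"
  shows "\<exists>l\<in>lspan A1R M B. \<exists>n\<in>N. x = l \<oplus>\<^bsub>M\<^esub> n"
proof -
  interpret FM: left_module F2A1R FM by (rule FM_left_module)
  have "red x \<in> carrier FM" using x by (auto simp: FM_simps)
  with span[unfolded module_basis_def, THEN conjunct2, THEN conjunct1]
  have "\<exists>F c. finite F \<and> F \<subseteq> red ` B \<and> c \<in> F \<rightarrow> carrier F2A1R \<and> red x = (\<Oplus>\<^bsub>FM\<^esub>u\<in>F. c u \<odot>\<^bsub>FM\<^esub> u)"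
    by (rule bspec)
  then obtain F c where F: "finite F" "F \<subseteq> red ` B" "c \<in> F \<rightarrow> carrier F2A1R" "red x = (\<Oplus>\<^bsub>FM\<^esub>u\<in>F. c u \<odot>\<^bsub>FM\<^esub> u)"
    by (elim exE conjE) (rule that)
  have "(\<Oplus>\<^bsub>FM\<^esub>u\<in>F. c u \<odot>\<^bsub>FM\<^esub> u) \<in> red ` lspan A1R M B"
  proof (rule FM.M.finsum_stable[OF F(1)])
    show "\<zero>\<^bsub>FM\<^esub> \<in> red ` lspan A1R M B"
      using imageI[OF lspan_zero, of red B] by (simp only: FM_simps red_zero)
    show "u \<oplus>\<^bsub>FM\<^esub> v \<in> red ` lspan A1R M B" if uv: "u \<in> red ` lspan A1R M B" "v \<in> red ` lspan A1R M B" for u v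
    proof -
      obtain y z where "y \<in> lspan A1R M B" "z \<in> lspan A1R M B" "u = red y" "v = red z" using uv by blast
      moreover from this have "y \<in> carrier M" "z \<in> carrier M" using lspan_carrier[OF B] by auto
      ultimately have "u \<oplus>\<^bsub>FM\<^esub> v = red (y \<oplus>\<^bsub>M\<^esub> z)" "y \<oplus>\<^bsub>M\<^esub> z \<in> lspan A1R M B"
        using lspan_add[OF B] by (simp_all add: FM_simps red_add)
      then show ?thesis by blast
    qed
    show "red ` lspan A1R M B \<subseteq> carrier FM"
      unfolding FM_simps using lspan_carrier[OF B] by (rule image_mono)
    fix u assume u: "u \<in> F"
    obtain b where b: "b \<in> B" "u = red b" using u F(2) by blast
    have "c u \<in> carrier F2A1R" using F(3) u by blast
    then obtain a where a: "a \<in> carrier A1R" "c u = redA a" by (auto simp: FA_carrier)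
    have "b \<in> carrier M" using b B by blast
    have "c u \<odot>\<^bsub>FM\<^esub> u = redA a \<odot>\<^bsub>FM\<^esub> red b" by (rule arg_cong2[OF a(2) b(2)])
    also have "\<dots> = red (a \<bullet> b)" by (rule FM_smult[OF a(1) \<open>b \<in> carrier M\<close>])
    finally have "c u \<odot>\<^bsub>FM\<^esub> u = red (a \<bullet> b)" .
    moreover have "a \<bullet> b \<in> lspan A1R M B"
      by (rule lspan_smult_basis[OF b(1) \<open>b \<in> carrier M\<close> a(1)])
    ultimately show "c u \<odot>\<^bsub>FM\<^esub> u \<in> red ` lspan A1R M B" by blast
  qed
  then obtain l where l: "l \<in> lspan A1R M B" "red x = red l" unfolding F(4)[symmetric] by blast
  have lM: "l \<in> carrier M" using l lspan_carrier[OF B] by blast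
  have "x \<in> red l" using red_self[OF x] l(2) by simp
  then obtain n where n: "n \<in> N" "x = n \<oplus>\<^bsub>M\<^esub> l" by (auto simp: red_elem)
  have "x = l \<oplus>\<^bsub>M\<^esub> n" unfolding n(2) using lM n(1) N_carrier by (intro M.a_comm) auto
  then show ?thesis using l n by blast
qed

lemma reduction_independent:
  assumes B: "B \<subseteq> carrier M" and inj: "inj_on red B" and basis: "module_basis F2A1R FM (red ` B)"
    and F: "finite F" "F \<subseteq> B" "c \<in> F \<rightarrow> carrier A1R" and sum: "(\<Oplus>\<^bsub>M\<^esub>b\<in>F. c b \<bullet> b) = \<zero>\<^bsub>M\<^esub>" and b: "b \<in> F"
  shows "c b \<in> tau_rho_ideal"
proof -
  interpret FM: left_module F2A1R FM by (rule FM_left_module)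
  have FcM: "F \<subseteq> carrier M" using F(2) B by blast
  have injF: "inj_on red F" using inj F(2) by (rule inj_on_subset)
  \<comment> \<open>The relation is reindexed by cosets; injectivity of \<open>red\<close> on
    \<open>F\<close> keeps distinct coefficients from being merged.\<close>
  define C where "C u = redA (c (the_inv_into F red u))" for u
  have C: "C (red b) = redA (c b)" if "b \<in> F" for b
    using the_inv_into_f_f[OF injF that] by (simp add: C_def)
  have cM: "(\<lambda>b. c b \<bullet> b) \<in> F \<rightarrow> carrier M" using F(3) FcM by (auto simp: Pi_iff subset_iff)
  have CFM: "C (red b) \<odot>\<^bsub>FM\<^esub> red b = red (c b \<bullet> b)" if "b \<in> F" for b
    unfolding C[OF that] using F(3) FcM that by (intro FM_smult) auto
  have cl: "red (c b \<bullet> b) \<in> carrier FM" if "b \<in> F" for b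
    using cM that by (auto simp: FM_simps)
  have "(\<Oplus>\<^bsub>FM\<^esub>u\<in>red ` F. C u \<odot>\<^bsub>FM\<^esub> u) = (\<Oplus>\<^bsub>FM\<^esub>b\<in>F. C (red b) \<odot>\<^bsub>FM\<^esub> red b)"
    by (rule FM.M.finsum_reindex[OF _ injF]) (auto simp: CFM cl)
  also have "\<dots> = (\<Oplus>\<^bsub>FM\<^esub>b\<in>F. red (c b \<bullet> b))"
    by (rule FM.M.finsum_cong') (auto simp: CFM cl)
  also have "\<dots> = red (\<Oplus>\<^bsub>M\<^esub>b\<in>F. c b \<bullet> b)"
    by (rule red_finsum[OF F(1) cM, symmetric])
  also have "\<dots> = \<zero>\<^bsub>FM\<^esub>"
    unfolding sum by (simp add: red_zero FM_simps)
  finally have zero: "(\<Oplus>\<^bsub>FM\<^esub>u\<in>red ` F. C u \<odot>\<^bsub>FM\<^esub> u) = \<zero>\<^bsub>FM\<^esub>" .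
  have "\<forall>F c. finite F \<and> F \<subseteq> red ` B \<and> c \<in> F \<rightarrow> carrier F2A1R \<and> (\<Oplus>\<^bsub>FM\<^esub>u\<in>F. c u \<odot>\<^bsub>FM\<^esub> u) = \<zero>\<^bsub>FM\<^esub>
      \<longrightarrow> (\<forall>u\<in>F. c u = \<zero>\<^bsub>F2A1R\<^esub>)"
    by (rule basis[unfolded module_basis_def, THEN conjunct2, THEN conjunct2])
  moreover have "C \<in> red ` F \<rightarrow> carrier F2A1R"
    using F(3) C by (auto simp: FA_carrier)
  ultimately have "C (red b) = \<zero>\<^bsub>F2A1R\<^esub>"
    using zero F(1,2) b by (meson finite_imageI image_mono imageI)
  then show ?thesis using C[OF b] F(3) b redA_zero[of "c b"] by auto
qed

text \<open>If \<open>\<Sum> (\<tau> p\<^sub>b + \<rho> q\<^sub>b) b = 0\<close> then \<open>\<Sum> p\<^sub>b b = \<rho> z\<close> with \<open>z = \<Sum> z\<^sub>b b\<close>, and the coefficients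
  \<open>p\<^sub>b + \<rho> z\<^sub>b\<close> and \<open>q\<^sub>b + \<tau> z\<^sub>b\<close> form relations again.\<close>

lemma independent_filt:
  assumes BM: "B \<subseteq> carrier M" and inj: "inj_on red B" and basis: "module_basis F2A1R FM (red ` B)"
    and E: "module_basis M2R M E" and span: "carrier M \<subseteq> lspan A1R M B"
  shows "finite F \<Longrightarrow> F \<subseteq> B \<Longrightarrow> c \<in> F \<rightarrow> carrier A1R \<Longrightarrow> (\<Oplus>\<^bsub>M\<^esub>b\<in>F. c b \<bullet> b) = \<zero>\<^bsub>M\<^esub> \<Longrightarrow> b \<in> F \<Longrightarrow> c b \<in> filt n"
proof (induction n arbitrary: F c b)
  case 0
  then show ?case by auto
next
  case (Suc n)
  note F = Suc.prems(1-3) and sum = Suc.prems(4) and b = Suc.prems(5)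
  have FcM: "F \<subseteq> carrier M" using F(2) BM by blast
  have "\<forall>b\<in>F. \<exists>x y. x \<in> carrier A1R \<and> y \<in> carrier A1R \<and> c b = tau \<cdot> x \<boxplus> rho \<cdot> y"
  proof
    fix b assume "b \<in> F"
    from reduction_independent[OF BM inj basis F sum this]
    show "\<exists>x y. x \<in> carrier A1R \<and> y \<in> carrier A1R \<and> c b = tau \<cdot> x \<boxplus> rho \<cdot> y"
      unfolding tau_rho_ideal_def by auto
  qed
  then obtain p q where pq: "\<And>b. b \<in> F \<Longrightarrow> p b \<in> carrier A1R" "\<And>b. b \<in> F \<Longrightarrow> q b \<in> carrier A1R"
    "\<And>b. b \<in> F \<Longrightarrow> c b = tau \<cdot> p b \<boxplus> rho \<cdot> q b" by metis
  define px qy where "px = (\<Oplus>\<^bsub>M\<^esub>b\<in>F. p b \<bullet> b)" and "qy = (\<Oplus>\<^bsub>M\<^esub>b\<in>F. q b \<bullet> b)"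
  have pxqy: "px \<in> carrier M" "qy \<in> carrier M"
    unfolding px_def qy_def by (rule M.finsum_closed; use FcM pq in auto)+
  have rel: "tau \<bullet> px \<oplus>\<^bsub>M\<^esub> rho \<bullet> qy = \<zero>\<^bsub>M\<^esub>"
  proof -
    have "tau \<bullet> px = (\<Oplus>\<^bsub>M\<^esub>b\<in>F. (tau \<otimes>\<^bsub>A1R\<^esub> p b) \<bullet> b)"
      unfolding px_def by (rule finsum_comb_smult[OF F(1) FcM]) (use pq in auto)
    moreover have "rho \<bullet> qy = (\<Oplus>\<^bsub>M\<^esub>b\<in>F. (rho \<otimes>\<^bsub>A1R\<^esub> q b) \<bullet> b)"
      unfolding qy_def by (rule finsum_comb_smult[OF F(1) FcM]) (use pq in auto)
    moreover have "(\<Oplus>\<^bsub>M\<^esub>b\<in>F. (tau \<otimes>\<^bsub>A1R\<^esub> p b) \<bullet> b) \<oplus>\<^bsub>M\<^esub> (\<Oplus>\<^bsub>M\<^esub>b\<in>F. (rho \<otimes>\<^bsub>A1R\<^esub> q b) \<bullet> b)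
        = (\<Oplus>\<^bsub>M\<^esub>b\<in>F. (tau \<otimes>\<^bsub>A1R\<^esub> p b \<oplus>\<^bsub>A1R\<^esub> rho \<otimes>\<^bsub>A1R\<^esub> q b) \<bullet> b)"
      by (rule finsum_comb_add[OF F(1) FcM]) (use pq in auto)
    moreover have "\<dots> = (\<Oplus>\<^bsub>M\<^esub>b\<in>F. c b \<bullet> b)"
      by (rule M.finsum_cong') (use pq FcM F(3) in \<open>auto simp: Pi_iff subset_iff\<close>)
    ultimately show ?thesis using sum by (simp only:)
  qed
  \<comment> \<open>Since tau px = rho qy, regularity makes px divisible by rho.\<close>
  obtain z where z: "z \<in> carrier M" "px = rho \<bullet> z"
    using tau_rho_regular[OF E pxqy rel] by blast
  have "z \<in> lspan A1R M B" using z(1) span by blast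
  then obtain F' zc where F': "finite F'" "F' \<subseteq> B" "zc \<in> F' \<rightarrow> carrier A1R" "z = (\<Oplus>\<^bsub>M\<^esub>b\<in>F'. zc b \<bullet> b)"
    unfolding lspan_def by blast
  \<comment> \<open>z may involve basis elements outside \<open>F\<close>, so the new relations live
    on a larger finite set; the induction therefore generalizes over \<open>F\<close>.\<close>
  let ?H = "F \<union> F'"
  have H: "finite ?H" "?H \<subseteq> B" "?H \<subseteq> carrier M" using F F' BM by auto
  define p' q' z' where "p' b = (if b \<in> F then p b else \<zero>\<^bsub>A1R\<^esub>)" and "q' b = (if b \<in> F then q b else \<zero>\<^bsub>A1R\<^esub>)"
    and "z' b = (if b \<in> F' then zc b else \<zero>\<^bsub>A1R\<^esub>)" for b
  have cl: "p' b \<in> carrier A1R" "q' b \<in> carrier A1R" "z' b \<in> carrier A1R" for b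
    using pq F'(3) by (auto simp: p'_def q'_def z'_def)
  have ext: "px = (\<Oplus>\<^bsub>M\<^esub>b\<in>?H. p' b \<bullet> b)" "qy = (\<Oplus>\<^bsub>M\<^esub>b\<in>?H. q' b \<bullet> b)" "z = (\<Oplus>\<^bsub>M\<^esub>b\<in>?H. z' b \<bullet> b)"
    unfolding px_def qy_def F'(4) p'_def q'_def z'_def
    by (rule finsum_extend; use H pq F' in auto)+
  have smz: "a \<bullet> z = (\<Oplus>\<^bsub>M\<^esub>b\<in>?H. (a \<otimes>\<^bsub>A1R\<^esub> z' b) \<bullet> b)" if "a \<in> carrier A1R" for a
    unfolding ext(3) by (rule finsum_comb_smult[OF H(1,3)]) (use cl that in auto)
  define u v where "u b = p' b \<oplus>\<^bsub>A1R\<^esub> rho \<otimes>\<^bsub>A1R\<^esub> z' b" and "v b = q' b \<oplus>\<^bsub>A1R\<^esub> tau \<otimes>\<^bsub>A1R\<^esub> z' b" for b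
  have uv: "u b \<in> carrier A1R" "v b \<in> carrier A1R" for b
    using cl by (simp_all add: u_def v_def)
  have "(\<Oplus>\<^bsub>M\<^esub>b\<in>?H. u b \<bullet> b) = px \<oplus>\<^bsub>M\<^esub> rho \<bullet> z"
    unfolding u_def ext(1) smz[OF A1R_gens(2)]
    by (rule finsum_comb_add[OF H(1,3), symmetric]) (use cl in auto)
  also have "\<dots> = \<zero>\<^bsub>M\<^esub>" unfolding z(2) using z(1) by (simp add: char_two)
  finally have u0: "(\<Oplus>\<^bsub>M\<^esub>b\<in>?H. u b \<bullet> b) = \<zero>\<^bsub>M\<^esub>" .
  have v: "(\<Oplus>\<^bsub>M\<^esub>b\<in>?H. v b \<bullet> b) = qy \<oplus>\<^bsub>M\<^esub> tau \<bullet> z"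
    unfolding v_def ext(2) smz[OF A1R_gens(1)]
    by (rule finsum_comb_add[OF H(1,3), symmetric]) (use cl in auto)
  \<comment> \<open>With px = rho z the given relation becomes rho (qy + tau z) = 0, and rho can be
    cancelled.\<close>
  have "rho \<bullet> (qy \<oplus>\<^bsub>M\<^esub> tau \<bullet> z) = tau \<bullet> px \<oplus>\<^bsub>M\<^esub> rho \<bullet> qy"
    unfolding z(2) using z(1) pxqy(2) by (simp add: smult_r_distr tau_rho_swap M.a_comm)
  then have "rho \<bullet> (qy \<oplus>\<^bsub>M\<^esub> tau \<bullet> z) = \<zero>\<^bsub>M\<^esub>" unfolding rel .
  then have "qy \<oplus>\<^bsub>M\<^esub> tau \<bullet> z = \<zero>\<^bsub>M\<^esub>"
    by (rule rho_cancel[OF E, rotated]) (use z(1) pxqy(2) in simp)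
  with v have v0: "(\<Oplus>\<^bsub>M\<^esub>b\<in>?H. v b \<bullet> b) = \<zero>\<^bsub>M\<^esub>" by simp
  have bH: "b \<in> ?H" using b by simp
  have uF: "u b \<in> filt n"
    by (rule Suc.IH[OF H(1,2) _ u0 bH]) (use uv in auto)
  have vF: "v b \<in> filt n"
    by (rule Suc.IH[OF H(1,2) _ v0 bH]) (use uv in auto)
  \<comment> \<open>The two corrections tau rho z' and rho tau z' agree and cancel in characteristic
    two, so u and v represent the same coefficient as p and q.\<close>
  have "c b = tau \<cdot> u b \<boxplus> rho \<cdot> v b"
  proof -
    have in_AR: "p b \<in> carrier AR" "q b \<in> carrier AR" "z' b \<in> carrier AR"
      using pq(1,2)[OF b] cl(3)[of b] by simp_all
    let ?w = "rho \<cdot> (tau \<cdot> z' b)"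
    have "tau \<cdot> u b \<boxplus> rho \<cdot> v b =
        (tau \<cdot> p b \<boxplus> ?w) \<boxplus> (rho \<cdot> q b \<boxplus> ?w)"
      using b in_AR by (simp add: u_def v_def p'_def q'_def AR.r_distr sq_tau_rho_left(4))
    also have "\<dots> = (tau \<cdot> p b \<boxplus> rho \<cdot> q b) \<boxplus> (?w \<boxplus> ?w)"
      using in_AR by (simp add: AR.a_ac)
    also have "\<dots> = c b"
      using in_AR pq(3)[OF b] by (simp add: AR_char_two)
    finally show ?thesis by (rule sym)
  qed
  then show ?case using uF vF by auto
qed

lemma reduction_basis_lift:
  assumes fg: "finitely_generated_module A1R M" and BG: "B \<subseteq> (\<Union>d. G d)" and inj: "inj_on red B"
    and basis: "module_basis F2A1R FM (red ` B)" and E: "module_basis M2R M E"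
  shows "module_basis A1R M B"
proof -
  have BM: "B \<subseteq> carrier M" using BG G_carrier by blast
  have span: "carrier M \<subseteq> lspan A1R M B"
    using graded_nakayama[OF fg BG] reduction_span[OF BM basis] by blast
  show ?thesis
    unfolding module_basis_def
  proof (intro conjI ballI allI impI)
    show "B \<subseteq> carrier M" by (rule BM)
    show "\<exists>F c. finite F \<and> F \<subseteq> B \<and> c \<in> F \<rightarrow> carrier A1R \<and> x = (\<Oplus>\<^bsub>M\<^esub>b\<in>F. c b \<bullet> b)" if "x \<in> carrier M" for x
      using span that unfolding lspan_def by blast
  next
    fix F c b
    assume F: "finite F \<and> F \<subseteq> B \<and> c \<in> F \<rightarrow> carrier A1R \<and> (\<Oplus>\<^bsub>M\<^esub>b\<in>F. c b \<bullet> b) = \<zero>\<^bsub>M\<^esub>" and b: "b \<in> F"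
    have "c b \<in> filt n" for n
      using independent_filt[OF BM inj basis E span] F b by blast
    then show "c b = \<zero>\<^bsub>A1R\<^esub>" using filt_Inter[of "c b"] by simp
  qed
qed

end

theorem theorem1p18:
  fixes M :: "(steenrod, 'm) module" and G :: "int \<times> int \<Rightarrow> 'm set"
  assumes "bigraded_left_module A1R M A1R_grading G"
    and "finitely_generated_module A1R M"
  shows "bigraded_free A1R M G \<longleftrightarrow>
    bigraded_free M2R M G \<and> bigraded_free F2A1R (F2_tensor M) (F2_tensor_grading M G)"
proof -
  interpret A1R_bigraded M G using assms(1) by (simp add: A1R_bigraded_def)
  show ?thesis
  proof
    assume "bigraded_free A1R M G"
    then obtain B where BG: "B \<subseteq> (\<Union>d. G d)" and B: "module_basis A1R M B"
      unfolding bigraded_free_def by blast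
    have "(\<lambda>(k, b). sq_basis k \<odot>\<^bsub>M\<^esub> b) ` ({..<8} \<times> B) \<subseteq> (\<Union>d. G d)"
    proof (intro image_subsetI, elim SigmaE)
      fix x k b assume "k \<in> {..<8::nat}" and b: "b \<in> B" and x: "x = (k, b)"
      then obtain d where "sq_basis k \<in> A1R_grading d" using sq_basis_graded by blast
      moreover obtain e where "b \<in> G e" using b BG by blast
      ultimately have "sq_basis k \<odot>\<^bsub>M\<^esub> b \<in> (\<Union>d. G d)" using smult_graded by blast
      then show "(case x of (k, b) \<Rightarrow> sq_basis k \<odot>\<^bsub>M\<^esub> b) \<in> (\<Union>d. G d)" unfolding x by simp
    qed
    then have "bigraded_free M2R M G"
      using free_imp_M2R_basis[OF B] unfolding bigraded_free_def by blast
    moreover have "red ` B \<subseteq> (\<Union>d. F2_tensor_grading M G d)"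
      using BG unfolding F2_tensor_grading_def by blast
    then have "bigraded_free F2A1R (F2_tensor M) (F2_tensor_grading M G)"
      using free_imp_reduction_basis[OF B] unfolding bigraded_free_def by blast
    ultimately show "bigraded_free M2R M G \<and> bigraded_free F2A1R (F2_tensor M) (F2_tensor_grading M G)" ..
  next
    assume "bigraded_free M2R M G \<and> bigraded_free F2A1R (F2_tensor M) (F2_tensor_grading M G)"
    then obtain E C where E: "module_basis M2R M E"
      and C: "C \<subseteq> (\<Union>d. F2_tensor_grading M G d)" "module_basis F2A1R (F2_tensor M) C"
      unfolding bigraded_free_def by blast
    \<comment> \<open>A homogeneous coset is by definition the coset of a homogeneous element, so
      homogeneous lifts exist. The chosen lift g is a section of \<open>red\<close>, which makes
      \<open>red\<close> injective on its image.\<close>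
    have "\<forall>u\<in>C. \<exists>x. x \<in> (\<Union>d. G d) \<and> red x = u"
      using C(1) unfolding F2_tensor_grading_def by blast
    then obtain g where g: "\<And>u. u \<in> C \<Longrightarrow> g u \<in> (\<Union>d. G d)" "\<And>u. u \<in> C \<Longrightarrow> red (g u) = u" by metis
    have "red ` g ` C = C" using g(2) by (force simp: image_iff)
    moreover have "inj_on red (g ` C)" by (rule inj_onI) (use g(2) in auto)
    ultimately have "module_basis A1R M (g ` C)"
      using reduction_basis_lift[OF assms(2) _ _ _ E, of "g ` C"] g(1) C(2) by (simp add: image_subset_iff)
    then show "bigraded_free A1R M G"
      unfolding bigraded_free_def using g(1) by blast
  qed
qed

end
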